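(* If $R$ is a Noetherian local ring and $I\subset R$ is an ideal of positive codimension, then $$\ell(I)\le \dim R-\limsup_{j\to\infty}\operatorname{depth} I^j+1 .$$
   Context: $\ell(I)$ denotes the analytic spread of $I$, i.e. the Krull dimension of $\mathcal R/\mathfrak m\mathcal R$, where $\mathcal R=\bigoplus_{j\ge 0}I^j$ is the Rees algebra of $I$ and $\mathfrak m$ is the maximal ideal of $R$. Here $\operatorname{depth} I^j$ is the depth of $I^j$ as an $R$-module, and codimension means height. *)

theory Defs
  imports
    "HOL-Algebra.UnivPoly"
    "HOL-Algebra.Ideal_Product"
    "HOL-Algebra.QuotRing"
    "HOL-Algebra.Ring_Divisibility"
    "HOL-Library.Extended_Real"
begin

locale local_ring = cring R + maximalideal \<mm> R for R (structure) and \<mm> +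
  assumes unique_maximal: "maximalideal J R \<Longrightarrow> J = \<mm>"


subsection \<open>Krull dimension and codimension\<close>

definition prime_chain :: "('a, 'b) ring_scheme \<Rightarrow> nat \<Rightarrow> (nat \<Rightarrow> 'a set) \<Rightarrow> bool" where
  "prime_chain R n P \<longleftrightarrow> (\<forall>i\<le>n. primeideal (P i) R) \<and> (\<forall>i<n. P i \<subset> P (Suc i))"

text \<open>The supremum is taken in the extended reals, so the zero ring has dimension \<open>-\<infinity>\<close>.\<close>

definition krull_dim :: "('a, 'b) ring_scheme \<Rightarrow> ereal" where
  "krull_dim R = Sup {ereal (real n) | n. \<exists>P. prime_chain R n P}"

definition prime_height :: "('a, 'b) ring_scheme \<Rightarrow> 'a set \<Rightarrow> ereal" where
  "prime_height R \<pp> = Sup {ereal (real n) | n. \<exists>P. prime_chain R n P \<and> P n = \<pp>}"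

text \<open>The unit ideal has codimension \<open>\<infinity>\<close>, the infimum of the empty set.\<close>

definition codim :: "('a, 'b) ring_scheme \<Rightarrow> 'a set \<Rightarrow> ereal" where
  "codim R I = Inf {prime_height R \<pp> | \<pp>. primeideal \<pp> R \<and> I \<subseteq> \<pp>}"


subsection \<open>Rees algebra and analytic spread\<close>

abbreviation ideal_power :: "('a, 'b) ring_scheme \<Rightarrow> 'a set \<Rightarrow> nat \<Rightarrow> 'a set" where
  "ideal_power R I j \<equiv> I [^]\<^bsub>ideals_set R\<^esub> j"

text \<open>
  An element of \<open>\<Oplus>\<^sub>j I\<^sup>j\<close> is a finitely supported family \<open>p\<close> with \<open>p j \<in> I\<^sup>j\<close>. Such families
  are polynomials over \<open>R\<close>, and the product of the Rees algebra is that of polynomials.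
\<close>

definition rees_algebra :: "('a, 'b) ring_scheme \<Rightarrow> 'a set \<Rightarrow> ('a, nat \<Rightarrow> 'a) up_ring" where
  "rees_algebra R I = (UP R)
     \<lparr>carrier := {p \<in> carrier (UP R). \<forall>j. coeff (UP R) p j \<in> ideal_power R I j}\<rparr>"

text \<open>The ideal \<open>\<mm>\<R>\<close> generated by \<open>\<mm>\<close>, viewed inside the degree zero part of the Rees algebra.\<close>

definition rees_extension :: "('a, 'b) ring_scheme \<Rightarrow> 'a set \<Rightarrow> 'a set \<Rightarrow> (nat \<Rightarrow> 'a) set" where
  "rees_extension R I \<mm> = Idl\<^bsub>rees_algebra R I\<^esub> ((\<lambda>a. monom (UP R) a 0) ` \<mm>)"

definition analytic_spread :: "('a, 'b) ring_scheme \<Rightarrow> 'a set \<Rightarrow> 'a set \<Rightarrow> ereal" where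
  "analytic_spread R \<mm> I = krull_dim (rees_algebra R I Quot rees_extension R I \<mm>)"


subsection \<open>Depth\<close>

text \<open>The submodule \<open>(A)M\<close>; the set \<open>A\<close> of scalars need not be an ideal.\<close>

definition smult_span ::
    "('a, 'b) ring_scheme \<Rightarrow> 'a set \<Rightarrow> ('a, 'c, 'd) module_scheme \<Rightarrow> 'c set" where
  "smult_span R A M =
     \<Inter>{N. submodule N R M \<and> (\<forall>a\<in>A. \<forall>v\<in>carrier M. a \<odot>\<^bsub>M\<^esub> v \<in> N)}"

text \<open>
  That \<open>xs ! i\<close> is a nonzerodivisor on \<open>M/(xs ! 0, \<dots>, xs ! (i - 1))M\<close> is expressed by
  representatives in \<open>M\<close>.
\<close>

definition regular_sequence ::
    "('a, 'b) ring_scheme \<Rightarrow> ('a, 'c, 'd) module_scheme \<Rightarrow> 'a list \<Rightarrow> bool" where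
  "regular_sequence R M xs \<longleftrightarrow>
     set xs \<subseteq> carrier R \<and>
     (\<forall>i<length xs. \<forall>v\<in>carrier M.
        xs ! i \<odot>\<^bsub>M\<^esub> v \<in> smult_span R (set (take i xs)) M \<longrightarrow>
        v \<in> smult_span R (set (take i xs)) M) \<and>
     smult_span R (set xs) M \<noteq> carrier M"

text \<open>
  Depth of a finitely generated module over a Noetherian local ring with maximal ideal \<open>\<mm>\<close>.
  The zero module has depth \<open>\<infinity>\<close>.
\<close>

definition depth ::
    "('a, 'b) ring_scheme \<Rightarrow> 'a set \<Rightarrow> ('a, 'c, 'd) module_scheme \<Rightarrow> ereal" where
  "depth R \<mm> M =
     (if carrier M = {\<zero>\<^bsub>M\<^esub>} then \<infinity>
      else Sup {ereal (real (length xs)) | xs. set xs \<subseteq> \<mm> \<and> regular_sequence R M xs})"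

text \<open>
  Module records extend ring records, but the locale \<open>module\<close> ignores the fields \<open>mult\<close>
  and \<open>one\<close>; their values here are irrelevant.
\<close>

definition ideal_as_module :: "('a, 'b) ring_scheme \<Rightarrow> 'a set \<Rightarrow> ('a, 'a) module" where
  "ideal_as_module R J =
     \<lparr>carrier = J, monoid.mult = (\<otimes>\<^bsub>R\<^esub>), one = \<one>\<^bsub>R\<^esub>, zero = \<zero>\<^bsub>R\<^esub>, add = (\<oplus>\<^bsub>R\<^esub>), smult = (\<otimes>\<^bsub>R\<^esub>)\<rparr>"

end

theory Submission
  imports Defs "HOL-Algebra.Subrings" "HOL-Library.Product_Plus"
begin

text \<open>
  Let \<open>d\<close> be the dimension of \<open>R\<close>, assume \<open>depth I\<^sup>j \<ge> k\<close> for infinitely many \<open>j\<close>, and write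
  \<open>\<mu>\<close> for the minimal number of generators. Stability of graded families of ideals and the
  exchange property of regular sequences give \<open>x\<^sub>1, \<dots>, x\<^sub>k \<in> \<mm>\<close> forming a regular sequence on
  \<open>I\<^sup>j\<close> for all large \<open>j\<close>. With \<open>J = (x\<^sub>1, \<dots>, x\<^sub>k) I\<close> it follows that \<open>\<mu>(J\<^sup>j)\<close> is at least
  \<open>\<mu>(I\<^sup>j)\<close> times the number of monomials of degree \<open>j\<close> in \<open>k\<close> variables. On the other hand
  \<open>\<mu>(J\<^sup>0) + \<dots> + \<mu>(J\<^sup>N) = O(N\<^sup>d)\<close>: by the Artin-Rees lemma the fiber cone of \<open>J\<close> embeds into that
  of the \<open>\<mm>\<close>-primary ideal \<open>J + \<mm>\<^sup>a\<close> for large \<open>a\<close>, where lengths are bounded through a system of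
  parameters. Finally, a chain of \<open>n + 1\<close> primes in the fiber cone of \<open>I\<close> yields \<open>n\<close>
  algebraically independent elements, so that \<open>\<mu>(I\<^sup>0) + \<dots> + \<mu>(I\<^sup>N)\<close> grows at least like \<open>N\<^sup>n\<close>.
  Comparing the growth rates gives \<open>n + k \<le> d + 1\<close>. In this way neither the dimension of the Rees
  algebra nor the Hilbert polynomial enters.
\<close>

no_notation Sum_Type.Plus (infixr \<open><+>\<close> 65)

section \<open>Ideals and chain conditions\<close>

text \<open>The bound has a heuristic source: for a chain of n + 1 primes in the fiber cone, the
  minimal number of generators of I^j grows on average at least like j^(n-1), and there are about
  j^(k-1) monomials of degree j in k variables. Summing the products up to N gives N^(n+k-1), which
  has to be O(N^d). Multiplying I by the regular sequence thus converts depth into growth, which is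
  the reason for passing to J. The obstacle is that depth is given only for infinitely many j, with
  a sequence that may change with j, whereas the count needs one sequence for all large j. Another
  is that nothing is known about the regularity of the generator counts, so they are compared over
  dyadic blocks. The modules whose depth matters are quotients N/U of ideals, represented by the
  pair N, U, so that dividing by x N only enlarges U. Dimensions over the residue field are read off
  from lists that are independent modulo a submodule. Positive codimension keeps every power of I
  nonzero, so that depth does not take the value infinity reserved for the zero module.\<close>

lemma (in ring) ideal_facts:
  assumes "ideal A R"
  shows "A \<subseteq> carrier R" "\<zero> \<in> A"
    and "\<And>x y. x \<in> A \<Longrightarrow> y \<in> A \<Longrightarrow> x \<oplus> y \<in> A"
    and "\<And>x y. x \<in> A \<Longrightarrow> y \<in> A \<Longrightarrow> x \<ominus> y \<in> A"
    and "\<And>x. x \<in> A \<Longrightarrow> \<ominus> x \<in> A"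
    and "\<And>r x. r \<in> carrier R \<Longrightarrow> x \<in> A \<Longrightarrow> r \<otimes> x \<in> A"
    and "\<And>r x. r \<in> carrier R \<Longrightarrow> x \<in> A \<Longrightarrow> x \<otimes> r \<in> A"
proof -
  interpret ideal A R by fact
  show "A \<subseteq> carrier R" "\<zero> \<in> A" by (auto simp: a_subset)
  show "x \<in> A \<Longrightarrow> y \<in> A \<Longrightarrow> x \<oplus> y \<in> A" for x y by auto
  show "x \<in> A \<Longrightarrow> y \<in> A \<Longrightarrow> x \<ominus> y \<in> A" for x y by (auto simp: a_minus_def)
  show "x \<in> A \<Longrightarrow> \<ominus> x \<in> A" for x by auto
  show "r \<in> carrier R \<Longrightarrow> x \<in> A \<Longrightarrow> r \<otimes> x \<in> A" for r x by (rule I_l_closed)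
  show "r \<in> carrier R \<Longrightarrow> x \<in> A \<Longrightarrow> x \<otimes> r \<in> A" for r x by (rule I_r_closed)
qed

section \<open>Arithmetic of sums, products, powers and principal multiples of ideals\<close>

context cring
begin

lemma ideal_intro:
  assumes "A \<subseteq> carrier R" "\<zero> \<in> A"
    and add: "\<And>x y. x \<in> A \<Longrightarrow> y \<in> A \<Longrightarrow> x \<oplus> y \<in> A"
    and mult: "\<And>r x. r \<in> carrier R \<Longrightarrow> x \<in> A \<Longrightarrow> r \<otimes> x \<in> A"
  shows "ideal A R"
proof (rule idealI[OF ring_axioms])
  have neg: "\<ominus> x \<in> A" if "x \<in> A" for x
  proof -
    have "(\<ominus> \<one>) \<otimes> x \<in> A" using that mult by blast
    thus ?thesis using that assms(1) by (simp add: subset_iff l_minus)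
  qed
  show "subgroup A (add_monoid R)"
    by (rule add.subgroupI) (use assms neg in \<open>auto simp: a_inv_def[symmetric]\<close>)
  show "a \<in> A \<Longrightarrow> x \<in> carrier R \<Longrightarrow> x \<otimes> a \<in> A" for a x by (rule mult)
  show "a \<in> A \<Longrightarrow> x \<in> carrier R \<Longrightarrow> a \<otimes> x \<in> A" for a x
    using mult[of x a] assms(1) m_comm[of a x] by auto
qed

lemma set_add_iff: "x \<in> A <+> B \<longleftrightarrow> (\<exists>a\<in>A. \<exists>b\<in>B. x = a \<oplus> b)"
  by (auto simp: set_add_def')

lemma set_add_upper:
  assumes "ideal A R" "ideal B R"
  shows "A \<subseteq> A <+> B" "B \<subseteq> A <+> B"
  using ideal_facts(1,2)[OF assms(1)] ideal_facts(1,2)[OF assms(2)]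
  by (force simp: set_add_iff)+

lemma set_add_least:
  assumes "ideal C R" "A \<subseteq> C" "B \<subseteq> C"
  shows "A <+> B \<subseteq> C"
  using assms ideal_facts(3)[OF assms(1)] by (fastforce simp: set_add_iff)

lemma set_add_mono:
  assumes "A \<subseteq> A'" "B \<subseteq> B'" shows "A <+> B \<subseteq> A' <+> B'"
  using assms by (fastforce simp: set_add_iff)

lemma add_ideals_assoc:
  assumes "ideal A R" "ideal B R" "ideal C R"
  shows "(A <+> B) <+> C = A <+> (B <+> C)"
  using assms ideal_facts(1) by (intro add.set_mult_assoc[folded set_add_def]) auto

lemma add_ideals_comm:
  assumes "ideal A R" "ideal B R"
  shows "A <+> B = B <+> A"
  using assms ideal_facts(1) by (intro set_add_comm) auto

lemma ideal_prod_mono: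
  assumes "A \<subseteq> A'" "B \<subseteq> B'"
  shows "A \<cdot> B \<subseteq> A' \<cdot> B'"
proof
  fix x assume "x \<in> A \<cdot> B"
  thus "x \<in> A' \<cdot> B'"
    by induction (use assms in \<open>auto intro: ideal_prod.intros\<close>)
qed

lemma ideal_prod_least:
  assumes "ideal C R" "\<And>a b. a \<in> A \<Longrightarrow> b \<in> B \<Longrightarrow> a \<otimes> b \<in> C"
  shows "A \<cdot> B \<subseteq> C"
proof
  fix x assume "x \<in> A \<cdot> B"
  thus "x \<in> C"
    by induction (use assms ideal_facts(3)[OF assms(1)] in auto)
qed

lemma ideal_prod_absorb:
  assumes "ideal A R" "B \<subseteq> carrier R"
  shows "B \<cdot> A \<subseteq> A" "A \<cdot> B \<subseteq> A"
  by (rule ideal_prod_least; use assms ideal_facts[OF assms(1)] in auto)+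

lemma carrier_prod: "ideal A R \<Longrightarrow> carrier R \<cdot> A = A"
  by (simp add: ideal_prod_commute ideal_prod_one oneideal)

lemma ideal_prod_left_commute:
  assumes "ideal A R" "ideal B R" "ideal C R"
  shows "A \<cdot> (B \<cdot> C) = B \<cdot> (A \<cdot> C)"
  using assms by (metis ideal_prod_assoc ideal_prod_commute)

lemmas ideal_prod_ac = ideal_prod_assoc ideal_prod_commute ideal_prod_left_commute

lemma ideals_set_simps [simp]:
  "\<one>\<^bsub>ideals_set R\<^esub> = carrier R" "A \<otimes>\<^bsub>ideals_set R\<^esub> B = A \<cdot> B"
  by (simp_all add: ideals_set_def)

lemma ideal_power_0 [simp]: "ideal_power R A 0 = carrier R"
  by simp

lemma ideal_power_Suc [simp]: "ideal_power R A (Suc n) = ideal_power R A n \<cdot> A"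
  by simp

lemma ideal_power_ideal [simp, intro]: "ideal A R \<Longrightarrow> ideal (ideal_power R A n) R"
  by (induction n) (simp_all add: oneideal ideal_prod_is_ideal)

lemma ideal_power_1: "ideal A R \<Longrightarrow> ideal_power R A 1 = A"
  by (simp add: carrier_prod)

lemma ideal_power_add:
  assumes "ideal A R"
  shows "ideal_power R A (m + n) = ideal_power R A m \<cdot> ideal_power R A n"
  by (induction n) (simp_all add: assms ideal_prod_one ideal_prod_assoc)

lemma ideal_power_antimono:
  assumes "ideal A R" "m \<le> n"
  shows "ideal_power R A n \<subseteq> ideal_power R A m"
proof -
  obtain k where n: "n = m + k" using assms(2) le_Suc_ex by blast
  show ?thesis
    unfolding n ideal_power_add[OF assms(1)]
    by (intro ideal_prod_absorb) (use assms ideal_facts(1) in auto)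
qed

lemma ideal_power_mono:
  assumes "A \<subseteq> B"
  shows "ideal_power R A n \<subseteq> ideal_power R B n"
  by (induction n) (simp_all add: assms ideal_prod_mono)

lemma ideal_power_mult_distrib:
  assumes "ideal A R" "ideal B R"
  shows "ideal_power R (A \<cdot> B) n = ideal_power R A n \<cdot> ideal_power R B n"
proof (induction n)
  case 0 show ?case by (simp add: ideal_prod_one oneideal)
next
  case (Suc n)
  have "ideal_power R (A \<cdot> B) (Suc n) = (ideal_power R A n \<cdot> ideal_power R B n) \<cdot> (A \<cdot> B)"
    by (simp add: Suc)
  also have "\<dots> = (ideal_power R A n \<cdot> A) \<cdot> (ideal_power R B n \<cdot> B)"
    using assms by (simp add: ideal_prod_assoc ideal_prod_left_commute ideal_prod_is_ideal)
  finally show ?case by simp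
qed

definition multiples :: "'a \<Rightarrow> 'a set \<Rightarrow> 'a set" where
  "multiples x N = (\<lambda>v. x \<otimes> v) ` N"

lemma multiples_ideal [simp, intro]:
  assumes "x \<in> carrier R" "ideal N R"
  shows "ideal (multiples x N) R"
proof (rule ideal_intro)
  note N = ideal_facts[OF assms(2)]
  show "multiples x N \<subseteq> carrier R" using assms(1) N by (auto simp: multiples_def)
  show "\<zero> \<in> multiples x N" using assms(1) N(2) by (force simp: multiples_def)
  fix y z assume "y \<in> multiples x N" "z \<in> multiples x N"
  then obtain v w where vw: "v \<in> N" "w \<in> N" "y = x \<otimes> v" "z = x \<otimes> w"
    by (auto simp: multiples_def)
  hence "y \<oplus> z = x \<otimes> (v \<oplus> w)" using assms(1) N(1) by (auto simp: r_distr subset_iff)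
  thus "y \<oplus> z \<in> multiples x N" using vw N(3) by (auto simp: multiples_def)
next
  note N = ideal_facts[OF assms(2)]
  fix r y assume "r \<in> carrier R" "y \<in> multiples x N"
  then obtain v where v: "v \<in> N" "y = x \<otimes> v" by (auto simp: multiples_def)
  hence "r \<otimes> y = x \<otimes> (r \<otimes> v)"
    using assms(1) \<open>r \<in> carrier R\<close> N(1) by (auto simp: subset_iff m_lcomm)
  thus "r \<otimes> y \<in> multiples x N" using v N(6) \<open>r \<in> carrier R\<close> by (auto simp: multiples_def)
qed

lemma multiples_mono: "N \<subseteq> N' \<Longrightarrow> multiples x N \<subseteq> multiples x N'"
  by (auto simp: multiples_def)

lemma multiplesI: "v \<in> N \<Longrightarrow> x \<otimes> v \<in> multiples x N"
  by (auto simp: multiples_def)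

lemma multiples_le: "ideal N R \<Longrightarrow> x \<in> carrier R \<Longrightarrow> multiples x N \<subseteq> N"
  by (auto simp: multiples_def intro: ideal_facts(6))

lemma multiples_prod:
  assumes "x \<in> carrier R" "ideal A R" "ideal B R"
  shows "multiples x A \<cdot> B = multiples x (A \<cdot> B)"
proof
  note A = ideal_facts[OF assms(2)] and B = ideal_facts[OF assms(3)]
  show "multiples x A \<cdot> B \<subseteq> multiples x (A \<cdot> B)"
  proof (rule ideal_prod_least)
    show "ideal (multiples x (A \<cdot> B)) R" using assms by (simp add: ideal_prod_is_ideal)
    fix a b assume "a \<in> multiples x A" "b \<in> B"
    then obtain a' where a: "a' \<in> A" "a = x \<otimes> a'" by (auto simp: multiples_def)
    hence "a \<otimes> b = x \<otimes> (a' \<otimes> b)"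
      using assms(1) A(1) B(1) \<open>b \<in> B\<close> by (auto simp: m_assoc subset_iff)
    thus "a \<otimes> b \<in> multiples x (A \<cdot> B)"
      using a \<open>b \<in> B\<close> by (auto simp: multiples_def intro: ideal_prod.prod)
  qed
  show "multiples x (A \<cdot> B) \<subseteq> multiples x A \<cdot> B"
  proof
    fix z assume "z \<in> multiples x (A \<cdot> B)"
    then obtain w where w: "w \<in> A \<cdot> B" "z = x \<otimes> w" by (auto simp: multiples_def)
    have "w \<in> carrier R \<and> x \<otimes> w \<in> multiples x A \<cdot> B" using w(1)
    proof induction
      case (prod i j)
      have "x \<otimes> (i \<otimes> j) = (x \<otimes> i) \<otimes> j"
        using prod A(1) B(1) assms(1) by (auto simp: m_assoc subset_iff)
      thus ?case using prod A(1) B(1) by (auto simp: multiples_def intro: ideal_prod.prod)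
    next
      case (sum s1 s2)
      thus ?case using assms(1) by (auto simp: r_distr intro: ideal_prod.sum)
    qed
    thus "z \<in> multiples x A \<cdot> B" using w by simp
  qed
qed

lemma prod_multiples:
  assumes "x \<in> carrier R" "ideal A R" "ideal B R"
  shows "B \<cdot> multiples x A = multiples x (B \<cdot> A)"
  using assms multiples_prod[OF assms] by (simp add: ideal_prod_commute)

lemma multiples_add:
  assumes "x \<in> carrier R" "ideal A R" "ideal B R"
  shows "multiples x (A <+> B) = multiples x A <+> multiples x B"
proof -
  have "x \<otimes> (a \<oplus> b) = x \<otimes> a \<oplus> x \<otimes> b" if "a \<in> A" "b \<in> B" for a b
    using that assms(1) ideal_facts(1)[OF assms(2)] ideal_facts(1)[OF assms(3)]
    by (auto simp: r_distr subset_iff)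
  thus ?thesis by (force simp: multiples_def set_add_iff)
qed

lemma Int_ideal: "ideal A R \<Longrightarrow> ideal B R \<Longrightarrow> ideal (A \<inter> B) R"
  by (rule i_intersect)

lemma UN_chain_ideal:
  fixes f :: "nat \<Rightarrow> 'a set"
  assumes "\<And>i. ideal (f i) R" "\<And>i. f i \<subseteq> f (Suc i)"
  shows "ideal (\<Union>i. f i) R"
proof -
  have mono: "f i \<subseteq> f j" if "i \<le> j" for i j
    using assms(2) that by (rule lift_Suc_mono_le)
  show ?thesis
  proof (rule ideal_intro)
    show "(\<Union>i. f i) \<subseteq> carrier R" "\<zero> \<in> (\<Union>i. f i)"
      using ideal_facts(1,2)[OF assms(1)] by auto
    fix x y assume "x \<in> (\<Union>i. f i)" "y \<in> (\<Union>i. f i)"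
    then obtain i j where "x \<in> f i" "y \<in> f j" by auto
    hence "x \<in> f (max i j)" "y \<in> f (max i j)" using mono by (meson max.cobounded1 max.cobounded2 subsetD)+
    thus "x \<oplus> y \<in> (\<Union>i. f i)" using ideal_facts(3)[OF assms(1)] by auto
  next
    fix r x assume "r \<in> carrier R" "x \<in> (\<Union>i. f i)"
    thus "r \<otimes> x \<in> (\<Union>i. f i)" using ideal_facts(6)[OF assms(1)] by auto
  qed
qed

end

section \<open>Chain condition, Noetherian induction and maximal elements\<close>

locale noetherian_cring = cring R + noetherian_ring R for R (structure)
begin

lemma acc:
  fixes f :: "nat \<Rightarrow> 'a set"
  assumes "\<And>i. ideal (f i) R" "\<And>i. f i \<subseteq> f (Suc i)"
  shows "\<exists>N. \<forall>i\<ge>N. f i = f N"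
proof -
  have mono: "f i \<subseteq> f j" if "i \<le> j" for i j
    using assms(2) that by (rule lift_Suc_mono_le)
  obtain S where S: "S \<subseteq> carrier R" "finite S" "(\<Union>i. f i) = Idl S"
    using finetely_gen[OF UN_chain_ideal[of f, OF assms]] by blast
  have "S \<subseteq> (\<Union>i. f i)" using S genideal_self by simp
  have "\<exists>N. S' \<subseteq> f N" if "finite S'" "S' \<subseteq> (\<Union>i. f i)" for S'
    using that
  proof (induction S')
    case (insert x F)
    then obtain N M where NM: "F \<subseteq> f N" "x \<in> f M" by auto
    thus ?case using mono[of N "max N M"] mono[of M "max N M"]
      by (intro exI[of _ "max N M"]) auto
  qed simp
  then obtain N where N: "S \<subseteq> f N" using S(2) \<open>S \<subseteq> (\<Union>i. f i)\<close> by blast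
  hence "(\<Union>i. f i) \<subseteq> f N" unfolding S(3) by (intro genideal_minimal assms(1))
  thus ?thesis using mono by (intro exI[of _ N]) blast
qed

lemma ideal_noetherian_induct [consumes 1, case_names step]:
  assumes "ideal U R"
    and step: "\<And>U. ideal U R \<Longrightarrow> (\<And>V. ideal V R \<Longrightarrow> U \<subset> V \<Longrightarrow> Q V) \<Longrightarrow> Q U"
  shows "Q U"
proof -
  define r where "r = {(V, U). ideal U R \<and> ideal V R \<and> U \<subset> V}"
  have "wf r"
  proof (rule ccontr)
    assume "\<not> wf r"
    then obtain f where f: "\<And>i. (f (Suc i), f i) \<in> r"
      unfolding wf_iff_no_infinite_down_chain by blast
    hence "\<And>i. ideal (f i) R" "\<And>i. f i \<subset> f (Suc i)" by (auto simp: r_def)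
    thus False using acc[of f] by (metis le_Suc_eq order_refl psubset_eq)
  qed
  thus ?thesis using assms(1)
  proof (induction U rule: wf_induct_rule)
    case (less U)
    show ?case by (rule step[OF less.prems]) (rule less.IH; use less.prems in \<open>auto simp: r_def\<close>)
  qed
qed

lemma maximal_element:
  assumes "\<A> \<noteq> {}" "\<And>A. A \<in> \<A> \<Longrightarrow> ideal A R" "A \<in> \<A>"
  obtains M where "M \<in> \<A>" "A \<subseteq> M" "\<And>B. B \<in> \<A> \<Longrightarrow> M \<subseteq> B \<Longrightarrow> B = M"
proof -
  have "ideal A R" using assms by blast
  hence "A \<in> \<A> \<Longrightarrow> \<exists>M\<in>\<A>. A \<subseteq> M \<and> (\<forall>B\<in>\<A>. M \<subseteq> B \<longrightarrow> B = M)"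
  proof (induction A rule: ideal_noetherian_induct)
    case (step U)
    show ?case
    proof (cases "\<forall>B\<in>\<A>. U \<subseteq> B \<longrightarrow> B = U")
      case True thus ?thesis using step.prems by blast
    next
      case False
      then obtain B where "B \<in> \<A>" "U \<subset> B" by blast
      thus ?thesis using step.IH[of B] assms(2) by (meson psubset_imp_subset subset_trans)
    qed
  qed
  then obtain M where "M \<in> \<A>" "A \<subseteq> M" "\<forall>B\<in>\<A>. M \<subseteq> B \<longrightarrow> B = M"
    using assms(3) by meson
  thus ?thesis by (intro that) blast+
qed

end

subsection \<open>Prime avoidance\<close>

context cring
begin

lemma primeideal_facts:
  assumes "primeideal P R"
  shows "ideal P R" "P \<noteq> carrier R" "\<one> \<notin> P"
    "\<And>a b. a \<in> carrier R \<Longrightarrow> b \<in> carrier R \<Longrightarrow> a \<otimes> b \<in> P \<Longrightarrow> a \<in> P \<or> b \<in> P"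
proof -
  interpret primeideal P R by fact
  show "ideal P R" by (rule is_ideal)
  show "P \<noteq> carrier R" using I_notcarr by blast
  thus "\<one> \<notin> P" using one_imp_carrier by blast
  show "\<And>a b. a \<in> carrier R \<Longrightarrow> b \<in> carrier R \<Longrightarrow> a \<otimes> b \<in> P \<Longrightarrow> a \<in> P \<or> b \<in> P"
    by (rule I_prime)
qed

lemma primeideal_prod_le:
  assumes "primeideal P R" "ideal A R" "ideal B R" "A \<cdot> B \<subseteq> P"
  shows "A \<subseteq> P \<or> B \<subseteq> P"
proof (rule ccontr)
  assume "\<not> ?thesis"
  then obtain a b where ab: "a \<in> A" "a \<notin> P" "b \<in> B" "b \<notin> P" by blast
  hence "a \<otimes> b \<in> P" using assms(4) by (blast intro: ideal_prod.prod)
  thus False using primeideal_facts(4)[OF assms(1), of a b] ab ideal_facts(1)[OF assms(2)]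
    ideal_facts(1)[OF assms(3)] by blast
qed

lemma primeideal_power_le:
  assumes "primeideal P R" "ideal A R" "ideal_power R A n \<subseteq> P"
  shows "A \<subseteq> P"
  using assms(3)
proof (induction n)
  case 0 thus ?case using primeideal_facts[OF assms(1)] one_closed by auto
next
  case (Suc n) thus ?case
    using primeideal_prod_le[OF assms(1) ideal_power_ideal[OF assms(2)] assms(2), of n] by auto
qed

text \<open>The witness is the product of an element of \<open>J\<close> outside \<open>P\<close>
  with one element of each \<open>Q\<close> outside \<open>P\<close>; primality of \<open>P\<close>
  keeps the product outside \<open>P\<close>.\<close>

lemma prime_not_in_Inter:
  assumes "primeideal P R" "ideal J R" "\<not> J \<subseteq> P" "finite \<Q>"
    "\<And>Q. Q \<in> \<Q> \<Longrightarrow> ideal Q R \<and> \<not> Q \<subseteq> P"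
  shows "\<exists>y\<in>J. y \<notin> P \<and> (\<forall>Q\<in>\<Q>. y \<in> Q)"
  using assms(4,5)
proof (induction \<Q>)
  case empty thus ?case using assms(3) by blast
next
  case (insert Q \<Q>)
  then obtain y where y: "y \<in> J" "y \<notin> P" "\<forall>Q\<in>\<Q>. y \<in> Q" by blast
  obtain z where z: "z \<in> Q" "z \<notin> P" using insert.prems by blast
  have c: "y \<in> carrier R" "z \<in> carrier R"
    using y z insert.prems[of Q] ideal_facts(1)[of Q] ideal_facts(1)[OF assms(2)] by auto
  have "y \<otimes> z \<notin> P" using primeideal_facts(4)[OF assms(1)] y z c by blast
  moreover have "y \<otimes> z \<in> J" using ideal_facts(7)[OF assms(2)] y c by blast
  moreover have "y \<otimes> z \<in> Q" using ideal_facts(6)[of Q] insert.prems z c by blast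
  moreover have "\<forall>Q'\<in>\<Q>. y \<otimes> z \<in> Q'" using y c ideal_facts(7) insert.prems by blast
  ultimately show ?case by blast
qed

lemma prime_avoidance:
  assumes "ideal J R" "finite \<P>" "\<And>P. P \<in> \<P> \<Longrightarrow> primeideal P R" "\<And>P. P \<in> \<P> \<Longrightarrow> \<not> J \<subseteq> P"
  shows "\<exists>x\<in>J. \<forall>P\<in>\<P>. x \<notin> P"
  using assms(2-)
proof (induction "card \<P>" arbitrary: \<P>)
  case 0 thus ?case using ideal_facts(2)[OF assms(1)] by auto
next
  case (Suc n)
  then obtain P \<Q> where PQ: "\<P> = insert P \<Q>" "P \<notin> \<Q>" "card \<Q> = n"
    by (metis card_Suc_eq)
  have fin: "finite \<Q>" using PQ Suc.prems by simp
  show ?case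
  proof (cases "\<exists>Q\<in>\<Q>. Q \<subseteq> P")
    case True
    then obtain Q where Q: "Q \<in> \<Q>" "Q \<subseteq> P" by blast
    have "card (insert P (\<Q> - {Q})) = Suc (card (\<Q> - {Q}))" using PQ fin by simp
    also have "\<dots> = n" using PQ(3) Q(1) fin by (metis card_Suc_Diff1)
    finally have "card (insert P (\<Q> - {Q})) = n" .
    hence "\<exists>x\<in>J. \<forall>P\<in>insert P (\<Q> - {Q}). x \<notin> P"
      using Suc.hyps(1)[of "insert P (\<Q> - {Q})"] Suc.prems PQ fin by auto
    thus ?thesis using Q PQ by blast
  next
    case False
    obtain x where x: "x \<in> J" "\<forall>Q\<in>\<Q>. x \<notin> Q"
      using Suc.hyps(1)[of \<Q>] Suc.prems PQ fin by auto
    show ?thesis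
    proof (cases "x \<in> P")
      case False thus ?thesis using x PQ by auto
    next
      case True
      have P: "primeideal P R" "\<not> J \<subseteq> P" using Suc.prems PQ by auto
      obtain y where y: "y \<in> J" "y \<notin> P" "\<forall>Q\<in>\<Q>. y \<in> Q"
        using prime_not_in_Inter[OF P(1) assms(1) P(2) fin] False Suc.prems(2) PQ
          primeideal_facts(1) by blast
      have c: "x \<in> carrier R" "y \<in> carrier R" using x y ideal_facts(1)[OF assms(1)] by auto
      \<comment> \<open>\<open>x\<close> lies in \<open>P\<close> only and \<open>y\<close> in all
        primes except \<open>P\<close>, so the sum lies in none of them.\<close>
      have eq: "x \<oplus> y \<ominus> y = x" "x \<oplus> y \<ominus> x = y" using c by algebra+
      have "x \<oplus> y \<notin> Q" if "Q \<in> \<Q>" for Q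
        using ideal_facts(4)[of Q "x \<oplus> y" y] eq(1) x y that primeideal_facts(1)[OF Suc.prems(2), of Q] PQ
        by auto
      moreover have "x \<oplus> y \<notin> P"
        using ideal_facts(4)[of P "x \<oplus> y" x] eq(2) True y primeideal_facts(1)[OF P(1)] by auto
      ultimately show ?thesis using ideal_facts(3)[OF assms(1) x(1) y(1)] PQ by blast
    qed
  qed
qed

end

section \<open>The ascending chain condition for graded families of ideals\<close>

context cring
begin

text \<open>The pairs in \<open>G\<close> are ring elements with a degree attached. The ideals
  \<open>F \<delta>\<close> are the components of a graded module over the polynomial ring with one
  variable for each pair, the variable of \<open>(g, e)\<close> acting as multiplication by
  \<open>g\<close> and raising degrees by \<open>e\<close>. In this way Rees algebras are treated
  without being constructed.\<close>

definition graded :: "('a \<times> 'g::cancel_comm_monoid_add) set \<Rightarrow> ('g \<Rightarrow> 'a set) \<Rightarrow> bool" where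
  "graded G F \<longleftrightarrow> (\<forall>\<delta>. ideal (F \<delta>) R) \<and> (\<forall>(g, e)\<in>G. \<forall>\<delta>. \<forall>a\<in>F \<delta>. g \<otimes> a \<in> F (\<delta> + e))"

definition acc_graded :: "('a \<times> 'g::cancel_comm_monoid_add) set \<Rightarrow> ('g \<Rightarrow> 'a set) \<Rightarrow> bool" where
  "acc_graded G H \<longleftrightarrow> (\<forall>F :: nat \<Rightarrow> 'g \<Rightarrow> 'a set.
     (\<forall>i. graded G (F i)) \<longrightarrow> (\<forall>i \<delta>. F i \<delta> \<subseteq> H \<delta>) \<longrightarrow> (\<forall>i \<delta>. F i \<delta> \<subseteq> F (Suc i) \<delta>) \<longrightarrow>
     (\<exists>N. \<forall>i\<ge>N. F i = F N))"

lemma graded_ideal: "graded G F \<Longrightarrow> ideal (F \<delta>) R"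
  by (simp add: graded_def)

lemma graded_mult: "graded G F \<Longrightarrow> (g, e) \<in> G \<Longrightarrow> a \<in> F \<delta> \<Longrightarrow> g \<otimes> a \<in> F (\<delta> + e)"
  by (fastforce simp: graded_def)

text \<open>
  \<open>low_sum H g e n \<delta> z\<close> says that \<open>z\<close> is, in degree \<open>\<delta>\<close>, a polynomial of degree less than \<open>n\<close>
  in the element \<open>g\<close> of degree \<open>e\<close> with coefficients in \<open>H\<close>.
\<close>

inductive low_sum ::
    "('g::cancel_comm_monoid_add \<Rightarrow> 'a set) \<Rightarrow> 'a \<Rightarrow> 'g \<Rightarrow> nat \<Rightarrow> 'g \<Rightarrow> 'a \<Rightarrow> bool"
  for H g e where
  zero: "low_sum H g e n \<delta> \<zero>"
| add: "low_sum H g e n \<delta> z \<Longrightarrow> i < n \<Longrightarrow> a \<in> H \<epsilon> \<Longrightarrow> \<epsilon> + (\<Sum>_<i. e) = \<delta> \<Longrightarrow>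
    low_sum H g e n \<delta> (z \<oplus> g [^] i \<otimes> a)"

text \<open>This is the component of degree \<open>\<delta>\<close> of H[g], that is, the sum of the
  ideals g^i H(\<epsilon>) over all \<epsilon> and i with \<epsilon> + i e = \<delta>.\<close>

definition adjoin_gen :: "('g::cancel_comm_monoid_add \<Rightarrow> 'a set) \<Rightarrow> 'a \<Rightarrow> 'g \<Rightarrow> 'g \<Rightarrow> 'a set" where
  "adjoin_gen H g e \<delta> = {z. \<exists>n. low_sum H g e n \<delta> z}"

context
  fixes H :: "'g::cancel_comm_monoid_add \<Rightarrow> 'a set" and G :: "('a \<times> 'g) set" and g :: 'a and e :: 'g
  assumes H: "graded G H" and G: "fst ` G \<subseteq> carrier R" and g: "g \<in> carrier R"
begin

lemma H_carrier: "a \<in> H \<delta> \<Longrightarrow> a \<in> carrier R"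
  using ideal_facts(1)[OF graded_ideal[OF H]] by blast

lemma low_sum_carrier: "low_sum H g e n \<delta> z \<Longrightarrow> z \<in> carrier R"
  by (induction rule: low_sum.induct) (auto simp: g H_carrier)

lemma low_sum_mono: "low_sum H g e n \<delta> z \<Longrightarrow> n \<le> n' \<Longrightarrow> low_sum H g e n' \<delta> z"
proof (induction rule: low_sum.induct)
  case (add n \<delta> z i a \<epsilon>)
  show ?case by (rule low_sum.add) (use add in auto)
qed (rule low_sum.zero)

lemma low_sum_plus:
  assumes "low_sum H g e n \<delta> y" "low_sum H g e n \<delta> z"
  shows "low_sum H g e n \<delta> (y \<oplus> z)"
  using assms(2,1)
proof (induction rule: low_sum.induct)
  case (zero n \<delta>) thus ?case using low_sum_carrier by force
next
  case (add n \<delta> z i a \<epsilon>)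
  have "y \<oplus> (z \<oplus> g [^] i \<otimes> a) = (y \<oplus> z) \<oplus> g [^] i \<otimes> a"
    using low_sum_carrier[OF add.hyps(1)] low_sum_carrier[OF add.prems] H_carrier[OF add.hyps(3)] g
    by (simp add: a_assoc)
  thus ?case using low_sum.add[where \<epsilon>=\<epsilon>] add by metis
qed

lemma low_sum_smult:
  assumes "low_sum H g e n \<delta> z" "r \<in> carrier R"
  shows "low_sum H g e n \<delta> (r \<otimes> z)"
  using assms
proof (induction rule: low_sum.induct)
  case (zero n \<delta>) thus ?case by (simp add: low_sum.zero)
next
  case (add n \<delta> z i a \<epsilon>)
  have "r \<otimes> (z \<oplus> g [^] i \<otimes> a) = r \<otimes> z \<oplus> g [^] i \<otimes> (r \<otimes> a)"
    using low_sum_carrier[OF add.hyps(1)] H_carrier[OF add.hyps(3)] g add.prems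
    by (simp add: r_distr m_lcomm)
  moreover have "r \<otimes> a \<in> H \<epsilon>" using ideal_facts(6)[OF graded_ideal[OF H]] add by blast
  ultimately show ?case using low_sum.add[where \<epsilon>=\<epsilon>] add by metis
qed

lemma low_sum_gen:
  assumes "low_sum H g e n \<delta> z" "(h, e') \<in> G"
  shows "low_sum H g e n (\<delta> + e') (h \<otimes> z)"
  using assms
proof (induction rule: low_sum.induct)
  have h: "h \<in> carrier R" using assms(2) G by force
  case (zero n \<delta>) show ?case using h by (simp add: low_sum.zero)
next
  have h: "h \<in> carrier R" using assms(2) G by force
  case (add n \<delta> z i a \<epsilon>)
  have "h \<otimes> (z \<oplus> g [^] i \<otimes> a) = h \<otimes> z \<oplus> g [^] i \<otimes> (h \<otimes> a)"
    using low_sum_carrier[OF add.hyps(1)] H_carrier[OF add.hyps(3)] g h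
    by (simp add: r_distr m_lcomm)
  moreover have "h \<otimes> a \<in> H (\<epsilon> + e')" using graded_mult[OF H add.prems] add by blast
  moreover have "\<epsilon> + e' + (\<Sum>_<i. e) = \<delta> + e'" using add.hyps(4) by (metis add.assoc add.commute)
  ultimately show ?case using low_sum.add[where \<epsilon>="\<epsilon> + e'"] add by metis
qed

lemma low_sum_shift:
  assumes "low_sum H g e n \<delta> z"
  shows "low_sum H g e (Suc n) (\<delta> + e) (g \<otimes> z)"
  using assms
proof (induction rule: low_sum.induct)
  case (zero n \<delta>) show ?case using g by (simp add: low_sum.zero)
next
  case (add n \<delta> z i a \<epsilon>)
  have "g \<otimes> (z \<oplus> g [^] i \<otimes> a) = g \<otimes> z \<oplus> g [^] Suc i \<otimes> a"
    using low_sum_carrier[OF add.hyps(1)] H_carrier[OF add.hyps(3)] g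
    by (simp add: r_distr m_ac)
  moreover have "\<epsilon> + (\<Sum>_<Suc i. e) = \<delta> + e" unfolding add.hyps(4)[symmetric] by (simp add: add_ac)
  moreover have "Suc i < Suc n" using add by simp
  ultimately show ?case using low_sum.add[where \<epsilon>="\<epsilon>" and i="Suc i"] add by metis
qed

text \<open>Cancellation in the degree monoid determines \<epsilon> from \<epsilon> + n e =
  \<delta>. All terms with exponent \<open>n\<close> therefore have coefficients in the same ideal
  \<open>H \<epsilon>\<close> and merge into one leading term.\<close>

lemma low_sum_split:
  assumes "low_sum H g e (Suc n) \<delta> z"
  shows "low_sum H g e n \<delta> z \<or>
    (\<exists>\<epsilon> a y. a \<in> H \<epsilon> \<and> \<epsilon> + (\<Sum>_<n. e) = \<delta> \<and> low_sum H g e n \<delta> y \<and> z = g [^] n \<otimes> a \<oplus> y)"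
    (is "_ \<or> ?top z")
  using assms
proof (induction "Suc n" \<delta> z rule: low_sum.induct)
  case (zero \<delta>) thus ?case by (simp add: low_sum.zero)
next
  case (add \<delta> z i a \<epsilon>)
  have a: "a \<in> carrier R" by (rule H_carrier[OF add.hyps(4)])
  note IH = add.hyps(2)
  show ?case
  proof (cases "i = n")
    case True
    show ?thesis
    proof (cases "low_sum H g e n \<delta> z")
      case low: True
      hence "z \<oplus> g [^] n \<otimes> a = g [^] n \<otimes> a \<oplus> z"
        using low_sum_carrier a g by (simp add: a_comm)
      thus ?thesis using low True add.hyps by blast
    next
      case False
      then obtain \<epsilon>' b y where y: "b \<in> H \<epsilon>'" "\<epsilon>' + (\<Sum>_<n. e) = \<delta>" "low_sum H g e n \<delta> y"
        "z = g [^] n \<otimes> b \<oplus> y" using IH by blast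
      have [simp]: "\<epsilon>' = \<epsilon>" using y(2) add.hyps(5) True by (metis add_right_cancel)
      have "z \<oplus> g [^] n \<otimes> a = g [^] n \<otimes> (b \<oplus> a) \<oplus> y"
        using H_carrier[OF y(1)] a g low_sum_carrier[OF y(3)] y(4) by (simp add: r_distr a_ac)
      moreover have "b \<oplus> a \<in> H \<epsilon>" using y(1) add.hyps(4) ideal_facts(3)[OF graded_ideal[OF H]] by simp
      ultimately show ?thesis using y True by auto
    qed
  next
    case False
    hence i: "i < n" using add.hyps by simp
    show ?thesis
    proof (cases "low_sum H g e n \<delta> z")
      case True thus ?thesis using low_sum.add[of H g e n \<delta> z i a \<epsilon>] i add.hyps by blast
    next
      case False
      then obtain \<epsilon>' b y where y: "b \<in> H \<epsilon>'" "\<epsilon>' + (\<Sum>_<n. e) = \<delta>" "low_sum H g e n \<delta> y"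
        "z = g [^] n \<otimes> b \<oplus> y" using IH by blast
      have "z \<oplus> g [^] i \<otimes> a = g [^] n \<otimes> b \<oplus> (y \<oplus> g [^] i \<otimes> a)"
        using H_carrier[OF y(1)] a g low_sum_carrier[OF y(3)] y(4) by (simp add: a_assoc)
      moreover have "low_sum H g e n \<delta> (y \<oplus> g [^] i \<otimes> a)"
        using low_sum.add[OF y(3) i add.hyps(4,5)] .
      ultimately show ?thesis using y by blast
    qed
  qed
qed

lemma graded_adjoin_gen: "graded (insert (g, e) G) (adjoin_gen H g e)"
  unfolding graded_def
proof (intro conjI allI ballI, goal_cases)
  case (1 \<delta>)
  show ?case
  proof (rule ideal_intro)
    show "adjoin_gen H g e \<delta> \<subseteq> carrier R" using low_sum_carrier by (auto simp: adjoin_gen_def)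
    show "\<zero> \<in> adjoin_gen H g e \<delta>" by (auto simp: adjoin_gen_def intro: low_sum.zero)
    fix x y assume "x \<in> adjoin_gen H g e \<delta>" "y \<in> adjoin_gen H g e \<delta>"
    then obtain n n' where "low_sum H g e n \<delta> x" "low_sum H g e n' \<delta> y" by (auto simp: adjoin_gen_def)
    hence "low_sum H g e (max n n') \<delta> (x \<oplus> y)"
      by (meson low_sum_mono low_sum_plus max.cobounded1 max.cobounded2)
    thus "x \<oplus> y \<in> adjoin_gen H g e \<delta>" by (auto simp: adjoin_gen_def)
  next
    fix r x assume "r \<in> carrier R" "x \<in> adjoin_gen H g e \<delta>"
    thus "r \<otimes> x \<in> adjoin_gen H g e \<delta>" using low_sum_smult unfolding adjoin_gen_def by blast
  qed
next
  case (2 he)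
  have "fst he \<otimes> x \<in> adjoin_gen H g e (\<delta> + snd he)" if "x \<in> adjoin_gen H g e \<delta>" for x \<delta>
  proof -
    from that obtain n where n: "low_sum H g e n \<delta> x" by (auto simp: adjoin_gen_def)
    have "low_sum H g e (Suc n) (\<delta> + snd he) (fst he \<otimes> x)"
    proof (cases "he = (g, e)")
      case True thus ?thesis using low_sum_shift[OF n] by simp
    next
      case False
      hence "(fst he, snd he) \<in> G" using 2 by simp
      thus ?thesis by (rule low_sum_mono[OF low_sum_gen[OF n]]) simp
    qed
    thus ?thesis by (auto simp: adjoin_gen_def)
  qed
  thus ?case by (simp add: case_prod_beta)
qed

lemma adjoin_gen_upper: "H \<delta> \<subseteq> adjoin_gen H g e \<delta>"
proof
  fix a assume a: "a \<in> H \<delta>"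
  have "low_sum H g e 1 \<delta> (\<zero> \<oplus> g [^] (0::nat) \<otimes> a)"
    by (rule low_sum.add[where \<epsilon>=\<delta>]) (use a low_sum.zero in auto)
  thus "a \<in> adjoin_gen H g e \<delta>" using H_carrier[OF a] by (auto simp: adjoin_gen_def)
qed

text \<open>These are the leading coefficient ideals of Hilbert's basis theorem. As the sums are
  evaluated in the ring, an element has no unique expression in powers of \<open>g\<close>; a
  coefficient counts as soon as one expression has it on top.\<close>

definition leading :: "('g \<Rightarrow> 'a set) \<Rightarrow> nat \<Rightarrow> 'g \<Rightarrow> 'a set" where
  "leading F n \<epsilon> = {a \<in> H \<epsilon>. \<exists>z. low_sum H g e n (\<epsilon> + (\<Sum>_<n. e)) z \<and> g [^] n \<otimes> a \<oplus> z \<in> F (\<epsilon> + (\<Sum>_<n. e))}"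

lemma graded_leading:
  assumes "graded (insert (g, e) G) F"
  shows "graded G (leading F n)"
  unfolding graded_def
proof (intro conjI allI ballI, goal_cases)
  case (1 \<delta>)
  note F = ideal_facts[OF graded_ideal[OF assms, of "\<delta> + (\<Sum>_<n. e)"]]
  note HI = ideal_facts[OF graded_ideal[OF H, of \<delta>]]
  show ?case
  proof (rule ideal_intro)
    show "leading F n \<delta> \<subseteq> carrier R" using HI(1) by (auto simp: leading_def)
    show "\<zero> \<in> leading F n \<delta>" using HI(2) F(2) g
      by (auto simp: leading_def intro!: exI[of _ \<zero>] low_sum.zero)
    fix x y assume "x \<in> leading F n \<delta>" "y \<in> leading F n \<delta>"
    then obtain z w where *: "x \<in> H \<delta>" "low_sum H g e n (\<delta> + (\<Sum>_<n. e)) z"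
      "g [^] n \<otimes> x \<oplus> z \<in> F (\<delta> + (\<Sum>_<n. e))" "y \<in> H \<delta>" "low_sum H g e n (\<delta> + (\<Sum>_<n. e)) w"
      "g [^] n \<otimes> y \<oplus> w \<in> F (\<delta> + (\<Sum>_<n. e))" by (auto simp: leading_def)
    have c: "x \<in> carrier R" "y \<in> carrier R" "z \<in> carrier R" "w \<in> carrier R" "g [^] n \<in> carrier R"
      using * HI(1) low_sum_carrier g by auto
    hence "(g [^] n \<otimes> x \<oplus> z) \<oplus> (g [^] n \<otimes> y \<oplus> w) = g [^] n \<otimes> (x \<oplus> y) \<oplus> (z \<oplus> w)"
      by algebra
    hence "g [^] n \<otimes> (x \<oplus> y) \<oplus> (z \<oplus> w) \<in> F (\<delta> + (\<Sum>_<n. e))" using F(3)[OF *(3,6)] by simp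
    thus "x \<oplus> y \<in> leading F n \<delta>" unfolding leading_def
      using HI(3)[OF *(1,4)] low_sum_plus[OF *(2,5)] by blast
  next
    fix r x assume r: "r \<in> carrier R" and "x \<in> leading F n \<delta>"
    then obtain z where *: "x \<in> H \<delta>" "low_sum H g e n (\<delta> + (\<Sum>_<n. e)) z"
      "g [^] n \<otimes> x \<oplus> z \<in> F (\<delta> + (\<Sum>_<n. e))" by (auto simp: leading_def)
    have c: "x \<in> carrier R" "z \<in> carrier R" "g [^] n \<in> carrier R"
      using * HI(1) low_sum_carrier g by auto
    hence "r \<otimes> (g [^] n \<otimes> x \<oplus> z) = g [^] n \<otimes> (r \<otimes> x) \<oplus> r \<otimes> z" using r by algebra
    hence "g [^] n \<otimes> (r \<otimes> x) \<oplus> r \<otimes> z \<in> F (\<delta> + (\<Sum>_<n. e))" using F(6)[OF r *(3)] by simp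
    thus "r \<otimes> x \<in> leading F n \<delta>" unfolding leading_def
      using HI(6)[OF r *(1)] low_sum_smult[OF *(2) r] by blast
  qed
next
  case (2 he)
  obtain h e' where he: "he = (h, e')" "(h, e') \<in> G" using 2 by (cases he) auto
  have h: "h \<in> carrier R" using he G by force
  have "h \<otimes> x \<in> leading F n (\<delta> + e')" if "x \<in> leading F n \<delta>" for x \<delta>
  proof -
    from that obtain z where *: "x \<in> H \<delta>" "low_sum H g e n (\<delta> + (\<Sum>_<n. e)) z"
      "g [^] n \<otimes> x \<oplus> z \<in> F (\<delta> + (\<Sum>_<n. e))" by (auto simp: leading_def)
    have c: "x \<in> carrier R" "z \<in> carrier R" "g [^] n \<in> carrier R"
      using * H_carrier low_sum_carrier g by auto
    have deg: "\<delta> + (\<Sum>_<n. e) + e' = \<delta> + e' + (\<Sum>_<n. e)" by (metis add.assoc add.commute)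
    have eq: "h \<otimes> (g [^] n \<otimes> x \<oplus> z) = g [^] n \<otimes> (h \<otimes> x) \<oplus> h \<otimes> z" using h c by algebra
    have "h \<otimes> (g [^] n \<otimes> x \<oplus> z) \<in> F (\<delta> + (\<Sum>_<n. e) + e')"
      by (rule graded_mult[OF assms _ *(3)]) (use he in simp)
    hence "g [^] n \<otimes> (h \<otimes> x) \<oplus> h \<otimes> z \<in> F (\<delta> + e' + (\<Sum>_<n. e))"
      unfolding eq deg .
    thus ?thesis unfolding leading_def
      using graded_mult[OF H he(2) *(1)] low_sum_gen[OF *(2) he(2)] deg by auto
  qed
  thus ?case using he by auto
qed

lemma leading_Suc:
  assumes "graded (insert (g, e) G) F"
  shows "leading F n \<epsilon> \<subseteq> leading F (Suc n) \<epsilon>"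
proof
  fix x assume "x \<in> leading F n \<epsilon>"
  then obtain z where *: "x \<in> H \<epsilon>" "low_sum H g e n (\<epsilon> + (\<Sum>_<n. e)) z"
    "g [^] n \<otimes> x \<oplus> z \<in> F (\<epsilon> + (\<Sum>_<n. e))" by (auto simp: leading_def)
  have c: "x \<in> carrier R" "z \<in> carrier R" using * H_carrier low_sum_carrier by auto
  have deg: "\<epsilon> + (\<Sum>_<n. e) + e = \<epsilon> + (\<Sum>_<Suc n. e)" by (simp add: add.assoc)
  have "g \<otimes> (g [^] n \<otimes> x \<oplus> z) = g [^] Suc n \<otimes> x \<oplus> g \<otimes> z"
    using c g by (simp add: r_distr m_ac)
  moreover have "g \<otimes> (g [^] n \<otimes> x \<oplus> z) \<in> F (\<epsilon> + (\<Sum>_<Suc n. e))"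
    using graded_mult[OF assms, of g e _ "\<epsilon> + (\<Sum>_<n. e)"] *(3) unfolding deg by simp
  moreover have "low_sum H g e (Suc n) (\<epsilon> + (\<Sum>_<Suc n. e)) (g \<otimes> z)"
    using low_sum_shift[OF *(2)] unfolding deg .
  ultimately show "x \<in> leading F (Suc n) \<epsilon>" unfolding leading_def
    using *(1) by auto
qed

text \<open>This is Hilbert's basis theorem for one more generator: a chain of graded submodules is
  controlled by the doubly indexed array \<open>M i n\<close> of leading coefficient modules, which
  increases in both indices.\<close>

lemma acc_adjoin_gen:
  assumes "acc_graded G H"
  shows "acc_graded (insert (g, e) G) (adjoin_gen H g e)"
  unfolding acc_graded_def
proof (intro allI impI)
  fix F :: "nat \<Rightarrow> 'g \<Rightarrow> 'a set"
  assume F: "\<forall>i. graded (insert (g, e) G) (F i)" "\<forall>i \<delta>. F i \<delta> \<subseteq> adjoin_gen H g e \<delta>"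
    "\<forall>i \<delta>. F i \<delta> \<subseteq> F (Suc i) \<delta>"
  define M where "M i n = leading (F i) n" for i n
  have M_le: "M i n \<delta> \<subseteq> H \<delta>" for i n \<delta> by (auto simp: M_def leading_def)
  have F_mono: "F i \<delta> \<subseteq> F j \<delta>" if "i \<le> j" for i j \<delta>
    by (rule lift_Suc_mono_le[of "\<lambda>i. F i \<delta>", OF F(3)[rule_format] that])
  have M_mono1: "M i n \<delta> \<subseteq> M j n \<delta>" if "i \<le> j" for i j n \<delta>
    using F_mono[OF that] unfolding M_def leading_def by blast
  have M_mono2: "M i n \<delta> \<subseteq> M i m \<delta>" if "n \<le> m" for i n m \<delta>
    unfolding M_def by (rule lift_Suc_mono_le[of "\<lambda>n. leading (F i) n \<delta>", OF leading_Suc[OF F(1)[rule_format]] that])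
  \<comment> \<open>Every increasing sequence picked from the array is stationary, because its
    members are graded submodules of \<open>H\<close>.\<close>
  have stab: "\<exists>N. \<forall>i\<ge>N. L i = L N"
    if "\<And>i. \<exists>j n. L i = M j n" "\<And>i \<delta>. L i \<delta> \<subseteq> L (Suc i) \<delta>" for L
  proof -
    have "graded G (L i)" for i using that(1)[of i] graded_leading F(1) by (auto simp: M_def)
    moreover have "L i \<delta> \<subseteq> H \<delta>" for i \<delta>
    proof -
      from that(1)[of i] obtain j n where "L i = M j n" by blast
      thus ?thesis by (simp add: M_le)
    qed
    ultimately show ?thesis using assms that(2) unfolding acc_graded_def by blast
  qed
  have "M i i \<delta> \<subseteq> M (Suc i) (Suc i) \<delta>" for i \<delta>
    using M_mono1[of i "Suc i" i \<delta>] M_mono2[of i "Suc i" "Suc i" \<delta>] by auto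
  hence "\<exists>N. \<forall>i\<ge>N. M i i = M N N" by (intro stab[of "\<lambda>i. M i i"]) blast+
  then obtain N0 where N0: "\<And>i. i \<ge> N0 \<Longrightarrow> M i i = M N0 N0" by blast
  \<comment> \<open>Beyond \<open>N0\<close> in both indices an entry is squeezed between two
    diagonal entries that agree.\<close>
  have big: "M i n = M N0 N0" if "i \<ge> N0" "n \<ge> N0" for i n
  proof
    fix \<delta>
    have "M N0 N0 \<delta> \<subseteq> M i n \<delta>" using M_mono1[OF that(1)] M_mono2[OF that(2)] by blast
    moreover have "M i n \<delta> \<subseteq> M (max i n) (max i n) \<delta>"
      using M_mono1[of i "max i n"] M_mono2[of n "max i n"] by fastforce
    moreover have "M (max i n) (max i n) = M N0 N0" using that by (intro N0) auto
    ultimately show "M i n \<delta> = M N0 N0 \<delta>" by simp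
  qed
  have "M i n \<delta> \<subseteq> M (Suc i) n \<delta>" for i n \<delta> using M_mono1[of i "Suc i"] by simp
  hence "\<exists>N. \<forall>i\<ge>N. M i n = M N n" for n by (intro stab[of "\<lambda>i. M i n"]) blast+
  \<comment> \<open>Only the finitely many exponents below \<open>N0\<close> still need a bound of
    their own.\<close>
  then obtain N1 where N1: "\<And>n i. i \<ge> N1 n \<Longrightarrow> M i n = M (N1 n) n" by metis
  define N where "N = Max (insert N0 (N1 ` {..<N0}))"
  have N_ge: "N0 \<le> N" "\<And>n. n < N0 \<Longrightarrow> N1 n \<le> N" unfolding N_def by (auto intro: Max_ge)
  have MN: "M i n = M N n" if "i \<ge> N" for i n
  proof (cases "n < N0")
    case True thus ?thesis using N1[of n i] N1[of n N] N_ge(2)[of n] that by auto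
  next
    case False thus ?thesis using big[of i n] big[of N n] N_ge(1) that by auto
  qed
  \<comment> \<open>Equal leading coefficients force equality: subtracting an element of
    \<open>F N\<close> with the same top term from an element of \<open>F i\<close> lowers its
    degree in \<open>g\<close>.\<close>
  have "F i \<delta> \<subseteq> F N \<delta>" if i: "i \<ge> N" for i \<delta>
  proof
    note FI = ideal_facts[OF graded_ideal[OF F(1)[rule_format]]]
    fix z assume z: "z \<in> F i \<delta>"
    hence "z \<in> adjoin_gen H g e \<delta>" using F(2) by blast
    then obtain n where "low_sum H g e n \<delta> z" by (auto simp: adjoin_gen_def)
    thus "z \<in> F N \<delta>" using z
    proof (induction n arbitrary: z)
      case 0
      hence "z = \<zero>" by (cases rule: low_sum.cases) auto
      thus ?case using FI(2) by blast
    next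
      case (Suc n)
      show ?case
      proof (cases "low_sum H g e n \<delta> z")
        case True thus ?thesis using Suc by blast
      next
        case False
        then obtain \<epsilon> a y where y: "a \<in> H \<epsilon>" "\<epsilon> + (\<Sum>_<n. e) = \<delta>" "low_sum H g e n \<delta> y"
          "z = g [^] n \<otimes> a \<oplus> y" using low_sum_split[OF Suc.prems(1)] by blast
        hence "a \<in> M i n \<epsilon>" using Suc.prems(2) by (auto simp: M_def leading_def)
        hence "a \<in> M N n \<epsilon>" using MN[OF i] by simp
        then obtain w where w: "low_sum H g e n \<delta> w" "g [^] n \<otimes> a \<oplus> w \<in> F N \<delta>"
          using y(2) by (auto simp: M_def leading_def)
        have c: "a \<in> carrier R" "y \<in> carrier R" "w \<in> carrier R" "g [^] n \<in> carrier R"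
          using y w low_sum_carrier H_carrier g by auto
        have "low_sum H g e n \<delta> (y \<oplus> (\<ominus> \<one>) \<otimes> w)"
          by (intro low_sum_plus y low_sum_smult w) simp
        moreover have "y \<oplus> (\<ominus> \<one>) \<otimes> w = z \<ominus> (g [^] n \<otimes> a \<oplus> w)" unfolding y(4) using c by algebra
        moreover have "z \<ominus> (g [^] n \<otimes> a \<oplus> w) \<in> F i \<delta>"
          using FI(4) Suc.prems(2) w(2) F_mono[OF i] by blast
        ultimately have "z \<ominus> (g [^] n \<otimes> a \<oplus> w) \<in> F N \<delta>" using Suc.IH by simp
        hence "(z \<ominus> (g [^] n \<otimes> a \<oplus> w)) \<oplus> (g [^] n \<otimes> a \<oplus> w) \<in> F N \<delta>" using FI(3) w(2) by blast
        moreover have "(z \<ominus> (g [^] n \<otimes> a \<oplus> w)) \<oplus> (g [^] n \<otimes> a \<oplus> w) = z"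
          unfolding y(4) using c by algebra
        ultimately show ?thesis by simp
      qed
    qed
  qed
  thus "\<exists>N. \<forall>i\<ge>N. F i = F N" using F_mono by (intro exI[of _ N] allI impI ext equalityI) blast+
qed

end

end

section \<open>Chain condition for bigraded families, stability and the Artin-Rees lemma\<close>

context cring
begin

text \<open>The elements that multiply \<open>A\<close> into \<open>B\<close> form an ideal, so it
  is enough to test the generators.\<close>

lemma Idl_mult_closed:
  assumes "S \<subseteq> carrier R" "ideal A R" "ideal B R" "\<And>g a. g \<in> S \<Longrightarrow> a \<in> A \<Longrightarrow> g \<otimes> a \<in> B"
    "i \<in> Idl S" "a \<in> A"
  shows "i \<otimes> a \<in> B"
proof -
  note A = ideal_facts[OF assms(2)] and B = ideal_facts[OF assms(3)]
  have "ideal {i \<in> carrier R. \<forall>a\<in>A. i \<otimes> a \<in> B} R"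
  proof (rule ideal_intro)
    show "\<zero> \<in> {i \<in> carrier R. \<forall>a\<in>A. i \<otimes> a \<in> B}" using A(1) B(2) by (auto simp: subset_iff)
    fix x y assume "x \<in> {i \<in> carrier R. \<forall>a\<in>A. i \<otimes> a \<in> B}" "y \<in> {i \<in> carrier R. \<forall>a\<in>A. i \<otimes> a \<in> B}"
    thus "x \<oplus> y \<in> {i \<in> carrier R. \<forall>a\<in>A. i \<otimes> a \<in> B}"
      using A(1) B(3) by (auto simp: subset_iff l_distr)
  next
    fix r x assume "r \<in> carrier R" "x \<in> {i \<in> carrier R. \<forall>a\<in>A. i \<otimes> a \<in> B}"
    thus "r \<otimes> x \<in> {i \<in> carrier R. \<forall>a\<in>A. i \<otimes> a \<in> B}"
      using A(1) B(6) by (auto simp: subset_iff m_assoc)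
  qed auto
  hence "Idl S \<subseteq> {i \<in> carrier R. \<forall>a\<in>A. i \<otimes> a \<in> B}"
    by (rule genideal_minimal) (use assms in auto)
  thus ?thesis using assms(5,6) by blast
qed

end

context noetherian_cring
begin

lemma acc_graded_base:
  fixes H :: "'g::cancel_comm_monoid_add \<Rightarrow> 'a set"
  defines "H \<equiv> \<lambda>\<delta>. if \<delta> = 0 then carrier R else {\<zero>}"
  shows "acc_graded {} H"
  unfolding acc_graded_def
proof (intro allI impI)
  fix F :: "nat \<Rightarrow> 'g \<Rightarrow> 'a set"
  assume F: "\<forall>i. graded {} (F i)" "\<forall>i \<delta>. F i \<delta> \<subseteq> H \<delta>" "\<forall>i \<delta>. F i \<delta> \<subseteq> F (Suc i) \<delta>"
  have I: "ideal (F i \<delta>) R" for i \<delta> using F(1) graded_ideal by blast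
  obtain N where N: "\<forall>i\<ge>N. F i 0 = F N 0" using acc[of "\<lambda>i. F i 0"] I F(3) by blast
  have "F i \<delta> = {\<zero>}" if "\<delta> \<noteq> 0" for i \<delta>
    using F(2)[rule_format, of i \<delta>] that ideal_facts(2)[OF I[of i \<delta>]] by (auto simp: H_def)
  hence "F i \<delta> = F N \<delta>" if "i \<ge> N" for i \<delta> using N that by metis
  thus "\<exists>N. \<forall>i\<ge>N. F i = F N" by blast
qed

text \<open>The ring concentrated in degree 0 satisfies the chain condition, and the generators are
  adjoined to it one at a time. That \<open>H 0\<close> contains the ring later ensures that
  \<open>H\<close> is large enough as an ambient module.\<close>

lemma acc_graded_generators:
  fixes gs :: "('a \<times> 'g::cancel_comm_monoid_add) list"
  assumes "fst ` set gs \<subseteq> carrier R"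
  shows "\<exists>H. graded (set gs) H \<and> acc_graded (set gs) H \<and> carrier R \<subseteq> H 0"
  using assms
proof (induction gs)
  case Nil
  show ?case
    by (rule exI[of _ "\<lambda>\<delta>. if \<delta> = 0 then carrier R else {\<zero>}"])
      (use acc_graded_base in \<open>auto simp: graded_def oneideal zeroideal\<close>)
next
  case (Cons ge gs)
  obtain g e where ge: "ge = (g, e)" by (cases ge)
  obtain H where H: "graded (set gs) H" "acc_graded (set gs) H" "carrier R \<subseteq> H 0"
    using Cons by auto
  have g: "g \<in> carrier R" "fst ` set gs \<subseteq> carrier R" using Cons.prems ge by auto
  show ?case
    using graded_adjoin_gen[OF H(1) g(2,1)] acc_adjoin_gen[OF H(1) g(2,1) H(2)]
      subset_trans[OF H(3) adjoin_gen_upper[OF H(1) g(2,1), of 0 e]] ge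
    by (intro exI[of _ "adjoin_gen H g e"]) (auto dest: subsetD)
qed

text \<open>The ideals A^s B^n are the components of the bigraded Rees algebra of \<open>A\<close>
  and \<open>B\<close>, which is Noetherian since both ideals are finitely generated.\<close>

lemma acc_bigraded:
  fixes F :: "nat \<Rightarrow> nat \<Rightarrow> nat \<Rightarrow> 'a set"
  assumes AB: "ideal A R" "ideal B R" and I: "\<And>i s n. ideal (F i s n) R"
    and le: "\<And>i s n. F i s n \<subseteq> ideal_power R A s \<cdot> ideal_power R B n"
    and A: "\<And>i s n. A \<cdot> F i s n \<subseteq> F i (Suc s) n"
    and B: "\<And>i s n. B \<cdot> F i s n \<subseteq> F i s (Suc n)"
    and mono: "\<And>i s n. F i s n \<subseteq> F (Suc i) s n"
  shows "\<exists>N. \<forall>i\<ge>N. \<forall>s n. F i s n = F N s n"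
proof -
  obtain SA SB where S: "SA \<subseteq> carrier R" "finite SA" "A = Idl SA" "SB \<subseteq> carrier R" "finite SB" "B = Idl SB"
    using finetely_gen AB by metis
  \<comment> \<open>Generators of \<open>A\<close> get degree (1, 0) and those of \<open>B\<close>
    degree (0, 1); an element occurring in both lists is kept twice.\<close>
  define G where "G = (\<lambda>g. (g, (1::nat, 0))) ` SA \<union> (\<lambda>g. (g, (0, 1::nat))) ` SB"
  have "finite G" using S by (simp add: G_def)
  then obtain gs where gs: "set gs = G" using finite_list by blast
  have G: "fst ` set gs \<subseteq> carrier R" unfolding gs G_def using S by auto
  then obtain H where H: "graded G H" "acc_graded G H" "carrier R \<subseteq> H 0"
    using acc_graded_generators[OF G] unfolding gs by blast
  have HI: "ideal (H \<delta>) R" for \<delta> using H graded_ideal by blast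
  have HA: "a \<otimes> x \<in> H (Suc s, n)" if "a \<in> A" "x \<in> H (s, n)" for a x s n
  proof (rule Idl_mult_closed[OF S(1) HI HI _ _ that(2)])
    show "a \<in> Idl SA" using that S by simp
    show "g \<otimes> y \<in> H (Suc s, n)" if "g \<in> SA" "y \<in> H (s, n)" for g y
      using graded_mult[OF H(1), of g "(1, 0)" y "(s, n)"] that by (auto simp: G_def)
  qed
  have HB: "a \<otimes> x \<in> H (s, Suc n)" if "a \<in> B" "x \<in> H (s, n)" for a x s n
  proof (rule Idl_mult_closed[OF S(4) HI HI _ _ that(2)])
    show "a \<in> Idl SB" using that S by simp
    show "g \<otimes> y \<in> H (s, Suc n)" if "g \<in> SB" "y \<in> H (s, n)" for g y
      using graded_mult[OF H(1), of g "(0, 1)" y "(s, n)"] that by (auto simp: G_def)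
  qed
  have HB0: "ideal_power R B n \<subseteq> H (0, n)" for n
  proof (induction n)
    case 0 thus ?case using H(3) by (simp add: zero_prod_def)
  next
    case (Suc n)
    have "B \<cdot> ideal_power R B n \<subseteq> H (0, Suc n)"
      by (rule ideal_prod_least[OF HI]) (use HB Suc in blast)
    thus ?case using AB by (simp add: ideal_prod_commute)
  qed
  have Hp: "ideal_power R A s \<cdot> ideal_power R B n \<subseteq> H (s, n)" for s n
  proof (induction s)
    case 0 thus ?case using HB0 AB by (simp add: carrier_prod)
  next
    case (Suc s)
    have "A \<cdot> (ideal_power R A s \<cdot> ideal_power R B n) \<subseteq> H (Suc s, n)"
      by (rule ideal_prod_least[OF HI]) (use HA Suc in blast)
    moreover have "A \<cdot> (ideal_power R A s \<cdot> ideal_power R B n) =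
      ideal_power R A (Suc s) \<cdot> ideal_power R B n"
      using AB by (simp add: ideal_prod_ac ideal_prod_is_ideal)
    ultimately show ?case by simp
  qed
  define F' where "F' i = (\<lambda>(s, n). F i s n)" for i
  have "graded G (F' i)" for i
  proof -
    have "g \<otimes> x \<in> F i (Suc s) n" if "g \<in> SA" "x \<in> F i s n" for g x s n
      using that A[of i s n] genideal_self[OF S(1)] S(3) by (blast intro: ideal_prod.prod)
    moreover have "g \<otimes> x \<in> F i s (Suc n)" if "g \<in> SB" "x \<in> F i s n" for g x s n
      using that B[of i s n] genideal_self[OF S(4)] S(6) by (blast intro: ideal_prod.prod)
    ultimately show ?thesis using I unfolding graded_def F'_def G_def by auto
  qed
  moreover have "F' i \<delta> \<subseteq> H \<delta>" for i \<delta>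
    using le Hp unfolding F'_def by (cases \<delta>) fastforce
  moreover have "F' i \<delta> \<subseteq> F' (Suc i) \<delta>" for i \<delta>
    using mono unfolding F'_def by (cases \<delta>) auto
  ultimately obtain N where "\<forall>i\<ge>N. F' i = F' N"
    using H(2) unfolding acc_graded_def by blast
  thus ?thesis unfolding F'_def fun_eq_iff by auto
qed

lemma acc_rees:
  fixes F :: "nat \<Rightarrow> nat \<Rightarrow> 'a set"
  assumes "ideal B R" "\<And>i n. ideal (F i n) R" "\<And>i n. F i n \<subseteq> ideal_power R B n"
    "\<And>i n. B \<cdot> F i n \<subseteq> F i (Suc n)" "\<And>i n. F i n \<subseteq> F (Suc i) n"
  shows "\<exists>N. \<forall>i\<ge>N. \<forall>n. F i n = F N n"
proof -
  have one: "ideal_power R (carrier R) n = carrier R" for n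
    by (induction n) (simp_all add: carrier_prod oneideal)
  \<comment> \<open>The unit ideal plays the second ideal. Its powers are the whole ring, so the
    second degree carries no information.\<close>
  have "\<exists>N. \<forall>i\<ge>N. \<forall>s n :: nat. F i s = F N s"
    by (rule acc_bigraded[OF assms(1) oneideal])
      (use assms in \<open>simp_all add: one carrier_prod ideal_prod_one del: nat_pow_Suc ideal_power_Suc\<close>)
  thus ?thesis by blast
qed

text \<open>Let \<open>F i\<close> agree with \<open>L\<close> up to degree \<open>i\<close> in
  \<open>s\<close> and be generated by \<open>L i\<close> beyond it. This is an increasing chain of
  bigraded submodules with union \<open>L\<close>, and the place where it becomes stationary is the
  wanted \<open>c\<close>. The point is that \<open>c\<close> is the same for all
  \<open>n\<close>.\<close>

lemma bigraded_stable:
  assumes A: "ideal A R" and B: "ideal B R" and LI: "\<And>s n. ideal (L s n) R"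
    and le: "\<And>s n. L s n \<subseteq> ideal_power R A s \<cdot> ideal_power R B n"
    and AL: "\<And>s n. A \<cdot> L s n \<subseteq> L (Suc s) n" and BL: "\<And>s n. B \<cdot> L s n \<subseteq> L s (Suc n)"
  shows "\<exists>c. \<forall>s n. L (s + c) n = ideal_power R A s \<cdot> L c n"
proof -
  let ?A = "ideal_power R A" and ?B = "ideal_power R B"
  define F where "F i s n = (if s \<le> i then L s n else ?A (s - i) \<cdot> L i n)" for i s n
  have FI: "ideal (F i s n) R" for i s n
    unfolding F_def using LI A by (simp add: ideal_prod_is_ideal)
  have "\<exists>N. \<forall>i\<ge>N. \<forall>s n. F i s n = F N s n"
  proof (rule acc_bigraded[OF A B FI])
    fix i s n
    show "A \<cdot> F i s n \<subseteq> F i (Suc s) n"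
    proof -
      consider "Suc s \<le> i" | "s = i" | "i < s" by linarith
      thus ?thesis
      proof cases
        case 1 thus ?thesis using AL by (simp add: F_def)
      next
        case 2 thus ?thesis using A LI by (simp add: F_def carrier_prod)
      next
        case 3
        hence "Suc s - i = Suc (s - i)" by simp
        hence "F i (Suc s) n = A \<cdot> F i s n"
          using 3 A LI by (simp add: F_def ideal_prod_ac ideal_prod_is_ideal)
        thus ?thesis by simp
      qed
    qed
    show "B \<cdot> F i s n \<subseteq> F i s (Suc n)"
    proof (cases "s \<le> i")
      case True thus ?thesis using BL by (simp add: F_def)
    next
      case False
      have "B \<cdot> (?A (s - i) \<cdot> L i n) = ?A (s - i) \<cdot> (B \<cdot> L i n)"
        using A B LI by (simp add: ideal_prod_left_commute)
      also have "\<dots> \<subseteq> ?A (s - i) \<cdot> L i (Suc n)" by (rule ideal_prod_mono) (use BL in auto)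
      finally show ?thesis using False by (simp add: F_def)
    qed
    show "F i s n \<subseteq> F (Suc i) s n"
    proof -
      consider "s \<le> i" | "s = Suc i" | "Suc i < s" by linarith
      thus ?thesis
      proof cases
        case 1 thus ?thesis by (simp add: F_def)
      next
        case 2 thus ?thesis using AL[of i n] A by (simp add: F_def carrier_prod)
      next
        case 3
        hence "s - i = Suc (s - Suc i)" by simp
        hence "?A (s - i) \<cdot> L i n = ?A (s - Suc i) \<cdot> (A \<cdot> L i n)"
          using A LI by (simp add: ideal_prod_assoc)
        also have "\<dots> \<subseteq> ?A (s - Suc i) \<cdot> L (Suc i) n" by (rule ideal_prod_mono) (use AL in auto)
        finally show ?thesis using 3 by (simp add: F_def)
      qed
    qed
    show "F i s n \<subseteq> ?A s \<cdot> ?B n"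
    proof (cases "s \<le> i")
      case True thus ?thesis using le by (simp add: F_def)
    next
      case False
      have "?A (s - i) \<cdot> L i n \<subseteq> ?A (s - i) \<cdot> (?A i \<cdot> ?B n)"
        by (rule ideal_prod_mono) (use le in auto)
      also have "\<dots> = (?A (s - i) \<cdot> ?A i) \<cdot> ?B n" using A B by (simp add: ideal_prod_assoc)
      also have "?A (s - i) \<cdot> ?A i = ?A s" using ideal_power_add[OF A, of "s - i" i] False by simp
      finally show ?thesis using False by (simp add: F_def)
    qed
  qed
  then obtain c where c: "F i s n = F c s n" if "i \<ge> c" for i s n by blast
  have "L (s + c) n = ?A s \<cdot> L c n" for s n
  proof -
    have "L (s + c) n = F (s + c) (s + c) n" by (simp add: F_def)
    also have "\<dots> = F c (s + c) n" by (rule c) simp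
    also have "\<dots> = ?A s \<cdot> L c n" using LI[of c n] by (cases "s = 0") (simp_all add: F_def carrier_prod)
    finally show ?thesis .
  qed
  thus ?thesis by blast
qed

text \<open>The intersections of A^s J^n with J^(n+1) form a bigraded submodule, and the components
  beyond \<open>c\<close> are generated by those at \<open>c\<close>. Bigrading is what makes the
  constant uniform in \<open>n\<close>, as the induction over powers of \<open>J\<close> will
  require.\<close>

lemma artin_rees:
  assumes A: "ideal A R" and J: "ideal J R"
  shows "\<exists>c. \<forall>s n. (ideal_power R A (s + c) \<cdot> ideal_power R J n) \<inter> ideal_power R J (Suc n)
    \<subseteq> ideal_power R A s \<cdot> ideal_power R J (Suc n)"
proof -
  let ?A = "ideal_power R A" and ?J = "ideal_power R J"
  define L where "L s n = (?A s \<cdot> ?J n) \<inter> ?J (Suc n)" for s n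
  have "\<exists>c. \<forall>s n. L (s + c) n = ?A s \<cdot> L c n"
  proof (rule bigraded_stable[OF A J])
    fix s n
    show "ideal (L s n) R"
      unfolding L_def by (intro Int_ideal ideal_prod_is_ideal ideal_power_ideal A J)
    show "L s n \<subseteq> ?A s \<cdot> ?J n" by (auto simp: L_def)
    have "A \<cdot> L s n \<subseteq> A \<cdot> (?A s \<cdot> ?J n)" by (rule ideal_prod_mono) (auto simp: L_def)
    also have "\<dots> = ?A (Suc s) \<cdot> ?J n" using A J by (simp add: ideal_prod_ac ideal_prod_is_ideal)
    moreover have "A \<cdot> L s n \<subseteq> A \<cdot> ?J (Suc n)" by (rule ideal_prod_mono) (auto simp: L_def)
    moreover have "A \<cdot> ?J (Suc n) \<subseteq> ?J (Suc n)"
      using ideal_prod_absorb(1)[OF ideal_power_ideal[OF J, of "Suc n"] ideal_facts(1)[OF A]] .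
    ultimately show "A \<cdot> L s n \<subseteq> L (Suc s) n" unfolding L_def by blast
    have "J \<cdot> L s n \<subseteq> J \<cdot> (?A s \<cdot> ?J n)" by (rule ideal_prod_mono) (auto simp: L_def)
    also have "\<dots> = ?A s \<cdot> ?J (Suc n)" using A J by (simp add: ideal_prod_ac ideal_prod_is_ideal)
    moreover have "J \<cdot> L s n \<subseteq> J \<cdot> ?J (Suc n)" by (rule ideal_prod_mono) (auto simp: L_def)
    moreover have "J \<cdot> ?J (Suc n) = ?J (Suc (Suc n))" using J by (simp add: ideal_prod_ac ideal_prod_is_ideal)
    ultimately show "J \<cdot> L s n \<subseteq> L s (Suc n)" unfolding L_def by blast
  qed
  then obtain c where c: "\<And>s n. L (s + c) n = ?A s \<cdot> L c n" by blast
  have "?A s \<cdot> L c n \<subseteq> ?A s \<cdot> ?J (Suc n)" for s n by (rule ideal_prod_mono) (auto simp: L_def)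
  thus ?thesis unfolding c[symmetric] unfolding L_def by blast
qed

lemma rees_stable:
  assumes J: "ideal J R" and I: "\<And>j. ideal (L j) R" and le: "\<And>j. L j \<subseteq> ideal_power R J j"
    and JL: "\<And>j. J \<cdot> L j \<subseteq> L (Suc j)"
  shows "\<exists>c. \<forall>j. L (j + c) = ideal_power R J j \<cdot> L c"
proof -
  have one: "ideal_power R (carrier R) n = carrier R" for n
    by (induction n) (simp_all add: carrier_prod oneideal)
  have "\<exists>c. \<forall>j n :: nat. L (j + c) = ideal_power R J j \<cdot> L c"
    by (rule bigraded_stable[OF J oneideal])
      (use assms in \<open>simp_all add: one carrier_prod ideal_prod_one del: nat_pow_Suc ideal_power_Suc\<close>)
  thus ?thesis by blast
qed

end

section \<open>Regular sequences on quotients of ideals\<close>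

context cring
begin

text \<open>The pair \<open>N\<close>, \<open>U\<close> stands for the image of \<open>N\<close>
  modulo \<open>U\<close>, and \<open>x\<close> is a nonzerodivisor on it. Inclusion of
  \<open>U\<close> in \<open>N\<close> is not built in.\<close>

definition regular_on :: "'a \<Rightarrow> 'a set \<Rightarrow> 'a set \<Rightarrow> bool" where
  "regular_on x N U \<longleftrightarrow> (\<forall>v\<in>N. x \<otimes> v \<in> U \<longrightarrow> v \<in> U)"

text \<open>For an ideal \<open>M\<close> this is the vanishing of Hom(R/M, N/U), with N/U again the
  image of \<open>N\<close> modulo \<open>U\<close>.\<close>

definition socle_free :: "'a set \<Rightarrow> 'a set \<Rightarrow> 'a set \<Rightarrow> bool" where
  "socle_free M N U \<longleftrightarrow> (\<forall>v\<in>N. (\<forall>r\<in>M. r \<otimes> v \<in> U) \<longrightarrow> v \<in> U)"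

lemma colon_ideal:
  assumes "ideal N R" "ideal U R" "A \<subseteq> carrier R"
  shows "ideal {v \<in> N. \<forall>r\<in>A. r \<otimes> v \<in> U} R"
proof (rule ideal_intro)
  note N = ideal_facts[OF assms(1)] and U = ideal_facts[OF assms(2)]
  show "{v \<in> N. \<forall>r\<in>A. r \<otimes> v \<in> U} \<subseteq> carrier R" using N by auto
  show "\<zero> \<in> {v \<in> N. \<forall>r\<in>A. r \<otimes> v \<in> U}" using N(2) U(2) assms(3) by (auto simp: subset_iff)
  fix x y assume "x \<in> {v \<in> N. \<forall>r\<in>A. r \<otimes> v \<in> U}" "y \<in> {v \<in> N. \<forall>r\<in>A. r \<otimes> v \<in> U}"
  thus "x \<oplus> y \<in> {v \<in> N. \<forall>r\<in>A. r \<otimes> v \<in> U}"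
    using N(1,3) U(3) assms(3) by (auto simp: subset_iff r_distr)
next
  note N = ideal_facts[OF assms(1)] and U = ideal_facts[OF assms(2)]
  fix r x assume "r \<in> carrier R" "x \<in> {v \<in> N. \<forall>r\<in>A. r \<otimes> v \<in> U}"
  moreover have "s \<otimes> (r \<otimes> x) = r \<otimes> (s \<otimes> x)" if "s \<in> A" for s
    using calculation N(1) assms(3) that by (intro m_lcomm) auto
  ultimately show "r \<otimes> x \<in> {v \<in> N. \<forall>r\<in>A. r \<otimes> v \<in> U}"
    using N(6) U(6) by auto
qed

lemma annihilator_ideal:
  assumes "ideal U R" "v \<in> carrier R"
  shows "ideal {r \<in> carrier R. r \<otimes> v \<in> U} R"
proof -
  have "{r \<in> carrier R. r \<otimes> v \<in> U} = {r \<in> carrier R. \<forall>s\<in>{v}. s \<otimes> r \<in> U}"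
    using assms(2) by (auto simp: m_comm)
  thus ?thesis using colon_ideal[OF oneideal assms(1), of "{v}"] assms(2) by simp
qed

end

text \<open>
  The maximal annihilators of nonzero elements of the modules \<open>N t / U t\<close> are prime, and the chain
  condition makes them finite in number; a regular element is found outside all of them.
\<close>

lemma (in noetherian_cring) exists_regular_on:
  assumes M: "ideal M R" and N: "\<And>t. t \<in> T \<Longrightarrow> ideal (N t) R" and U: "\<And>t. t \<in> T \<Longrightarrow> ideal (U t) R"
    and acc_colon: "\<And>A :: nat \<Rightarrow> 'a set. (\<And>n. ideal (A n) R) \<Longrightarrow> (\<And>n. A (Suc n) \<subseteq> A n) \<Longrightarrow>
      \<exists>n. \<forall>t\<in>T. {v \<in> N t. \<forall>r\<in>A (Suc n). r \<otimes> v \<in> U t} \<subseteq> {v \<in> N t. \<forall>r\<in>A n. r \<otimes> v \<in> U t}"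
    and socle: "\<And>t. t \<in> T \<Longrightarrow> socle_free M (N t) (U t)"
  shows "\<exists>x\<in>M. \<forall>t\<in>T. regular_on x (N t) (U t)"
proof -
  define Ann where "Ann t v = {r \<in> carrier R. r \<otimes> v \<in> U t}" for t v
  define \<A> where "\<A> = {Ann t v | t v. t \<in> T \<and> v \<in> N t \<and> v \<notin> U t}"
  define \<P> where "\<P> = {P \<in> \<A>. \<forall>B\<in>\<A>. P \<subseteq> B \<longrightarrow> B = P}"
  have Nc: "v \<in> carrier R" if "t \<in> T" "v \<in> N t" for t v using ideal_facts(1)[OF N] that by blast
  have ideal_A: "ideal A R" if "A \<in> \<A>" for A
    using that annihilator_ideal U Nc unfolding \<A>_def Ann_def by blast
  have below: "\<exists>P\<in>\<P>. A \<subseteq> P" if "A \<in> \<A>" for A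
  proof (rule maximal_element[of \<A> A])
    show "\<A> \<noteq> {}" "A \<in> \<A>" using that by auto
    fix P assume "P \<in> \<A>" "A \<subseteq> P" "\<And>B. B \<in> \<A> \<Longrightarrow> P \<subseteq> B \<Longrightarrow> B = P"
    thus ?thesis unfolding \<P>_def by blast
  qed (rule ideal_A)
  have prime: "primeideal P R" if "P \<in> \<P>" for P
  proof -
    obtain t v where tv: "t \<in> T" "v \<in> N t" "v \<notin> U t" "P = Ann t v"
      using \<open>P \<in> \<P>\<close> unfolding \<P>_def \<A>_def by blast
    have v: "v \<in> carrier R" using Nc tv by blast
    have max: "B = P" if "B \<in> \<A>" "P \<subseteq> B" for B using \<open>P \<in> \<P>\<close> that unfolding \<P>_def by blast
    show ?thesis
    proof (rule primeidealI)
      show "ideal P R" using ideal_A \<open>P \<in> \<P>\<close> unfolding \<P>_def by blast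
      show "cring R" by (rule cring_axioms)
      have "\<one> \<notin> P" using tv v by (simp add: Ann_def)
      thus "carrier R \<noteq> P" by blast
      fix a b assume ab: "a \<in> carrier R" "b \<in> carrier R" "a \<otimes> b \<in> P"
      show "a \<in> P \<or> b \<in> P"
      proof (rule disjCI)
        assume "b \<notin> P"
        hence bv: "b \<otimes> v \<notin> U t" using ab tv by (auto simp: Ann_def)
        moreover have "b \<otimes> v \<in> N t" using ideal_facts(6)[OF N] tv ab by blast
        ultimately have "Ann t (b \<otimes> v) \<in> \<A>" using tv unfolding \<A>_def by blast
        moreover have "r \<otimes> (b \<otimes> v) = b \<otimes> (r \<otimes> v)" if "r \<in> carrier R" for r
          using that ab v by (simp add: m_lcomm)
        hence "P \<subseteq> Ann t (b \<otimes> v)"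
          using ideal_facts(6)[OF U[OF tv(1)] ab(2)] by (auto simp: tv(4) Ann_def)
        ultimately have "Ann t (b \<otimes> v) = P" by (rule max)
        moreover have "a \<in> Ann t (b \<otimes> v)" using ab v by (simp add: tv(4) Ann_def m_assoc)
        ultimately show "a \<in> P" by simp
      qed
    qed
  qed
  have "finite \<P>"
  proof (rule ccontr)
    assume "infinite \<P>"
    then obtain P :: "nat \<Rightarrow> 'a set" where P: "inj P" "range P \<subseteq> \<P>"
      by (meson infinite_countable_subset)
    hence PP: "P i \<in> \<P>" for i by blast
    have "\<exists>t v. t \<in> T \<and> v \<in> N t \<and> v \<notin> U t \<and> P i = Ann t v" for i
      using PP[of i] unfolding \<P>_def \<A>_def by blast
    then obtain t v where tv: "\<And>i. t i \<in> T" "\<And>i. v i \<in> N (t i)" "\<And>i. v i \<notin> U (t i)" "\<And>i. P i = Ann (t i) (v i)"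
      by metis
    \<comment> \<open>The index set \<open>T\<close> may be infinite, so finiteness comes from
      intersecting ever more of the primes. When the elements killed by the intersections stop
      increasing, \<open>A n\<close> annihilates \<open>v n\<close> and so lies in
      \<open>P n\<close>; hence some earlier prime lies in \<open>P n\<close>, against the
      maximality and distinctness of the primes.\<close>
    define A where "A n = (\<Inter> (insert (carrier R) (P ` {..<n})))" for n
    have "ideal (A n) R" for n
      unfolding A_def by (rule i_Intersect) (use oneideal primeideal_facts(1)[OF prime[OF PP]] in auto)
    moreover have "A (Suc n) \<subseteq> A n" for n unfolding A_def by auto
    ultimately obtain n where n: "\<forall>t\<in>T. {v \<in> N t. \<forall>r\<in>A (Suc n). r \<otimes> v \<in> U t} \<subseteq> {v \<in> N t. \<forall>r\<in>A n. r \<otimes> v \<in> U t}"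
      using acc_colon[of A] by blast
    have "\<forall>r\<in>A (Suc n). r \<otimes> v n \<in> U (t n)"
      using tv(4)[of n] unfolding A_def Ann_def by auto
    hence "\<forall>r\<in>A n. r \<otimes> v n \<in> U (t n)" using n tv(1,2)[of n] by blast
    hence An: "A n \<subseteq> P n" using tv(4)[of n] unfolding A_def Ann_def by auto
    have "\<exists>i<n. P i \<subseteq> P n"
    proof (rule ccontr)
      assume no: "\<not> ?thesis"
      have "\<exists>y\<in>carrier R. y \<notin> P n \<and> (\<forall>Q\<in>P ` {..<n}. y \<in> Q)"
        by (rule prime_not_in_Inter[OF prime[OF PP] oneideal])
          (use primeideal_facts[OF prime[OF PP]] no one_closed in \<open>auto simp del: one_closed\<close>)
      thus False using An unfolding A_def by auto
    qed
    then obtain i where i: "i < n" "P i \<subseteq> P n" by blast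
    hence "P n = P i" using PP[of i] PP[of n] unfolding \<P>_def by blast
    thus False using P(1) i(1) by (simp add: inj_eq)
  qed
  moreover have "\<not> M \<subseteq> P" if "P \<in> \<P>" for P
  proof
    assume MP: "M \<subseteq> P"
    obtain t v where tv: "t \<in> T" "v \<in> N t" "v \<notin> U t" "P = Ann t v"
      using \<open>P \<in> \<P>\<close> unfolding \<P>_def \<A>_def by blast
    thus False using socle[OF tv(1)] MP unfolding socle_free_def Ann_def by blast
  qed
  ultimately obtain x where x: "x \<in> M" "\<forall>P\<in>\<P>. x \<notin> P"
    using prime_avoidance[OF M _ prime] by blast
  have "v \<in> U t" if "t \<in> T" "v \<in> N t" "x \<otimes> v \<in> U t" for t v
  proof (rule ccontr)
    assume "v \<notin> U t"
    hence "Ann t v \<in> \<A>" using that unfolding \<A>_def by blast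
    then obtain P where "P \<in> \<P>" "Ann t v \<subseteq> P" using below by blast
    moreover have "x \<in> Ann t v" using that x(1) ideal_facts(1)[OF M] by (auto simp: Ann_def)
    ultimately show False using x(2) by blast
  qed
  thus ?thesis using x(1) unfolding regular_on_def by blast
qed

text \<open>For each of the finitely many pairs the colon ideals form an ascending chain of ideals
  of the ring; the maximum of the stationary indices serves all pairs.\<close>

lemma (in noetherian_cring) exists_regular_on_finite:
  assumes M: "ideal M R" and T: "finite T" and NU: "\<And>N U. (N, U) \<in> T \<Longrightarrow> ideal N R \<and> ideal U R \<and> socle_free M N U"
  shows "\<exists>x\<in>M. \<forall>(N, U)\<in>T. regular_on x N U"
proof -
  have "\<exists>x\<in>M. \<forall>t\<in>T. regular_on x (fst t) (snd t)"
  proof (rule exists_regular_on[OF M])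
    show "ideal (fst t) R" "ideal (snd t) R" "socle_free M (fst t) (snd t)" if "t \<in> T" for t
      using NU[of "fst t" "snd t"] that by auto
    fix A :: "nat \<Rightarrow> 'a set"
    assume A: "\<And>n. ideal (A n) R" "\<And>n. A (Suc n) \<subseteq> A n"
    define C where "C t n = {v \<in> fst t. \<forall>r\<in>A n. r \<otimes> v \<in> snd t}" for t :: "'a set \<times> 'a set" and n
    have "\<exists>n. \<forall>i\<ge>n. C t i = C t n" if "t \<in> T" for t
    proof (rule acc)
      show "ideal (C t i) R" for i
        unfolding C_def by (rule colon_ideal) (use NU[of "fst t" "snd t"] that ideal_facts(1)[OF A(1)] in auto)
      show "C t i \<subseteq> C t (Suc i)" for i using A(2)[of i] unfolding C_def by blast
    qed
    then obtain n where n: "\<And>t i. t \<in> T \<Longrightarrow> i \<ge> n t \<Longrightarrow> C t i = C t (n t)" by metis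
    define m where "m = Max (insert 0 (n ` T))"
    have "n t \<le> m" if "t \<in> T" for t unfolding m_def using that T by (intro Max_ge) auto
    hence "C t (Suc m) = C t m" if "t \<in> T" for t using n[OF that, of m] n[OF that, of "Suc m"] that by (metis le_SucI)
    thus "\<exists>n. \<forall>t\<in>T. {v \<in> fst t. \<forall>r\<in>A (Suc n). r \<otimes> v \<in> snd t} \<subseteq> {v \<in> fst t. \<forall>r\<in>A n. r \<otimes> v \<in> snd t}"
      unfolding C_def by blast
  qed
  thus ?thesis by (simp add: case_prod_beta)
qed

section \<open>Regular sequences and depth for pairs of ideals\<close>

context cring
begin

primrec add_multiples :: "'a set \<Rightarrow> 'a set \<Rightarrow> 'a list \<Rightarrow> 'a set" where
  "add_multiples N U [] = U"
| "add_multiples N U (x # xs) = add_multiples N (U <+> multiples x N) xs"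

primrec regular_seq_on :: "'a set \<Rightarrow> 'a set \<Rightarrow> 'a list \<Rightarrow> bool" where
  "regular_seq_on N U [] \<longleftrightarrow> True"
| "regular_seq_on N U (x # xs) \<longleftrightarrow> regular_on x N U \<and> regular_seq_on N (U <+> multiples x N) xs"

text \<open>Only weak regularity is asked for: the quotient modulo the whole sequence may
  vanish.\<close>

definition depth_ge :: "'a set \<Rightarrow> 'a set \<Rightarrow> 'a set \<Rightarrow> nat \<Rightarrow> bool" where
  "depth_ge M N U k \<longleftrightarrow> (\<exists>xs. length xs = k \<and> set xs \<subseteq> M \<and> regular_seq_on N U xs)"

lemma depth_ge_0 [simp]: "depth_ge M N U 0"
  by (simp add: depth_ge_def)

lemma depth_ge_Suc:
  "depth_ge M N U (Suc k) \<longleftrightarrow> (\<exists>x\<in>M. regular_on x N U \<and> depth_ge M N (U <+> multiples x N) k)"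
proof
  assume "depth_ge M N U (Suc k)"
  then obtain x xs where "length xs = k" "set (x # xs) \<subseteq> M" "regular_seq_on N U (x # xs)"
    unfolding depth_ge_def length_Suc_conv by blast
  thus "\<exists>x\<in>M. regular_on x N U \<and> depth_ge M N (U <+> multiples x N) k"
    unfolding depth_ge_def by auto
next
  assume "\<exists>x\<in>M. regular_on x N U \<and> depth_ge M N (U <+> multiples x N) k"
  then obtain x xs where "x \<in> M" "length xs = k" "set xs \<subseteq> M" "regular_seq_on N U (x # xs)"
    unfolding depth_ge_def by auto
  thus "depth_ge M N U (Suc k)" unfolding depth_ge_def by (intro exI[of _ "x # xs"]) auto
qed

lemma depth_ge_socle_free: "depth_ge M N U (Suc k) \<Longrightarrow> socle_free M N U"
  unfolding depth_ge_Suc socle_free_def regular_on_def by blast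

text \<open>If y v = z w modulo \<open>U\<close>, then regularity of \<open>z\<close> modulo
  \<open>y\<close> makes w a multiple of \<open>y\<close>, and \<open>y\<close> can be cancelled.
  This is the half of the permutation property of regular sequences that holds without Nakayama's
  lemma.\<close>

lemma regular_on_swap:
  assumes N: "ideal N R" and U: "ideal U R" and c: "y \<in> carrier R" "z \<in> carrier R"
    and y: "regular_on y N U" and z: "regular_on z N (U <+> multiples y N)"
  shows "regular_on y N (U <+> multiples z N)"
  unfolding regular_on_def
proof (intro ballI impI)
  note NI = ideal_facts[OF N] and UI = ideal_facts[OF U]
  fix v assume v: "v \<in> N" "y \<otimes> v \<in> U <+> multiples z N"
  then obtain u w where uw: "u \<in> U" "w \<in> N" "y \<otimes> v = u \<oplus> z \<otimes> w" by (auto simp: set_add_iff multiples_def)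
  have c': "v \<in> carrier R" "u \<in> carrier R" "w \<in> carrier R" using v uw NI(1) UI(1) by auto
  have "z \<otimes> w = \<ominus> u \<oplus> (u \<oplus> z \<otimes> w)" using c c' by algebra
  hence "z \<otimes> w = \<ominus> u \<oplus> y \<otimes> v" using uw(3) by simp
  hence "z \<otimes> w \<in> U <+> multiples y N" using UI(5)[OF uw(1)] v(1) by (auto simp: set_add_iff multiples_def)
  hence "w \<in> U <+> multiples y N" using z uw(2) by (auto simp: regular_on_def)
  then obtain u' w' where uw': "u' \<in> U" "w' \<in> N" "w = u' \<oplus> y \<otimes> w'" by (auto simp: set_add_iff multiples_def)
  have c'': "u' \<in> carrier R" "w' \<in> carrier R" using uw' NI(1) UI(1) by auto
  have "y \<otimes> (v \<ominus> z \<otimes> w') = y \<otimes> v \<ominus> z \<otimes> (y \<otimes> w')" using c c' c'' by algebra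
  also have "\<dots> = u \<oplus> z \<otimes> u'" unfolding uw(3) uw'(3) using c c' c'' by algebra
  finally have "y \<otimes> (v \<ominus> z \<otimes> w') \<in> U" using UI(3)[OF uw(1) UI(6)[OF c(2) uw'(1)]] by simp
  moreover have "v \<ominus> z \<otimes> w' \<in> N" using NI(4)[OF v(1) NI(6)[OF c(2) uw'(2)]] .
  ultimately have "v \<ominus> z \<otimes> w' \<in> U" using y by (auto simp: regular_on_def)
  moreover have "v = (v \<ominus> z \<otimes> w') \<oplus> z \<otimes> w'" using c c' c'' by algebra
  ultimately show "v \<in> U <+> multiples z N" using uw'(2) by (auto simp: set_add_iff multiples_def)
qed

text \<open>For an ideal \<open>M\<close> both socles are isomorphic to Ext^1(R/M, N/U), because
  \<open>x\<close> and \<open>y\<close> are regular and annihilate R/M. In elements, a socle element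
  v modulo \<open>y\<close> corresponds to the w with x v = y w modulo \<open>U\<close>, which is a
  socle element modulo \<open>x\<close>.\<close>

lemma socle_free_transfer:
  assumes N: "ideal N R" and U: "ideal U R" and M: "M \<subseteq> carrier R" "x \<in> M" "y \<in> M"
    and x: "regular_on x N U" and y: "regular_on y N U" and s: "socle_free M N (U <+> multiples x N)"
  shows "socle_free M N (U <+> multiples y N)"
  unfolding socle_free_def
proof (intro ballI impI)
  note NI = ideal_facts[OF N] and UI = ideal_facts[OF U]
  have c: "x \<in> carrier R" "y \<in> carrier R" using M by auto
  fix v assume v: "v \<in> N" "\<forall>r\<in>M. r \<otimes> v \<in> U <+> multiples y N"
  then obtain u w where uw: "u \<in> U" "w \<in> N" "x \<otimes> v = u \<oplus> y \<otimes> w" using M(2) by (fastforce simp: set_add_iff multiples_def)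
  have c': "v \<in> carrier R" "u \<in> carrier R" "w \<in> carrier R" using v uw NI(1) UI(1) by auto
  have "r \<otimes> w \<in> U <+> multiples x N" if r: "r \<in> M" for r
  proof -
    have rc: "r \<in> carrier R" using r M by auto
    have "r \<otimes> v \<in> U <+> multiples y N" using v(2) r by blast
    then obtain u' w' where uw': "u' \<in> U" "w' \<in> N" "r \<otimes> v = u' \<oplus> y \<otimes> w'"
      by (auto simp: set_add_iff multiples_def)
    have c'': "u' \<in> carrier R" "w' \<in> carrier R" using uw' NI(1) UI(1) by auto
    have "y \<otimes> (r \<otimes> w \<ominus> x \<otimes> w') = r \<otimes> (u \<oplus> y \<otimes> w) \<ominus> x \<otimes> (u' \<oplus> y \<otimes> w') \<oplus> (x \<otimes> u' \<ominus> r \<otimes> u)"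
      using c c' c'' rc by algebra
    also have "\<dots> = r \<otimes> (x \<otimes> v) \<ominus> x \<otimes> (r \<otimes> v) \<oplus> (x \<otimes> u' \<ominus> r \<otimes> u)" using uw(3) uw'(3) by simp
    also have "\<dots> = x \<otimes> u' \<ominus> r \<otimes> u" using c c' c'' rc by algebra
    finally have "y \<otimes> (r \<otimes> w \<ominus> x \<otimes> w') \<in> U"
      using UI(4)[OF UI(6)[OF c(1) uw'(1)] UI(6)[OF rc uw(1)]] by simp
    moreover have "r \<otimes> w \<ominus> x \<otimes> w' \<in> N" using NI(4)[OF NI(6)[OF rc uw(2)] NI(6)[OF c(1) uw'(2)]] .
    ultimately have "r \<otimes> w \<ominus> x \<otimes> w' \<in> U" using y by (auto simp: regular_on_def)
    moreover have "r \<otimes> w = (r \<otimes> w \<ominus> x \<otimes> w') \<oplus> x \<otimes> w'" using c c' c'' rc by algebra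
    ultimately show ?thesis using uw'(2) by (auto simp: set_add_iff multiples_def)
  qed
  hence "w \<in> U <+> multiples x N" using s uw(2) by (auto simp: socle_free_def)
  then obtain u' w' where uw': "u' \<in> U" "w' \<in> N" "w = u' \<oplus> x \<otimes> w'" by (auto simp: set_add_iff multiples_def)
  have c'': "u' \<in> carrier R" "w' \<in> carrier R" using uw' NI(1) UI(1) by auto
  have "x \<otimes> (v \<ominus> y \<otimes> w') = x \<otimes> v \<ominus> y \<otimes> (x \<otimes> w')" using c c' c'' by algebra
  also have "\<dots> = u \<oplus> y \<otimes> u'" unfolding uw(3) uw'(3) using c c' c'' by algebra
  finally have "x \<otimes> (v \<ominus> y \<otimes> w') \<in> U" using UI(3)[OF uw(1) UI(6)[OF c(2) uw'(1)]] by simp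
  moreover have "v \<ominus> y \<otimes> w' \<in> N" using NI(4)[OF v(1) NI(6)[OF c(2) uw'(2)]] .
  ultimately have "v \<ominus> y \<otimes> w' \<in> U" using x by (auto simp: regular_on_def)
  moreover have "v = (v \<ominus> y \<otimes> w') \<oplus> y \<otimes> w'" using c c' c'' by algebra
  ultimately show "v \<in> U <+> multiples y N" using uw'(2) by (auto simp: set_add_iff multiples_def)
qed

lemma add_multiples_ideal:
  assumes "ideal N R" "ideal U R" "set xs \<subseteq> carrier R"
  shows "ideal (add_multiples N U xs) R"
  using assms(2,3)
proof (induction xs arbitrary: U)
  case (Cons x xs)
  have "ideal (U <+> multiples x N) R" using Cons.prems assms(1) by (intro add_ideals) auto
  thus ?case using Cons by simp
qed simp

lemma add_multiples_least:
  assumes "ideal K R"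
  shows "U \<subseteq> K \<Longrightarrow> (\<And>x v. x \<in> set xs \<Longrightarrow> v \<in> N \<Longrightarrow> x \<otimes> v \<in> K) \<Longrightarrow> add_multiples N U xs \<subseteq> K"
proof (induction xs arbitrary: U)
  case (Cons x xs)
  have "U <+> multiples x N \<subseteq> K"
    using Cons.prems by (intro set_add_least[OF assms]) (auto simp: multiples_def)
  thus ?case using Cons by simp
qed simp

lemma add_multiples_prod:
  assumes "ideal N R" "ideal B R" "ideal U R" "set xs \<subseteq> carrier R"
  shows "B \<cdot> add_multiples N U xs = add_multiples (B \<cdot> N) (B \<cdot> U) xs"
  using assms(3,4)
proof (induction xs arbitrary: U)
  case (Cons x xs)
  have x: "x \<in> carrier R" "set xs \<subseteq> carrier R" using Cons.prems by auto
  have "B \<cdot> (U <+> multiples x N) = (B \<cdot> U) <+> multiples x (B \<cdot> N)"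
    using assms(1,2) Cons.prems(1) x by (simp add: ideal_prod_distr prod_multiples)
  moreover have "ideal (U <+> multiples x N) R" using Cons.prems assms(1) x by (intro add_ideals) auto
  ultimately show ?case using Cons.IH[OF _ x(2)] by simp
qed simp

lemma add_multiples_snoc: "add_multiples N U (xs @ [x]) = add_multiples N U xs <+> multiples x N"
  by (induction xs arbitrary: U) auto

lemma regular_seq_on_snoc:
  "regular_seq_on N U (xs @ [x]) \<longleftrightarrow> regular_seq_on N U xs \<and> regular_on x N (add_multiples N U xs)"
  by (induction xs arbitrary: U) auto

end

section \<open>Exchange of regular elements and a sequence regular on all large powers\<close>

context noetherian_cring
begin

text \<open>The first element \<open>x\<close> of a given sequence is traded for \<open>y\<close>
  through an intermediate \<open>z\<close> that forms regular pairs with both. This independence of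
  depth from the chosen regular element allows one common sequence to replace those belonging to
  single powers.\<close>

lemma depth_ge_quotient:
  assumes M: "ideal M R" and N: "ideal N R"
  shows "ideal U R \<Longrightarrow> depth_ge M N U (Suc k) \<Longrightarrow> y \<in> M \<Longrightarrow> regular_on y N U \<Longrightarrow>
    depth_ge M N (U <+> multiples y N) k"
proof (induction k arbitrary: U y)
  case 0 show ?case by simp
next
  case (Suc k)
  note Mc = ideal_facts(1)[OF M]
  obtain x where x: "x \<in> M" "regular_on x N U" "depth_ge M N (U <+> multiples x N) (Suc k)"
    using Suc.prems(2) unfolding depth_ge_Suc[of M N U] by blast
  have c: "x \<in> carrier R" "y \<in> carrier R" using x Suc.prems Mc by auto
  have UN: "ideal (U <+> multiples w N) R" if "w \<in> carrier R" for w
    using that N Suc.prems(1) by (intro add_ideals) auto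
  have sf: "socle_free M N (U <+> multiples x N)" by (rule depth_ge_socle_free[OF x(3)])
  \<comment> \<open>Such a \<open>z\<close> exists because all three quotients have zero socle; for
    the quotient modulo \<open>y\<close> this is transferred from the one modulo
    \<open>x\<close>.\<close>
  have "\<exists>z\<in>M. \<forall>(N, U)\<in>{(N, U), (N, U <+> multiples x N), (N, U <+> multiples y N)}. regular_on z N U"
  proof (rule exists_regular_on_finite[OF M])
    show "ideal N' R \<and> ideal U' R \<and> socle_free M N' U'"
      if "(N', U') \<in> {(N, U), (N, U <+> multiples x N), (N, U <+> multiples y N)}" for N' U'
      using that N Suc.prems(1) UN[OF c(1)] UN[OF c(2)] sf depth_ge_socle_free[OF Suc.prems(2)]
        socle_free_transfer[OF N Suc.prems(1) Mc x(1) Suc.prems(3) x(2) Suc.prems(4) sf] by auto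
  qed simp
  then obtain z where z: "z \<in> M" "regular_on z N U" "regular_on z N (U <+> multiples x N)"
    "regular_on z N (U <+> multiples y N)" by auto
  have zc: "z \<in> carrier R" using z Mc by auto
  have comm: "(U <+> multiples v N) <+> multiples w N = (U <+> multiples w N) <+> multiples v N"
    if "v \<in> carrier R" "w \<in> carrier R" for v w
    using that N Suc.prems(1) by (simp add: add_ideals_assoc add_ideals_comm[of "multiples v N" "multiples w N"])
  have "depth_ge M N ((U <+> multiples x N) <+> multiples z N) k"
    by (rule Suc.IH[OF UN[OF c(1)] x(3) z(1,3)])
  moreover have "regular_on x N (U <+> multiples z N)"
    by (rule regular_on_swap[OF N Suc.prems(1) c(1) zc x(2) z(3)])
  ultimately have "depth_ge M N (U <+> multiples z N) (Suc k)"
    unfolding depth_ge_Suc using x(1) comm[OF c(1) zc] by auto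
  moreover have "regular_on y N (U <+> multiples z N)"
    by (rule regular_on_swap[OF N Suc.prems(1) c(2) zc Suc.prems(4) z(4)])
  ultimately have "depth_ge M N ((U <+> multiples z N) <+> multiples y N) k"
    using Suc.IH[OF UN[OF zc]] Suc.prems(3) by blast
  thus ?case unfolding depth_ge_Suc using z(1,4) comm[OF c(2) zc] by auto
qed

lemma depth_ge_add_multiples:
  assumes M: "ideal M R" and N: "ideal N R"
  shows "ideal U R \<Longrightarrow> set xs \<subseteq> M \<Longrightarrow> depth_ge M N U (length xs + k) \<Longrightarrow> regular_seq_on N U xs \<Longrightarrow>
    depth_ge M N (add_multiples N U xs) k"
proof (induction xs arbitrary: U)
  case (Cons x xs)
  have "ideal (U <+> multiples x N) R"
    using Cons.prems N ideal_facts(1)[OF M] by (intro add_ideals) auto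
  thus ?case using depth_ge_quotient[OF M N Cons.prems(1), of "length xs + k" x] Cons by auto
qed simp

text \<open>The sequence is built element by element. The socles of the quotients by the elements
  found so far form a graded module over the Rees algebra, so their vanishing at one sufficiently
  large power forces it at all later ones. Infinitely many powers of large depth provide that one
  power.\<close>

lemma exists_stable_regular_seq:
  assumes M: "ideal M R" and I: "ideal I R"
    and depth: "\<exists>\<^sub>\<infinity>j. depth_ge M (ideal_power R I j) {\<zero>} k"
  shows "\<exists>xs j\<^sub>0. length xs = k \<and> set xs \<subseteq> M \<and> (\<forall>j\<ge>j\<^sub>0. regular_seq_on (ideal_power R I j) {\<zero>} xs)"
proof -
  note Mc = ideal_facts(1)[OF M]
  let ?I = "ideal_power R I"
  have "i \<le> k \<Longrightarrow> \<exists>xs j\<^sub>0. length xs = i \<and> set xs \<subseteq> M \<and> (\<forall>j\<ge>j\<^sub>0. regular_seq_on (?I j) {\<zero>} xs)" for i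
  proof (induction i)
    case (Suc i)
    then obtain xs j\<^sub>0 where xs: "length xs = i" "set xs \<subseteq> M" "\<And>j. j \<ge> j\<^sub>0 \<Longrightarrow> regular_seq_on (?I j) {\<zero>} xs"
      by auto
    define U where "U j = add_multiples (?I j) {\<zero>} xs" for j
    have UI: "ideal (U j) R" for j
      unfolding U_def using xs(2) Mc I zeroideal by (intro add_multiples_ideal) auto
    have IU: "I \<cdot> U j = U (Suc j)" for j
      unfolding U_def using xs(2) Mc I zeroideal
      by (subst add_multiples_prod) (auto simp: ideal_prod_commute ideal_prod_zero)
    \<comment> \<open>\<open>L j\<close> is the preimage in I^j of the socle modulo
      \<open>U j\<close>. The family is closed under multiplication by \<open>I\<close>, hence
      generated by its component at some \<open>c\<close> from there on.\<close>
    define L where "L j = {v \<in> ?I j. \<forall>r\<in>M. r \<otimes> v \<in> U j}" for j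
    have LI: "ideal (L j) R" for j
      unfolding L_def by (rule colon_ideal) (use I UI Mc in auto)
    have IL: "I \<cdot> {v \<in> ?I j. \<forall>r\<in>A. r \<otimes> v \<in> U j} \<subseteq> {v \<in> ?I (Suc j). \<forall>r\<in>A. r \<otimes> v \<in> U (Suc j)}"
      if A: "A \<subseteq> carrier R" for A j
    proof (rule ideal_prod_least)
      show "ideal {v \<in> ?I (Suc j). \<forall>r\<in>A. r \<otimes> v \<in> U (Suc j)} R"
        by (rule colon_ideal[OF ideal_power_ideal[OF I] UI A])
      fix a b assume ab: "a \<in> I" "b \<in> {v \<in> ?I j. \<forall>r\<in>A. r \<otimes> v \<in> U j}"
      have c: "a \<in> carrier R" "b \<in> carrier R" using ab ideal_facts(1)[OF I] ideal_facts(1)[OF ideal_power_ideal[OF I]] by auto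
      have "b \<otimes> a \<in> ?I (Suc j)" using ab by (auto intro: ideal_prod.prod)
      hence "a \<otimes> b \<in> ?I (Suc j)" using c by (simp add: m_comm)
      moreover have "r \<otimes> (a \<otimes> b) \<in> U (Suc j)" if "r \<in> A" for r
      proof -
        have "a \<otimes> (r \<otimes> b) \<in> I \<cdot> U j" using ab that by (auto intro: ideal_prod.prod)
        thus ?thesis using c A that IU[of j] by (auto simp: m_lcomm subset_iff)
      qed
      ultimately show "a \<otimes> b \<in> {v \<in> ?I (Suc j). \<forall>r\<in>A. r \<otimes> v \<in> U (Suc j)}" by blast
    qed
    have "\<exists>c. \<forall>j. L (j + c) = ?I j \<cdot> L c"
      by (rule rees_stable[OF I LI]) (use IL[OF Mc] in \<open>auto simp: L_def\<close>)
    then obtain c where c': "\<And>j. L (j + c) = ?I j \<cdot> L c" by blast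
    have c: "L j = ?I (j - c) \<cdot> L c" if "j \<ge> c" for j using c'[of "j - c"] that by simp
    have UL: "U j \<subseteq> L j" for j
    proof -
      have "U j \<subseteq> ?I j"
        unfolding U_def using ideal_facts(2,6)[OF ideal_power_ideal[OF I, of j]] xs(2) Mc
        by (intro add_multiples_least[OF ideal_power_ideal[OF I]]) auto
      thus ?thesis unfolding L_def using ideal_facts(6)[OF UI] Mc by blast
    qed
    \<comment> \<open>The exponent must exceed \<open>c\<close> for the propagation to start and
      exceed the earlier bound for \<open>xs\<close> to be regular there.\<close>
    have "\<exists>j\<ge>max c j\<^sub>0. depth_ge M (?I j) {\<zero>} k" using depth unfolding INFM_nat_le by blast
    then obtain j\<^sub>1 where j1: "j\<^sub>1 \<ge> c" "j\<^sub>1 \<ge> j\<^sub>0" "depth_ge M (?I j\<^sub>1) {\<zero>} k" by auto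
    have k: "k = length xs + Suc (k - Suc i)" using xs(1) Suc.prems by simp
    have "depth_ge M (?I j\<^sub>1) (U j\<^sub>1) (Suc (k - Suc i))"
      unfolding U_def using j1(3) xs j1(2) k I
      by (intro depth_ge_add_multiples[OF M _ zeroideal]) auto
    hence "socle_free M (?I j\<^sub>1) (U j\<^sub>1)" by (rule depth_ge_socle_free)
    hence "L j\<^sub>1 \<subseteq> U j\<^sub>1" unfolding L_def socle_free_def by blast
    hence LU1: "L j\<^sub>1 = U j\<^sub>1" using UL by blast
    have LU: "L j = U j" if "j \<ge> j\<^sub>1" for j using that
    proof (induction rule: dec_induct)
      case base show ?case by (rule LU1)
    next
      case (step j)
      have "Suc j - c = Suc (j - c)" using step j1(1) by simp
      hence "L (Suc j) = (?I (j - c) \<cdot> I) \<cdot> L c" using c[of "Suc j"] step j1(1) by simp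
      also have "\<dots> = I \<cdot> (?I (j - c) \<cdot> L c)" using I LI[of c] by (simp add: ideal_prod_ac ideal_prod_is_ideal)
      also have "?I (j - c) \<cdot> L c = L j" using c[of j] step j1(1) by simp
      finally show ?case using step IU by simp
    qed
    \<comment> \<open>One element has to be regular on infinitely many modules; the chain condition
      over the Rees algebra makes this possible.\<close>
    have "\<exists>x\<in>M. \<forall>j\<in>{j\<^sub>1..}. regular_on x (?I j) (U j)"
    proof (rule exists_regular_on[OF M])
      show "ideal (?I j) R" "ideal (U j) R" for j using I UI by auto
      show "socle_free M (?I j) (U j)" if "j \<in> {j\<^sub>1..}" for j
        using LU[of j] that unfolding L_def socle_free_def by auto
      fix A :: "nat \<Rightarrow> 'a set"
      assume A: "\<And>n. ideal (A n) R" "\<And>n. A (Suc n) \<subseteq> A n"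
      define C where "C n j = {v \<in> ?I j. \<forall>r\<in>A n. r \<otimes> v \<in> U j}" for n j
      have "\<exists>N. \<forall>i\<ge>N. \<forall>j. C i j = C N j"
      proof (rule acc_rees[OF I])
        show "ideal (C n j) R" for n j unfolding C_def by (rule colon_ideal) (use I UI ideal_facts(1)[OF A(1)] in auto)
        show "C n j \<subseteq> ?I j" for n j unfolding C_def by blast
        show "I \<cdot> C n j \<subseteq> C n (Suc j)" for n j unfolding C_def by (rule IL[OF ideal_facts(1)[OF A(1)]])
        show "C n j \<subseteq> C (Suc n) j" for n j using A(2)[of n] unfolding C_def by blast
      qed
      then obtain n where "\<And>i j. i \<ge> n \<Longrightarrow> C i j = C n j" by blast
      from this[of "Suc n"] show "\<exists>n. \<forall>j\<in>{j\<^sub>1..}. {v \<in> ?I j. \<forall>r\<in>A (Suc n). r \<otimes> v \<in> U j} \<subseteq> {v \<in> ?I j. \<forall>r\<in>A n. r \<otimes> v \<in> U j}"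
        unfolding C_def by (intro exI[of _ n]) auto
    qed
    then obtain x where x: "x \<in> M" "\<And>j. j \<ge> j\<^sub>1 \<Longrightarrow> regular_on x (?I j) (U j)" by auto
    have "regular_seq_on (?I j) {\<zero>} (xs @ [x])" if "j \<ge> max j\<^sub>0 j\<^sub>1" for j
      using xs(3)[of j] x(2)[of j] that unfolding regular_seq_on_snoc U_def by simp
    thus ?case using xs x by (intro exI[of _ "xs @ [x]"] exI[of _ "max j\<^sub>0 j\<^sub>1"]) auto
  qed auto
  thus ?thesis by blast
qed

end

section \<open>Independence modulo a submodule\<close>

context module
begin

definition adjoin :: "'c set \<Rightarrow> 'c \<Rightarrow> 'c set" where
  "adjoin P f = {p \<oplus>\<^bsub>M\<^esub> r \<odot>\<^bsub>M\<^esub> f | p r. p \<in> P \<and> r \<in> carrier R}"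

primrec span :: "'c set \<Rightarrow> 'c list \<Rightarrow> 'c set" where
  "span P [] = P"
| "span P (f # fs) = span (adjoin P f) fs"

text \<open>
  If the maximal ideal of a local ring maps the listed elements into \<open>P\<close>, this is linear
  independence over the residue field.
\<close>

primrec indep :: "'c set \<Rightarrow> 'c list \<Rightarrow> bool" where
  "indep P [] \<longleftrightarrow> True"
| "indep P (f # fs) \<longleftrightarrow> f \<notin> P \<and> indep (adjoin P f) fs"

lemma submodule_facts:
  assumes "submodule P R M"
  shows "P \<subseteq> carrier M" "\<zero>\<^bsub>M\<^esub> \<in> P"
    and "\<And>x y. x \<in> P \<Longrightarrow> y \<in> P \<Longrightarrow> x \<oplus>\<^bsub>M\<^esub> y \<in> P"
    and "\<And>r x. r \<in> carrier R \<Longrightarrow> x \<in> P \<Longrightarrow> r \<odot>\<^bsub>M\<^esub> x \<in> P"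
    and "\<And>x. x \<in> P \<Longrightarrow> \<ominus>\<^bsub>M\<^esub> x \<in> P"
  using submoduleE[OF assms] subgroup.one_closed[OF submodule.axioms(1)[OF assms]] by auto

lemma adjoinI: "p \<in> P \<Longrightarrow> r \<in> carrier R \<Longrightarrow> p \<oplus>\<^bsub>M\<^esub> r \<odot>\<^bsub>M\<^esub> f \<in> adjoin P f"
  by (auto simp: adjoin_def)

lemma adjoin_submodule:
  assumes P: "submodule P R M" and f: "f \<in> carrier M"
  shows "submodule (adjoin P f) R M"
proof (rule submoduleI)
  note PI = submodule_facts[OF P]
  show "adjoin P f \<subseteq> carrier M" using PI(1) f by (auto simp: adjoin_def)
  show "\<zero>\<^bsub>M\<^esub> \<in> adjoin P f" using adjoinI[OF PI(2) R.zero_closed, of f] f by simp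
  fix a assume "a \<in> adjoin P f"
  then obtain p r where a: "p \<in> P" "r \<in> carrier R" "a = p \<oplus>\<^bsub>M\<^esub> r \<odot>\<^bsub>M\<^esub> f" by (auto simp: adjoin_def)
  have pc: "p \<in> carrier M" using a PI(1) by auto
  have "\<ominus>\<^bsub>M\<^esub> a = (\<ominus>\<^bsub>M\<^esub> p) \<oplus>\<^bsub>M\<^esub> (\<ominus> r) \<odot>\<^bsub>M\<^esub> f"
    using pc a f by (simp add: M.minus_add smult_l_minus)
  thus "\<ominus>\<^bsub>M\<^esub> a \<in> adjoin P f" using a PI(5) by (auto intro: adjoinI)
  {
    fix s assume s: "s \<in> carrier R"
    have "s \<odot>\<^bsub>M\<^esub> a = s \<odot>\<^bsub>M\<^esub> p \<oplus>\<^bsub>M\<^esub> (s \<otimes> r) \<odot>\<^bsub>M\<^esub> f"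
      using pc a f s by (simp add: smult_r_distr smult_assoc1)
    thus "s \<odot>\<^bsub>M\<^esub> a \<in> adjoin P f" using a PI(4) s by (auto intro: adjoinI)
  }
  fix b assume "b \<in> adjoin P f"
  then obtain q t where b: "q \<in> P" "t \<in> carrier R" "b = q \<oplus>\<^bsub>M\<^esub> t \<odot>\<^bsub>M\<^esub> f" by (auto simp: adjoin_def)
  have qc: "q \<in> carrier M" using b PI(1) by auto
  have "a \<oplus>\<^bsub>M\<^esub> b = (p \<oplus>\<^bsub>M\<^esub> q) \<oplus>\<^bsub>M\<^esub> (r \<oplus> t) \<odot>\<^bsub>M\<^esub> f"
    using pc qc a b f by (simp add: smult_l_distr M.a_ac)
  thus "a \<oplus>\<^bsub>M\<^esub> b \<in> adjoin P f" using a b PI(3) by (auto intro: adjoinI)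
qed

lemma adjoin_upper:
  assumes P: "submodule P R M" and f: "f \<in> carrier M"
  shows "P \<subseteq> adjoin P f" "f \<in> adjoin P f"
proof -
  note PI = submodule_facts[OF P]
  show "P \<subseteq> adjoin P f"
  proof
    fix p assume p: "p \<in> P"
    have "p \<oplus>\<^bsub>M\<^esub> \<zero> \<odot>\<^bsub>M\<^esub> f = p" using p PI(1) f by auto
    thus "p \<in> adjoin P f" using adjoinI[OF p R.zero_closed, of f] by simp
  qed
  show "f \<in> adjoin P f" using adjoinI[OF PI(2) R.one_closed, of f] f by simp
qed

lemma adjoin_least:
  assumes "submodule K R M" "P \<subseteq> K" "f \<in> K"
  shows "adjoin P f \<subseteq> K"
  using assms submodule_facts[OF assms(1)] by (auto simp: adjoin_def)

lemma adjoin_mono: "P \<subseteq> P' \<Longrightarrow> adjoin P f \<subseteq> adjoin P' f"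
  by (auto simp: adjoin_def)

lemma adjoin_absorb:
  assumes "submodule P R M" "f \<in> P"
  shows "adjoin P f = P"
  using adjoin_least[OF assms(1) order_refl assms(2)] adjoin_upper(1)[OF assms(1)]
    submodule_facts(1)[OF assms(1)] assms(2) by blast

lemma span_submodule:
  "submodule P R M \<Longrightarrow> set fs \<subseteq> carrier M \<Longrightarrow> submodule (span P fs) R M"
  by (induction fs arbitrary: P) (auto simp: adjoin_submodule)

lemma span_upper:
  "submodule P R M \<Longrightarrow> set fs \<subseteq> carrier M \<Longrightarrow> P \<subseteq> span P fs \<and> set fs \<subseteq> span P fs"
proof (induction fs arbitrary: P)
  case (Cons f fs)
  have "submodule (adjoin P f) R M" "P \<subseteq> adjoin P f" "f \<in> adjoin P f"
    using Cons.prems adjoin_submodule adjoin_upper by auto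
  thus ?case using Cons.IH[of "adjoin P f"] Cons.prems by auto
qed simp

lemma span_least:
  assumes "submodule K R M"
  shows "P \<subseteq> K \<Longrightarrow> set fs \<subseteq> K \<Longrightarrow> span P fs \<subseteq> K"
  by (induction fs arbitrary: P) (use assms in \<open>auto simp: adjoin_least\<close>)

lemma span_mono: "P \<subseteq> P' \<Longrightarrow> span P fs \<subseteq> span P' fs"
  by (induction fs arbitrary: P P') (auto simp: adjoin_mono)

lemma span_Cons:
  assumes "submodule P R M" "set (w # ws) \<subseteq> carrier M"
  shows "span P (w # ws) = adjoin (span P ws) w"
proof
  have ws: "set ws \<subseteq> carrier M" and w: "w \<in> carrier M" using assms(2) by auto
  note sp = span_submodule[OF assms(1) ws]
  note up = span_upper[OF assms(1) ws]
  show "span P (w # ws) \<subseteq> adjoin (span P ws) w"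
    by (rule span_least[OF adjoin_submodule[OF sp w]]) (use adjoin_upper[OF sp w] up in auto)
  note up' = span_upper[OF assms]
  show "adjoin (span P ws) w \<subseteq> span P (w # ws)"
    by (rule adjoin_least[OF span_submodule[OF assms]])
      (use up' span_least[OF span_submodule[OF assms], of P ws] in auto)
qed

lemma indep_append: "indep P (fs @ gs) \<longleftrightarrow> indep P fs \<and> indep (span P fs) gs"
  by (induction fs arbitrary: P) auto

lemma indep_antimono: "indep P' fs \<Longrightarrow> P \<subseteq> P' \<Longrightarrow> indep P fs"
proof (induction fs arbitrary: P P')
  case (Cons f fs)
  thus ?case using adjoin_mono[of P P' f] by auto
qed simp

text \<open>The hypothesis that \<open>N\<close> meets \<open>P'\<close> inside \<open>P\<close>
  says that no new relations between elements of \<open>N\<close> arise modulo \<open>P'\<close>. It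
  survives the adjunction of an element of \<open>N\<close> to both submodules by the modular
  law.\<close>

lemma indep_restrict:
  assumes N: "submodule N R M"
  shows "submodule P R M \<Longrightarrow> submodule P' R M \<Longrightarrow> indep P fs \<Longrightarrow> set fs \<subseteq> N \<Longrightarrow> N \<inter> P' \<subseteq> P \<Longrightarrow> indep P' fs"
proof (induction fs arbitrary: P P')
  case (Cons f fs)
  note NI = submodule_facts[OF N]
  have f: "f \<in> N" "f \<in> carrier M" using Cons.prems NI(1) by auto
  have "N \<inter> adjoin P' f \<subseteq> adjoin P f"
  proof
    fix x assume "x \<in> N \<inter> adjoin P' f"
    then obtain p r where x: "x \<in> N" "p \<in> P'" "r \<in> carrier R" "x = p \<oplus>\<^bsub>M\<^esub> r \<odot>\<^bsub>M\<^esub> f"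
      by (auto simp: adjoin_def)
    have pc: "p \<in> carrier M" using x submodule_facts(1)[OF Cons.prems(2)] by auto
    have "p = x \<oplus>\<^bsub>M\<^esub> (\<ominus> r) \<odot>\<^bsub>M\<^esub> f"
      using x pc f by (simp add: M.a_assoc smult_l_minus M.r_neg)
    moreover have "x \<oplus>\<^bsub>M\<^esub> (\<ominus> r) \<odot>\<^bsub>M\<^esub> f \<in> N"
      by (rule NI(3)[OF x(1) NI(4)[OF R.a_inv_closed[OF x(3)] f(1)]])
    ultimately have "p \<in> N" by (rule ssubst)
    hence "p \<in> P" using x Cons.prems by blast
    thus "x \<in> adjoin P f" using x by (auto intro: adjoinI)
  qed
  thus ?case using Cons.IH[of "adjoin P f" "adjoin P' f"] Cons.prems f adjoin_submodule by auto
qed simp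

text \<open>On \<open>N\<close> the preimage of \<open>P'\<close> lies in \<open>P\<close>, so a
  relation between the images modulo \<open>P'\<close> pulls back to one modulo \<open>P\<close>;
  adjoining \<open>f\<close> and \<open>\<phi> f\<close> preserves this situation.\<close>

lemma indep_map:
  assumes N: "submodule N R M"
    and \<phi>: "\<And>v. v \<in> carrier M \<Longrightarrow> \<phi> v \<in> carrier M"
      "\<And>v w r. v \<in> carrier M \<Longrightarrow> w \<in> carrier M \<Longrightarrow> r \<in> carrier R \<Longrightarrow> \<phi> (v \<oplus>\<^bsub>M\<^esub> r \<odot>\<^bsub>M\<^esub> w) = \<phi> v \<oplus>\<^bsub>M\<^esub> r \<odot>\<^bsub>M\<^esub> \<phi> w"
  shows "submodule P R M \<Longrightarrow> submodule P' R M \<Longrightarrow> indep P fs \<Longrightarrow> set fs \<subseteq> N \<Longrightarrow>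
    (\<And>v. v \<in> N \<Longrightarrow> \<phi> v \<in> P' \<Longrightarrow> v \<in> P) \<Longrightarrow> indep P' (map \<phi> fs)"
proof (induction fs arbitrary: P P')
  case (Cons f fs)
  note NI = submodule_facts[OF N]
  have f: "f \<in> N" "f \<in> carrier M" using Cons.prems NI(1) by auto
  have step: "v \<in> adjoin P f" if v: "v \<in> N" "\<phi> v \<in> adjoin P' (\<phi> f)" for v
  proof -
    obtain p r where p: "p \<in> P'" "r \<in> carrier R" "\<phi> v = p \<oplus>\<^bsub>M\<^esub> r \<odot>\<^bsub>M\<^esub> \<phi> f"
      using v(2) by (auto simp: adjoin_def)
    have c: "p \<in> carrier M" "v \<in> carrier M" using p v NI(1) submodule_facts(1)[OF Cons.prems(2)] by auto
    have "\<phi> (v \<oplus>\<^bsub>M\<^esub> (\<ominus> r) \<odot>\<^bsub>M\<^esub> f) = \<phi> v \<oplus>\<^bsub>M\<^esub> (\<ominus> r) \<odot>\<^bsub>M\<^esub> \<phi> f"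
      by (rule \<phi>(2)) (use c f p in auto)
    also have "\<dots> = p"
      using p c \<phi>(1)[OF f(2)] by (simp add: M.a_assoc smult_l_minus M.r_neg)
    finally have "\<phi> (v \<oplus>\<^bsub>M\<^esub> (\<ominus> r) \<odot>\<^bsub>M\<^esub> f) = p" .
    moreover have "v \<oplus>\<^bsub>M\<^esub> (\<ominus> r) \<odot>\<^bsub>M\<^esub> f \<in> N" using v f p NI(3,4) by auto
    ultimately have "v \<oplus>\<^bsub>M\<^esub> (\<ominus> r) \<odot>\<^bsub>M\<^esub> f \<in> P" using Cons.prems(5) p by auto
    hence "(v \<oplus>\<^bsub>M\<^esub> (\<ominus> r) \<odot>\<^bsub>M\<^esub> f) \<oplus>\<^bsub>M\<^esub> r \<odot>\<^bsub>M\<^esub> f \<in> adjoin P f" using p by (auto intro: adjoinI)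
    moreover have "(v \<oplus>\<^bsub>M\<^esub> (\<ominus> r) \<odot>\<^bsub>M\<^esub> f) \<oplus>\<^bsub>M\<^esub> r \<odot>\<^bsub>M\<^esub> f = v"
      using p c f by (simp add: M.a_assoc smult_l_minus M.l_neg)
    ultimately show ?thesis by simp
  qed
  have "indep (adjoin P' (\<phi> f)) (map \<phi> fs)"
  proof (rule Cons.IH[OF _ _ _ _ step])
    show "submodule (adjoin P f) R M" "submodule (adjoin P' (\<phi> f)) R M"
      using adjoin_submodule \<phi>(1) f Cons.prems(1,2) by blast+
    show "indep (adjoin P f) fs" "set fs \<subseteq> N" using Cons.prems(3,4) by simp_all
  qed
  moreover have "\<phi> f \<notin> P'" using Cons.prems(3) Cons.prems(5)[OF f(1)] by auto
  ultimately show ?case by simp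
qed simp

lemma exists_indep_sublist:
  "submodule P R M \<Longrightarrow> set ws \<subseteq> carrier M \<Longrightarrow>
    \<exists>vs. set vs \<subseteq> set ws \<and> span P vs = span P ws \<and> indep P vs"
proof (induction ws arbitrary: P)
  case (Cons w ws)
  have w: "w \<in> carrier M" and ws: "set ws \<subseteq> carrier M" using Cons.prems(2) by auto
  show ?case
  proof (cases "w \<in> P")
    case True
    obtain vs where "set vs \<subseteq> set ws" "span P vs = span P ws" "indep P vs"
      using Cons.IH[OF Cons.prems(1) ws] by blast
    moreover have "span P (w # ws) = span P ws"
      using adjoin_absorb[OF Cons.prems(1) True] by simp
    ultimately show ?thesis by (metis set_subset_Cons subset_trans)
  next
    case False
    obtain vs where "set vs \<subseteq> set ws" "span (adjoin P w) vs = span (adjoin P w) ws" "indep (adjoin P w) vs"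
      using Cons.IH[OF adjoin_submodule[OF Cons.prems(1) w] ws] by blast
    thus ?thesis using False by (intro exI[of _ "w # vs"]) auto
  qed
qed auto

section \<open>Linear algebra over the residue field\<close>

context
  fixes \<mm> assumes unit: "\<And>x. x \<in> carrier R \<Longrightarrow> x \<notin> \<mm> \<Longrightarrow> \<exists>y\<in>carrier R. y \<otimes> x = \<one>"
begin

text \<open>In a combination that falls into \<open>P'\<close>, no coefficient can be a unit, since
  the list is independent modulo \<open>P'\<close>; coefficients in \<open>\<mm>\<close> contribute
  only elements of \<open>P\<close>.\<close>

lemma span_Int:
  "submodule P R M \<Longrightarrow> submodule P' R M \<Longrightarrow> indep P' fs \<Longrightarrow> P \<subseteq> P' \<Longrightarrow> set fs \<subseteq> carrier M \<Longrightarrow>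
    (\<And>r f. r \<in> \<mm> \<Longrightarrow> f \<in> set fs \<Longrightarrow> r \<odot>\<^bsub>M\<^esub> f \<in> P) \<Longrightarrow> span P fs \<inter> P' \<subseteq> P"
proof (induction fs arbitrary: P P')
  case (Cons f fs)
  have f: "f \<in> carrier M" using Cons.prems by auto
  note P'I = submodule_facts[OF Cons.prems(2)] and PI = submodule_facts[OF Cons.prems(1)]
  have IH: "span (adjoin P f) fs \<inter> adjoin P' f \<subseteq> adjoin P f"
    using Cons.prems f adjoin_submodule adjoin_mono[of P P' f] adjoin_upper(1)[OF Cons.prems(1) f]
    by (intro Cons.IH) auto
  show ?case
  proof
    fix z assume z: "z \<in> span P (f # fs) \<inter> P'"
    hence "z \<in> adjoin P f" using IH adjoin_upper(1)[OF Cons.prems(2) f] by auto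
    then obtain p c where pc: "p \<in> P" "c \<in> carrier R" "z = p \<oplus>\<^bsub>M\<^esub> c \<odot>\<^bsub>M\<^esub> f" by (auto simp: adjoin_def)
    have pcar: "p \<in> carrier M" using pc PI(1) by auto
    have "\<ominus>\<^bsub>M\<^esub> p \<oplus>\<^bsub>M\<^esub> z \<in> P'" using P'I(3,5) pc Cons.prems(4) z by auto
    moreover have "\<ominus>\<^bsub>M\<^esub> p \<oplus>\<^bsub>M\<^esub> z = c \<odot>\<^bsub>M\<^esub> f" using pc pcar f by (simp add: M.r_neg1)
    ultimately have cf: "c \<odot>\<^bsub>M\<^esub> f \<in> P'" by simp
    have "c \<in> \<mm>"
    proof (rule ccontr)
      assume "c \<notin> \<mm>"
      then obtain y where y: "y \<in> carrier R" "y \<otimes> c = \<one>" using unit pc by blast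
      have "f = y \<odot>\<^bsub>M\<^esub> (c \<odot>\<^bsub>M\<^esub> f)" using y pc f by (simp add: smult_assoc1[symmetric])
      hence "f \<in> P'" using P'I(4)[OF y(1) cf] by simp
      thus False using Cons.prems(3) by simp
    qed
    hence "c \<odot>\<^bsub>M\<^esub> f \<in> P" using Cons.prems(6) by simp
    thus "z \<in> P" using pc PI(3) by simp
  qed
qed auto

text \<open>A coefficient in \<open>\<mm>\<close> sends \<open>w\<close> into \<open>P\<close> and
  can be ignored; any other coefficient is a unit, so the relation can be solved for
  \<open>w\<close>.\<close>

lemma exchange_one:
  "submodule P R M \<Longrightarrow> set ws \<subseteq> carrier M \<Longrightarrow> (\<And>r w. r \<in> \<mm> \<Longrightarrow> w \<in> set ws \<Longrightarrow> r \<odot>\<^bsub>M\<^esub> w \<in> P) \<Longrightarrow>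
    f \<in> span P ws \<Longrightarrow> f \<notin> P \<Longrightarrow> \<exists>xs w ys. ws = xs @ w # ys \<and> w \<in> span (adjoin P f) (xs @ ys)"
proof (induction ws)
  case (Cons w ws)
  have w: "w \<in> carrier M" "set ws \<subseteq> carrier M" using Cons.prems by auto
  have sp: "submodule (span P ws) R M" using span_submodule[OF Cons.prems(1) w(2)] .
  have fc: "f \<in> carrier M"
    using Cons.prems(4) submodule_facts(1)[OF span_submodule[OF Cons.prems(1,2)]] by blast
  have aP: "submodule (adjoin P f) R M" using adjoin_submodule[OF Cons.prems(1) fc] .
  have "f \<in> adjoin (span P ws) w" using span_Cons[OF Cons.prems(1,2)] Cons.prems(4) by simp
  then obtain x c where x: "x \<in> span P ws" "c \<in> carrier R" "f = x \<oplus>\<^bsub>M\<^esub> c \<odot>\<^bsub>M\<^esub> w"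
    by (auto simp: adjoin_def)
  have xc: "x \<in> carrier M" using x submodule_facts(1)[OF sp] by auto
  show ?case
  proof (cases "c \<in> \<mm>")
    case True
    hence "c \<odot>\<^bsub>M\<^esub> w \<in> P" using Cons.prems(3) by simp
    hence "f \<in> span P ws" using x span_upper[OF Cons.prems(1) w(2)] submodule_facts(3)[OF sp] by blast
    then obtain xs w' ys where *: "ws = xs @ w' # ys" "w' \<in> span (adjoin P f) (xs @ ys)"
      using Cons.IH[OF Cons.prems(1) w(2) Cons.prems(3)] Cons.prems(5) by auto
    have "w' \<in> span (adjoin P f) ((w # xs) @ ys)"
      using *(2) span_mono[OF adjoin_upper(1)[OF aP w(1)], of "xs @ ys"] by auto
    thus ?thesis using *(1) by (intro exI[of _ "w # xs"] exI[of _ w'] exI[of _ ys]) auto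
  next
    case False
    then obtain y where y: "y \<in> carrier R" "y \<otimes> c = \<one>" using unit x by blast
    have "w = y \<odot>\<^bsub>M\<^esub> (c \<odot>\<^bsub>M\<^esub> w)" using y x w by (simp add: smult_assoc1[symmetric])
    also have "c \<odot>\<^bsub>M\<^esub> w = \<ominus>\<^bsub>M\<^esub> x \<oplus>\<^bsub>M\<^esub> f" unfolding x(3) using x xc w by (simp add: M.r_neg1)
    finally have weq: "w = y \<odot>\<^bsub>M\<^esub> (\<ominus>\<^bsub>M\<^esub> x \<oplus>\<^bsub>M\<^esub> f)" .
    note sp' = submodule_facts[OF span_submodule[OF aP w(2)]]
    have "x \<in> span (adjoin P f) ws" using x span_mono[OF adjoin_upper(1)[OF Cons.prems(1) fc]] by blast
    moreover have "f \<in> span (adjoin P f) ws"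
      using span_upper[OF aP w(2)] adjoin_upper(2)[OF Cons.prems(1) fc] by blast
    ultimately have "w \<in> span (adjoin P f) ws" using weq sp'(3,4,5) y(1) by metis
    thus ?thesis by (intro exI[of _ "[]"] exI[of _ w] exI[of _ ws]) auto
  qed
qed auto

lemma steinitz:
  "submodule P R M \<Longrightarrow> indep P fs \<Longrightarrow> set ws \<subseteq> carrier M \<Longrightarrow>
    (\<And>r w. r \<in> \<mm> \<Longrightarrow> w \<in> set ws \<Longrightarrow> r \<odot>\<^bsub>M\<^esub> w \<in> P) \<Longrightarrow> set fs \<subseteq> span P ws \<Longrightarrow> length fs \<le> length ws"
proof (induction fs arbitrary: P ws)
  case (Cons f fs)
  have fc: "f \<in> carrier M"
    using Cons.prems submodule_facts(1)[OF span_submodule[OF Cons.prems(1,3)]] by auto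
  have aP: "submodule (adjoin P f) R M" using adjoin_submodule[OF Cons.prems(1) fc] .
  obtain xs w ys where w: "ws = xs @ w # ys" "w \<in> span (adjoin P f) (xs @ ys)"
    using exchange_one[OF Cons.prems(1,3,4), of f] Cons.prems by auto
  have c: "set (xs @ ys) \<subseteq> carrier M" using Cons.prems(3) w by auto
  have "span P ws \<subseteq> span (adjoin P f) (xs @ ys)"
    by (rule span_least[OF span_submodule[OF aP c]])
      (use w span_upper[OF aP c] adjoin_upper(1)[OF Cons.prems(1) fc] in auto)
  hence "length fs \<le> length (xs @ ys)"
    using Cons.prems w adjoin_upper(1)[OF Cons.prems(1) fc]
    by (intro Cons.IH[OF aP _ c]) auto
  thus ?case using w by simp
qed simp

end

end

section \<open>Regular elements modulo powers of a regular sequence\<close>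

context cring
begin

definition gen_ideal :: "'a list \<Rightarrow> 'a set" where
  "gen_ideal xs = add_multiples (carrier R) {\<zero>} xs"

lemma gen_ideal_ideal: "set xs \<subseteq> carrier R \<Longrightarrow> ideal (gen_ideal xs) R"
  unfolding gen_ideal_def by (intro add_multiples_ideal oneideal zeroideal)

lemma gen_ideal_least:
  assumes "ideal K R" "set xs \<subseteq> K"
  shows "gen_ideal xs \<subseteq> K"
  unfolding gen_ideal_def
  by (rule add_multiples_least) (use assms ideal_facts(2,7)[OF assms(1)] in auto)

lemma gen_ideal_snoc: "gen_ideal (xs @ [x]) = gen_ideal xs <+> multiples x (carrier R)"
  by (simp add: gen_ideal_def add_multiples_snoc)

lemma gen_ideal_prod:
  assumes "set xs \<subseteq> carrier R" "ideal N R"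
  shows "gen_ideal xs \<cdot> N = add_multiples N {\<zero>} xs"
proof -
  have "gen_ideal xs \<cdot> N = N \<cdot> gen_ideal xs"
    using assms by (intro ideal_prod_commute gen_ideal_ideal)
  also have "\<dots> = add_multiples N {\<zero>} xs"
    unfolding gen_ideal_def
    using assms by (simp add: add_multiples_prod oneideal zeroideal ideal_prod_one ideal_prod_zero)
  finally show ?thesis .
qed

lemma principal_prod:
  assumes "x \<in> carrier R" "ideal N R"
  shows "multiples x (carrier R) \<cdot> N = multiples x N"
  using assms by (simp add: multiples_prod oneideal carrier_prod)

text \<open>Products of n + 1 factors from the sum either avoid \<open>x\<close> altogether or
  contain it and leave a factor in the n-th power.\<close>

lemma power_add_principal:
  assumes X: "ideal X R" and x: "x \<in> carrier R"
  defines "X' \<equiv> X <+> multiples x (carrier R)"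
  shows "ideal_power R X' (Suc n) = ideal_power R X (Suc n) <+> multiples x (ideal_power R X' n)"
proof -
  have xR: "ideal (multiples x (carrier R)) R" using x oneideal by simp
  have X': "ideal X' R" unfolding X'_def using X xR by (rule add_ideals)
  note P = ideal_power_ideal[OF X] and P' = ideal_power_ideal[OF X']
  have XX': "X \<subseteq> X'" unfolding X'_def by (rule set_add_upper[OF X xR])
  have xP': "ideal_power R X' n \<cdot> multiples x (carrier R) = multiples x (ideal_power R X' n)" for n
    using principal_prod[OF x P'] xR P' by (simp add: ideal_prod_commute)
  have unfold': "ideal_power R X' (Suc n) = (ideal_power R X' n \<cdot> X) <+> multiples x (ideal_power R X' n)" for n
    using X xR P'[of n] xP'[of n] by (simp add: X'_def[symmetric]) (simp add: X'_def ideal_prod_distr)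
  show ?thesis
  proof (induction n)
    case 0 show ?case using X X' by (simp add: carrier_prod X'_def)
  next
    case (Suc n)
    have "ideal_power R X' (Suc n) \<cdot> X = (ideal_power R X (Suc n) <+> multiples x (ideal_power R X' n)) \<cdot> X"
      by (simp only: Suc)
    also have "\<dots> = (ideal_power R X (Suc n) \<cdot> X) <+> (multiples x (ideal_power R X' n) \<cdot> X)"
      by (rule ideal_prod_distr(2)) (use X P P' x in \<open>auto intro: ideal_prod_is_ideal\<close>)
    also have "multiples x (ideal_power R X' n) \<cdot> X = multiples x (ideal_power R X' n \<cdot> X)"
      by (rule multiples_prod[OF x P' X])
    finally have eq: "ideal_power R X' (Suc n) \<cdot> X = ideal_power R X (Suc (Suc n)) <+> multiples x (ideal_power R X' n \<cdot> X)"
      by simp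
    have le: "multiples x (ideal_power R X' n \<cdot> X) \<subseteq> multiples x (ideal_power R X' (Suc n))"
      by (simp, intro multiples_mono ideal_prod_mono XX' order_refl)
    have I2: "ideal (ideal_power R X (Suc (Suc n))) R" "ideal (multiples x (ideal_power R X' (Suc n))) R"
      by (rule P, rule multiples_ideal[OF x P'])
    have IT: "ideal (ideal_power R X (Suc (Suc n)) <+> multiples x (ideal_power R X' (Suc n))) R"
      by (rule add_ideals[OF I2])
    show ?case
    proof
      show "ideal_power R X' (Suc (Suc n)) \<subseteq> ideal_power R X (Suc (Suc n)) <+> multiples x (ideal_power R X' (Suc n))"
        unfolding unfold'[of "Suc n"] eq
        by (intro set_add_least[OF IT] set_add_upper(2)[OF I2] order_trans[OF le] set_add_upper(1)[OF I2])
      have "multiples x (ideal_power R X' (Suc n)) \<subseteq> ideal_power R X' (Suc (Suc n))"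
        unfolding unfold'[of "Suc n"]
        by (rule set_add_upper(2)) (use P'[of "Suc n"] X x in \<open>auto intro: ideal_prod_is_ideal\<close>)
      thus "ideal_power R X (Suc (Suc n)) <+> multiples x (ideal_power R X' (Suc n)) \<subseteq> ideal_power R X' (Suc (Suc n))"
        by (intro set_add_least[OF P'] ideal_power_mono XX')
    qed
  qed
qed

lemma gen_ideal_power_snoc:
  assumes N: "ideal N R" and x: "x \<in> carrier R" and xs: "set xs \<subseteq> carrier R"
  defines "E \<equiv> \<lambda>n. ideal_power R (gen_ideal xs) n \<cdot> N"
    and "E' \<equiv> \<lambda>n. ideal_power R (gen_ideal (xs @ [x])) n \<cdot> N"
  shows "ideal (E n) R" "ideal (E' n) R" "E' (Suc n) = E (Suc n) <+> multiples x (E' n)"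
    "E n \<subseteq> E' n" "multiples x (E' n) \<subseteq> E' (Suc n)" "E' n \<subseteq> N"
proof -
  let ?X = "gen_ideal xs" and ?X' = "gen_ideal (xs @ [x])"
  have X: "ideal ?X R" and X': "ideal ?X' R" using x xs by (simp_all add: gen_ideal_ideal)
  have xR: "ideal (multiples x (carrier R)) R" using x oneideal by simp
  show EI: "ideal (E n) R" and EI': "ideal (E' n) R" for n
    unfolding E_def E'_def by (intro ideal_prod_is_ideal ideal_power_ideal X X' N)+
  have "E' (Suc n) = (ideal_power R ?X (Suc n) <+> multiples x (ideal_power R ?X' n)) \<cdot> N"
    unfolding E'_def using power_add_principal[OF X x, of n] unfolding gen_ideal_snoc by simp
  also have "\<dots> = (ideal_power R ?X (Suc n) \<cdot> N) <+> (multiples x (ideal_power R ?X' n) \<cdot> N)"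
    by (rule ideal_prod_distr(2)) (use X X' x N in \<open>auto intro!: ideal_prod_is_ideal\<close>)
  also have "multiples x (ideal_power R ?X' n) \<cdot> N = multiples x (ideal_power R ?X' n \<cdot> N)"
    by (rule multiples_prod[OF x _ N]) (use X' in auto)
  finally show E': "E' (Suc n) = E (Suc n) <+> multiples x (E' n)" unfolding E_def E'_def .
  show "E n \<subseteq> E' n"
    unfolding E_def E'_def gen_ideal_snoc
    by (intro ideal_prod_mono ideal_power_mono set_add_upper(1)[OF X xR] order_refl)
  show "multiples x (E' n) \<subseteq> E' (Suc n)"
    unfolding E' by (rule set_add_upper(2)[OF EI multiples_ideal[OF x EI']])
  show "E' n \<subseteq> N"
    unfolding E'_def by (rule ideal_prod_absorb[OF N ideal_facts(1)[OF ideal_power_ideal[OF X']]])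
qed

text \<open>The quotient by X^n N is filtered by the pieces X^i N / X^(i+1) N, and regularity on
  every piece adds up to regularity on the whole.\<close>

lemma regular_on_powers:
  assumes N: "ideal N R" and X: "ideal X R" and y: "y \<in> carrier R" "regular_on y N (X \<cdot> N)"
    and graded: "\<And>n. regular_on y (ideal_power R X n \<cdot> N) (ideal_power R X (Suc n) \<cdot> N)"
  shows "regular_on y N (ideal_power R X n \<cdot> N)"
proof (induction n)
  case 0 show ?case using N by (simp add: regular_on_def carrier_prod)
next
  case (Suc n)
  have "ideal_power R X (Suc n) \<cdot> N \<subseteq> ideal_power R X n \<cdot> N"
    by (intro ideal_prod_mono ideal_power_antimono X) auto
  thus ?case using Suc graded[of n] unfolding regular_on_def by blast
qed

text \<open>
  The graded pieces of \<open>N\<close> for the filtration by powers of \<open>X\<close> are direct sums of copies of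
  \<open>N / X N\<close>; the lemma extracts from this what is needed about regular elements. The ideal \<open>Z\<close>
  makes the induction on the length of the sequence possible.
\<close>

lemma regular_on_graded_pieces:
  assumes N: "ideal N R"
  shows "set xs \<subseteq> carrier R \<Longrightarrow> regular_seq_on N {\<zero>} xs \<Longrightarrow> ideal Z R \<Longrightarrow> y \<in> carrier R \<Longrightarrow>
    regular_on y N ((gen_ideal xs \<cdot> N) <+> (Z \<cdot> N)) \<Longrightarrow>
    regular_on y (ideal_power R (gen_ideal xs) n \<cdot> N)
      ((ideal_power R (gen_ideal xs) (Suc n) \<cdot> N) <+> (Z \<cdot> (ideal_power R (gen_ideal xs) n \<cdot> N)))"
proof (induction xs arbitrary: Z y n rule: rev_induct)
  case Nil
  have g: "gen_ideal [] = {\<zero>}" by (simp add: gen_ideal_def)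
  have zN: "{\<zero>} \<cdot> K = {\<zero>}" if "ideal K R" for K
    using that by (simp add: ideal_prod_commute zeroideal ideal_prod_zero)
  show ?case
  proof (cases n)
    case 0 thus ?thesis using Nil.prems N by (simp add: g carrier_prod zeroideal)
  next
    case (Suc m)
    have pw: "ideal_power R {\<zero>} (Suc k) = {\<zero>}" for k
      using zN by (simp add: ideal_prod_zero zeroideal)
    have "ideal (Z \<cdot> {\<zero>}) R" using Nil.prems(3) zeroideal ideal_prod_is_ideal by blast
    hence "\<zero> \<in> {\<zero>} <+> (Z \<cdot> {\<zero>})"
      using set_add_upper(1)[OF zeroideal] by blast
    moreover have "ideal_power R {\<zero>} n \<cdot> N = {\<zero>}" "ideal_power R {\<zero>} (Suc n) \<cdot> N = {\<zero>}"
      using pw[of m] pw[of n] zN[OF N] Suc by (simp_all del: ideal_power_Suc nat_pow_Suc)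
    ultimately show ?thesis unfolding g regular_on_def by auto
  qed
next
  case (snoc x xs)
  define X where "X = gen_ideal xs"
  define X' where "X' = gen_ideal (xs @ [x])"
  have x: "x \<in> carrier R" and xs: "set xs \<subseteq> carrier R" using snoc.prems by auto
  have X: "ideal X R" unfolding X_def by (rule gen_ideal_ideal[OF xs])
  have X'_eq: "X' = X <+> multiples x (carrier R)" unfolding X'_def X_def by (rule gen_ideal_snoc)
  have X': "ideal X' R" unfolding X'_def using snoc.prems by (intro gen_ideal_ideal) auto
  define E where "E n = ideal_power R X n \<cdot> N" for n
  define E' where "E' n = ideal_power R X' n \<cdot> N" for n
  note snoc_facts = gen_ideal_power_snoc[OF N x xs, folded X_def X'_def, folded E_def E'_def]
  note EI = snoc_facts(1) and EI' = snoc_facts(2) and E'_Suc = snoc_facts(3) and EE' = snoc_facts(4)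
    and xE' = snoc_facts(5) and E'N = snoc_facts(6)
  have xE'I: "ideal (multiples x (E' n)) R" for n using x EI' by auto
  have seq: "regular_seq_on N {\<zero>} xs" "regular_on x N (X \<cdot> N)"
    using snoc.prems(2) gen_ideal_prod[OF xs N] unfolding regular_seq_on_snoc X_def by auto
  have G: "regular_on y (E n) (E (Suc n) <+> (Z \<cdot> E n))"
    if "ideal Z R" "y \<in> carrier R" "regular_on y N ((X \<cdot> N) <+> (Z \<cdot> N))" for y Z n
    using snoc.IH[OF xs seq(1) that(1,2)] that(3) unfolding X_def[symmetric] E_def by blast
  have add0: "A <+> {\<zero>} = A" if "ideal A R" for A
    using that ideal_facts(1)[OF that] by (force simp: set_add_iff)
  have z: "{\<zero>} \<cdot> K = {\<zero>}" if "ideal K R" for K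
    using that by (simp add: ideal_prod_commute zeroideal ideal_prod_zero)
  \<comment> \<open>The induction hypothesis also applies to \<open>x\<close> itself in place of
    \<open>y\<close>, with zero for \<open>Z\<close>; thus \<open>x\<close> can be cancelled modulo
    every \<open>E n\<close>.\<close>
  have H: "regular_on x N (E n)" for n
    unfolding E_def
  proof (rule regular_on_powers[OF N X x seq(2)])
    fix n
    have "regular_on x N ((X \<cdot> N) <+> ({\<zero>} \<cdot> N))"
      using seq(2) N X by (simp add: z add0 ideal_prod_is_ideal)
    from G[OF zeroideal x this, of n]
    show "regular_on x (ideal_power R X n \<cdot> N) (ideal_power R X (Suc n) \<cdot> N)"
      unfolding z[OF EI] add0[OF EI] unfolding E_def .
  qed
  have ZI: "ideal (Z \<cdot> E n) R" "ideal (Z \<cdot> E' n) R" for n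
    using snoc.prems(3) EI EI' ideal_prod_is_ideal by auto
  define Tg where "Tg n = E' (Suc n) <+> (Z \<cdot> E' n)" for n
  have TgI: "ideal (Tg n) R" for n unfolding Tg_def by (rule add_ideals[OF EI' ZI(2)])
  have main: "v \<in> Tg n" if "v \<in> E' n" "y \<otimes> v \<in> Tg n" for v
    using that
  proof (induction n arbitrary: v)
    case 0
    have "E' 0 = N" "E' (Suc 0) = X' \<cdot> N" using X' N by (simp_all add: E'_def carrier_prod)
    thus ?case using 0 snoc.prems(5) unfolding Tg_def regular_on_def X'_def by auto
  next
    case (Suc n)
    note TI = ideal_facts[OF TgI[of "Suc n"]]
    have xT: "multiples x (Tg n) \<subseteq> Tg (Suc n)"
    proof -
      have "multiples x (Tg n) = multiples x (E' (Suc n)) <+> multiples x (Z \<cdot> E' n)"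
        unfolding Tg_def by (rule multiples_add[OF x EI' ZI(2)])
      also have "multiples x (Z \<cdot> E' n) = Z \<cdot> multiples x (E' n)"
        using prod_multiples[OF x EI' snoc.prems(3)] by simp
      also have "multiples x (E' (Suc n)) <+> (Z \<cdot> multiples x (E' n)) \<subseteq> Tg (Suc n)"
        unfolding Tg_def by (intro set_add_mono xE' ideal_prod_mono order_refl)
      finally show ?thesis .
    qed
    \<comment> \<open>Elements of \<open>Tg (Suc n)\<close> split into a part free of
      \<open>x\<close> and a multiple of \<open>x\<close>, in both summands.\<close>
    have dec: "w \<in> Tg (Suc n) \<Longrightarrow> \<exists>a'\<in>E (Suc (Suc n)). \<exists>b'\<in>E' (Suc n). \<exists>z1\<in>Z \<cdot> E (Suc n). \<exists>z2\<in>Z \<cdot> E' n.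
      w = (a' \<oplus> x \<otimes> b') \<oplus> (z1 \<oplus> x \<otimes> z2)" for w
    proof -
      assume "w \<in> Tg (Suc n)"
      then obtain p q where pq: "p \<in> E' (Suc (Suc n))" "q \<in> Z \<cdot> E' (Suc n)" "w = p \<oplus> q"
        by (auto simp: Tg_def set_add_iff)
      have "Z \<cdot> E' (Suc n) = (Z \<cdot> E (Suc n)) <+> multiples x (Z \<cdot> E' n)"
        unfolding E'_Suc[of n]
        using ideal_prod_distr(1)[OF snoc.prems(3) EI xE'I] prod_multiples[OF x EI' snoc.prems(3)] by simp
      hence "\<exists>z1\<in>Z \<cdot> E (Suc n). \<exists>z2\<in>Z \<cdot> E' n. q = z1 \<oplus> x \<otimes> z2" using pq(2) by (auto simp: set_add_iff multiples_def)
      moreover have "\<exists>a'\<in>E (Suc (Suc n)). \<exists>b'\<in>E' (Suc n). p = a' \<oplus> x \<otimes> b'"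
        using pq(1) unfolding E'_Suc[of "Suc n"] by (auto simp: set_add_iff multiples_def)
      ultimately show ?thesis using pq(3) by blast
    qed
    note c = ideal_facts(1)[OF EI, THEN subsetD] ideal_facts(1)[OF EI', THEN subsetD]
      ideal_facts(1)[OF ZI(1), THEN subsetD] ideal_facts(1)[OF ZI(2), THEN subsetD]
    have y: "y \<in> carrier R" by (rule snoc.prems(4))
    obtain a b where ab: "a \<in> E (Suc n)" "b \<in> E' n" "v = a \<oplus> x \<otimes> b"
      using Suc.prems(1) unfolding E'_Suc by (auto simp: set_add_iff multiples_def)
    have ZE'N: "Z \<cdot> E' n \<subseteq> N" for n
      using ideal_prod_absorb(1)[OF EI' ideal_facts(1)[OF snoc.prems(3)]] E'N by blast
    note NI = ideal_facts[OF N]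
    \<comment> \<open>With v = a + x b, everything free of \<open>x\<close> lies in
      \<open>E (Suc n)\<close>. Cancelling \<open>x\<close> there leaves y b in \<open>Tg n\<close>,
      one degree lower, where the inner induction applies.\<close>
    have bT: "b \<in> Tg n"
    proof (rule Suc.IH[OF ab(2)])
      obtain a' b' z1 z2 where d: "a' \<in> E (Suc (Suc n))" "b' \<in> E' (Suc n)" "z1 \<in> Z \<cdot> E (Suc n)" "z2 \<in> Z \<cdot> E' n"
        "y \<otimes> v = (a' \<oplus> x \<otimes> b') \<oplus> (z1 \<oplus> x \<otimes> z2)" using dec[OF Suc.prems(2)] by blast
      note dc = d(1)[THEN c(1)] d(2)[THEN c(2)] d(3)[THEN c(3)] d(4)[THEN c(4)] ab(1)[THEN c(1)] ab(2)[THEN c(2)]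
      have "x \<otimes> (y \<otimes> b \<ominus> b' \<ominus> z2) = y \<otimes> (a \<oplus> x \<otimes> b) \<ominus> y \<otimes> a \<ominus> x \<otimes> b' \<ominus> x \<otimes> z2"
        using dc x y by algebra
      also have "\<dots> = (a' \<oplus> x \<otimes> b') \<oplus> (z1 \<oplus> x \<otimes> z2) \<ominus> y \<otimes> a \<ominus> x \<otimes> b' \<ominus> x \<otimes> z2"
        using d(5) ab(3) by simp
      also have "\<dots> = (a' \<oplus> z1) \<ominus> y \<otimes> a" using dc x y by algebra
      finally have eq: "x \<otimes> (y \<otimes> b \<ominus> b' \<ominus> z2) = (a' \<oplus> z1) \<ominus> y \<otimes> a" .
      have "E (Suc (Suc n)) \<subseteq> E (Suc n)" unfolding E_def
        by (intro ideal_prod_mono ideal_power_antimono X) auto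
      moreover have "Z \<cdot> E (Suc n) \<subseteq> E (Suc n)"
        by (rule ideal_prod_absorb(1)[OF EI ideal_facts(1)[OF snoc.prems(3)]])
      ultimately have "(a' \<oplus> z1) \<ominus> y \<otimes> a \<in> E (Suc n)"
        using d(1,3) ab(1) ideal_facts(3,4,6)[OF EI[of "Suc n"]] y by blast
      moreover have "y \<otimes> b \<ominus> b' \<ominus> z2 \<in> N"
        using NI(4,6) y ab(2) d(2,4) E'N ZE'N by (meson subsetD)
      ultimately have "y \<otimes> b \<ominus> b' \<ominus> z2 \<in> E (Suc n)" using H[of "Suc n"] unfolding regular_on_def eq[symmetric] by blast
      hence "y \<otimes> b \<ominus> b' \<ominus> z2 \<in> E' (Suc n)" using EE' by blast
      hence "(y \<otimes> b \<ominus> b' \<ominus> z2) \<oplus> b' \<in> E' (Suc n)" using ideal_facts(3)[OF EI'] d(2) by blast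
      moreover have "y \<otimes> b = ((y \<otimes> b \<ominus> b' \<ominus> z2) \<oplus> b') \<oplus> z2" using dc x y by algebra
      ultimately show "y \<otimes> b \<in> Tg n" unfolding Tg_def set_add_iff using d(4) by blast
    qed
    hence xb: "x \<otimes> b \<in> Tg (Suc n)" using xT by (auto simp: multiples_def)
    have abc: "a \<in> carrier R" "b \<in> carrier R" using ab c by blast+
    have "y \<otimes> v \<ominus> y \<otimes> (x \<otimes> b) \<in> Tg (Suc n)" using TI(4)[OF Suc.prems(2) TI(6)[OF y xb]] .
    moreover have "y \<otimes> v \<ominus> y \<otimes> (x \<otimes> b) = y \<otimes> a" unfolding ab(3) using abc x y by algebra
    ultimately have "y \<otimes> a \<in> Tg (Suc n)" by simp
    then obtain a' b' z1 z2 where d: "a' \<in> E (Suc (Suc n))" "b' \<in> E' (Suc n)" "z1 \<in> Z \<cdot> E (Suc n)" "z2 \<in> Z \<cdot> E' n"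
      "y \<otimes> a = (a' \<oplus> x \<otimes> b') \<oplus> (z1 \<oplus> x \<otimes> z2)" using dec by blast
    note dc = d(1)[THEN c(1)] d(2)[THEN c(2)] d(3)[THEN c(3)] d(4)[THEN c(4)]
    have "x \<otimes> (b' \<oplus> z2) = (a' \<oplus> x \<otimes> b') \<oplus> (z1 \<oplus> x \<otimes> z2) \<ominus> (a' \<oplus> z1)"
      using dc x y by algebra
    hence eq: "x \<otimes> (b' \<oplus> z2) = y \<otimes> a \<ominus> (a' \<oplus> z1)" using d(5) by simp
    have "E (Suc (Suc n)) \<subseteq> E (Suc n)" unfolding E_def
      by (intro ideal_prod_mono ideal_power_antimono X) auto
    moreover have "Z \<cdot> E (Suc n) \<subseteq> E (Suc n)"
      by (rule ideal_prod_absorb(1)[OF EI ideal_facts(1)[OF snoc.prems(3)]])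
    ultimately have "y \<otimes> a \<ominus> (a' \<oplus> z1) \<in> E (Suc n)"
      using d(1,3) ab(1) ideal_facts(3,4,6)[OF EI[of "Suc n"]] y by blast
    moreover have "b' \<oplus> z2 \<in> N" using NI(3) d(2,4) E'N ZE'N by (meson subsetD)
    ultimately have bz: "b' \<oplus> z2 \<in> E (Suc n)" using H[of "Suc n"] unfolding regular_on_def eq[symmetric] by blast
    \<comment> \<open>What remains is an element \<open>a\<close> free of \<open>x\<close> for which
      y a involves \<open>x\<close> only through x E(n+1). Absorbing \<open>x\<close> into
      \<open>Z\<close> turns this remainder into an instance for the shorter sequence; this is the
      step for which \<open>Z\<close> was introduced.\<close>
    define Z' where "Z' = Z <+> multiples x (carrier R)"
    have Z': "ideal Z' R" unfolding Z'_def using snoc.prems(3) x oneideal by (intro add_ideals) auto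
    have Z'prod: "Z' \<cdot> K = (Z \<cdot> K) <+> multiples x K" if "ideal K R" for K
    proof -
      have "Z' \<cdot> K = (Z \<cdot> K) <+> (multiples x (carrier R) \<cdot> K)" unfolding Z'_def
        by (rule ideal_prod_distr(2)) (use that snoc.prems(3) x oneideal in auto)
      thus ?thesis using principal_prod[OF x that] by simp
    qed
    have "regular_on y N ((X \<cdot> N) <+> (Z' \<cdot> N))"
    proof -
      have "X' \<cdot> N = (X \<cdot> N) <+> multiples x N"
        unfolding X'_eq using ideal_prod_distr(2)[OF N X, of "multiples x (carrier R)"] principal_prod[OF x N] x oneideal
        by simp
      hence "(X' \<cdot> N) <+> (Z \<cdot> N) = ((X \<cdot> N) <+> multiples x N) <+> (Z \<cdot> N)" by simp
      also have "\<dots> = (X \<cdot> N) <+> (multiples x N <+> (Z \<cdot> N))"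
        using X N x snoc.prems(3) by (intro add_ideals_assoc) (auto intro: ideal_prod_is_ideal)
      also have "multiples x N <+> (Z \<cdot> N) = Z' \<cdot> N"
        using N x snoc.prems(3) unfolding Z'prod[OF N] by (intro add_ideals_comm) (auto intro: ideal_prod_is_ideal)
      finally show ?thesis using snoc.prems(5) unfolding X'_def by simp
    qed
    from G[OF Z' y this, of "Suc n"]
    have reg: "regular_on y (E (Suc n)) (E (Suc (Suc n)) <+> (Z' \<cdot> E (Suc n)))" .
    have "y \<otimes> a = a' \<oplus> (z1 \<oplus> x \<otimes> (b' \<oplus> z2))" unfolding d(5) using dc x by algebra
    moreover have "z1 \<oplus> x \<otimes> (b' \<oplus> z2) \<in> Z' \<cdot> E (Suc n)"
      unfolding Z'prod[OF EI] set_add_iff using d(3) bz multiplesI by blast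
    ultimately have "y \<otimes> a \<in> E (Suc (Suc n)) <+> (Z' \<cdot> E (Suc n))"
      unfolding set_add_iff using d(1) by blast
    hence "a \<in> E (Suc (Suc n)) <+> (Z' \<cdot> E (Suc n))" using reg ab(1) unfolding regular_on_def by blast
    moreover have "E (Suc (Suc n)) <+> (Z' \<cdot> E (Suc n)) \<subseteq> Tg (Suc n)"
    proof (rule set_add_least[OF TgI])
      have up: "E' (Suc (Suc n)) \<subseteq> Tg (Suc n)" "Z \<cdot> E' (Suc n) \<subseteq> Tg (Suc n)"
        unfolding Tg_def by (rule set_add_upper[OF EI' ZI(2)])+
      show "E (Suc (Suc n)) \<subseteq> Tg (Suc n)" using EE' up(1) by blast
      have "Z \<cdot> E (Suc n) \<subseteq> Tg (Suc n)"
        using ideal_prod_mono[OF order_refl EE', of Z "Suc n"] up(2) by blast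
      moreover have "multiples x (E (Suc n)) \<subseteq> Tg (Suc n)"
        using multiples_mono[OF EE', of x "Suc n"] xE'[of "Suc n"] up(1) by blast
      ultimately show "Z' \<cdot> E (Suc n) \<subseteq> Tg (Suc n)"
        unfolding Z'prod[OF EI] by (intro set_add_least[OF TgI])
    qed
    ultimately have "a \<in> Tg (Suc n)" by blast
    thus ?case unfolding ab(3) using TI(3) xb by blast
  qed
  show ?case
    unfolding regular_on_def using main unfolding Tg_def E'_def X'_def by blast
qed

lemma regular_on_gen_ideal_power:
  assumes N: "ideal N R" and xs: "set xs \<subseteq> carrier R" "regular_seq_on N {\<zero>} xs"
    and y: "y \<in> carrier R" "regular_on y N (gen_ideal xs \<cdot> N)"
  shows "regular_on y N (ideal_power R (gen_ideal xs) n \<cdot> N)"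
proof (rule regular_on_powers[OF N gen_ideal_ideal[OF xs(1)] y])
  fix n
  have add0: "A <+> ({\<zero>} \<cdot> K) = A" if "ideal A R" "ideal K R" for A K
    using that ideal_facts(1)[OF that(1)]
    by (force simp: set_add_iff ideal_prod_commute zeroideal ideal_prod_zero)
  have I: "ideal (ideal_power R (gen_ideal xs) n \<cdot> N) R" for n
    by (intro ideal_prod_is_ideal ideal_power_ideal gen_ideal_ideal xs N)
  have "regular_on y N ((gen_ideal xs \<cdot> N) <+> ({\<zero>} \<cdot> N))"
    unfolding add0[OF ideal_prod_is_ideal[OF gen_ideal_ideal[OF xs(1)] N] N] by (rule y)
  from regular_on_graded_pieces[OF N xs zeroideal y(1) this, of n]
  show "regular_on y (ideal_power R (gen_ideal xs) n \<cdot> N) (ideal_power R (gen_ideal xs) (Suc n) \<cdot> N)"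
    unfolding add0[OF I I] .
qed

end

section \<open>Counting in a Noetherian local ring\<close>

lemma ideal_as_module_simps [simp]:
  "carrier (ideal_as_module R N) = N" "\<zero>\<^bsub>ideal_as_module R N\<^esub> = \<zero>\<^bsub>R\<^esub>"
  "x \<oplus>\<^bsub>ideal_as_module R N\<^esub> y = x \<oplus>\<^bsub>R\<^esub> y" "r \<odot>\<^bsub>ideal_as_module R N\<^esub> x = r \<otimes>\<^bsub>R\<^esub> x"
  by (simp_all add: ideal_as_module_def)

context cring
begin

lemma module_ideal_as_module:
  assumes "ideal N R"
  shows "module R (ideal_as_module R N)"
proof (rule moduleI)
  note N = ideal_facts[OF assms]
  show "cring R" by (rule cring_axioms)
  have c: "x \<in> carrier R" if "x \<in> N" for x using that N(1) by auto
  show "abelian_group (ideal_as_module R N)"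
  proof (rule abelian_groupI)
    show "\<exists>y\<in>carrier (ideal_as_module R N). y \<oplus>\<^bsub>ideal_as_module R N\<^esub> x = \<zero>\<^bsub>ideal_as_module R N\<^esub>"
      if "x \<in> carrier (ideal_as_module R N)" for x
      using that N(5) c by (intro bexI[of _ "\<ominus> x"]) (auto simp: l_neg)
  qed (use N(2,3) c in \<open>auto simp: a_ac\<close>)
qed (use ideal_facts[OF assms] in \<open>auto simp: l_distr r_distr m_assoc subset_iff\<close>)

lemma submodule_ideal_as_module:
  assumes "ideal N R"
  shows "submodule P R (ideal_as_module R N) \<longleftrightarrow> ideal P R \<and> P \<subseteq> N"
proof
  interpret M: module R "ideal_as_module R N" by (rule module_ideal_as_module[OF assms])
  assume P: "submodule P R (ideal_as_module R N)"
  note PI = M.submodule_facts[OF P]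
  have "ideal P R"
    by (rule ideal_intro) (use PI ideal_facts(1)[OF assms] in auto)
  thus "ideal P R \<and> P \<subseteq> N" using PI(1) by simp
next
  interpret M: module R "ideal_as_module R N" by (rule module_ideal_as_module[OF assms])
  assume P: "ideal P R \<and> P \<subseteq> N"
  note PI = ideal_facts[OF conjunct1[OF P]]
  have neg: "\<ominus>\<^bsub>ideal_as_module R N\<^esub> x = \<ominus> x" if "x \<in> P" for x
    by (rule M.minus_equality) (use that P PI ideal_facts(1)[OF assms] in \<open>auto simp: l_neg\<close>)
  show "submodule P R (ideal_as_module R N)"
    by (rule M.submoduleI) (use P PI neg in auto)
qed

end

locale noetherian_local_ring = noetherian_cring R + local_ring R \<mm> for R (structure) and \<mm>
begin

lemma \<mm>_ideal [simp, intro]: "ideal \<mm> R" by (rule is_ideal)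

lemmas \<mm>_facts = ideal_facts[OF \<mm>_ideal]

lemma proper_le_\<mm>:
  assumes "ideal A R" "\<one> \<notin> A"
  shows "A \<subseteq> \<mm>"
proof -
  define \<A> where "\<A> = {B. ideal B R \<and> \<one> \<notin> B}"
  show ?thesis
  proof (rule maximal_element[of \<A> A])
    show "\<A> \<noteq> {}" "A \<in> \<A>" "\<And>B. B \<in> \<A> \<Longrightarrow> ideal B R" using assms by (auto simp: \<A>_def)
    fix M assume M: "M \<in> \<A>" "A \<subseteq> M" "\<And>B. B \<in> \<A> \<Longrightarrow> M \<subseteq> B \<Longrightarrow> B = M"
    have "maximalideal M R"
    proof (rule maximalidealI)
      show "ideal M R" using M by (simp add: \<A>_def)
      show "carrier R \<noteq> M" using M by (auto simp: \<A>_def)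
      fix J assume J: "ideal J R" "M \<subseteq> J" "J \<subseteq> carrier R"
      show "J = M \<or> J = carrier R"
        using M(3)[of J] J ideal.one_imp_carrier[OF J(1)] by (auto simp: \<A>_def)
    qed
    thus "A \<subseteq> \<mm>" using unique_maximal M(2) by blast
  qed
qed

lemma one_notin_\<mm>: "\<one> \<notin> \<mm>"
  using I_notcarr one_imp_carrier by blast

lemma inverse_ex:
  assumes "x \<in> carrier R" "x \<notin> \<mm>"
  shows "\<exists>y\<in>carrier R. y \<otimes> x = \<one>"
proof -
  have "ideal (PIdl x) R" "x \<in> PIdl x" using assms by (auto simp: cgenideal_ideal cgenideal_self)
  hence "\<one> \<in> PIdl x" using proper_le_\<mm> assms(2) by blast
  thus ?thesis unfolding cgenideal_def by auto
qed

lemma prime_\<mm>: "primeideal \<mm> R"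
  by (rule maximalideal_prime) (rule is_maximalideal)

lemma prime_le_\<mm>: "primeideal P R \<Longrightarrow> P \<subseteq> \<mm>"
  using proper_le_\<mm> primeideal_facts by blast

sublocale regular: module R "ideal_as_module R (carrier R)"
  by (rule module_ideal_as_module[OF oneideal])

lemma regular_submodule [simp]: "submodule P R (ideal_as_module R (carrier R)) \<longleftrightarrow> ideal P R"
  using submodule_ideal_as_module[OF oneideal] ideal_facts(1) by auto

lemma regular_adjoin: "regular.adjoin P f = P <+> PIdl f"
  by (simp add: regular.adjoin_def set_add_iff cgenideal_def set_eq_iff) blast

subsection \<open>Nakayama's lemma\<close>

text \<open>A maximal proper subideal \<open>U\<close> of \<open>N\<close> exists by the chain
  condition. The quotient is simple, hence annihilated by \<open>\<mm>\<close>, so \<mm> N stays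
  inside \<open>U\<close>.\<close>

lemma nakayama:
  assumes N: "ideal N R" "N \<noteq> {\<zero>}"
  shows "\<not> N \<subseteq> \<mm> \<cdot> N"
proof -
  define \<A> where "\<A> = {U. ideal U R \<and> U \<subset> N}"
  have zero: "{\<zero>} \<in> \<A>" using N ideal_facts(2)[OF N(1)] zeroideal by (auto simp: \<A>_def)
  show ?thesis
  proof (rule maximal_element[of \<A> "{\<zero>}"])
    show "\<A> \<noteq> {}" "{\<zero>} \<in> \<A>" "\<And>B. B \<in> \<A> \<Longrightarrow> ideal B R" using zero by (auto simp: \<A>_def)
    fix U assume U: "U \<in> \<A>" "\<And>B. B \<in> \<A> \<Longrightarrow> U \<subseteq> B \<Longrightarrow> B = U"
    have UI: "ideal U R" "U \<subset> N" using U(1) by (auto simp: \<A>_def)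
    note UF = ideal_facts[OF UI(1)] and NF = ideal_facts[OF N(1)]
    have "\<mm> \<cdot> N \<subseteq> U"
    proof (rule ideal_prod_least[OF UI(1)], rule ccontr)
      fix r w assume r: "r \<in> \<mm>" and w: "w \<in> N" and nU: "r \<otimes> w \<notin> U"
      have c: "r \<in> carrier R" "w \<in> carrier R" using r w \<mm>_facts(1) NF(1) by auto
      have P: "ideal (PIdl (r \<otimes> w)) R" "r \<otimes> w \<in> PIdl (r \<otimes> w)"
        using c by (auto intro: cgenideal_ideal cgenideal_self)
      have "PIdl (r \<otimes> w) \<subseteq> N" by (rule cgenideal_minimal[OF N(1)]) (use NF(6) c w in auto)
      hence sub: "U <+> PIdl (r \<otimes> w) \<subseteq> N" using UI(2) by (intro set_add_least[OF N(1)]) auto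
      have "U <+> PIdl (r \<otimes> w) \<notin> \<A>"
        using U(2)[of "U <+> PIdl (r \<otimes> w)"] set_add_upper[OF UI(1) P(1)] P(2) nU by blast
      hence "w \<in> U <+> PIdl (r \<otimes> w)" using w sub add_ideals[OF UI(1) P(1)] unfolding \<A>_def by blast
      then obtain u s where us: "u \<in> U" "s \<in> carrier R" "w = u \<oplus> s \<otimes> (r \<otimes> w)"
        by (auto simp: set_add_iff cgenideal_def)
      have uc: "u \<in> carrier R" using us UF by auto
      have sr: "s \<otimes> r \<in> \<mm>" using \<mm>_facts(6) us r by blast
      have "\<one> \<ominus> s \<otimes> r \<notin> \<mm>"
      proof
        assume "\<one> \<ominus> s \<otimes> r \<in> \<mm>"
        hence "(\<one> \<ominus> s \<otimes> r) \<oplus> s \<otimes> r \<in> \<mm>" using \<mm>_facts(3) sr by blast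
        moreover have "(\<one> \<ominus> s \<otimes> r) \<oplus> s \<otimes> r = \<one>" using us c by algebra
        ultimately show False using one_notin_\<mm> by simp
      qed
      then obtain y where y: "y \<in> carrier R" "y \<otimes> (\<one> \<ominus> s \<otimes> r) = \<one>" using inverse_ex[of "\<one> \<ominus> s \<otimes> r"] us(2) c by auto
      have "(\<one> \<ominus> s \<otimes> r) \<otimes> w = (u \<oplus> s \<otimes> (r \<otimes> w)) \<ominus> s \<otimes> (r \<otimes> w)" using us c by algebra
      also have "\<dots> = u" using us(2) c uc by algebra
      finally have "y \<otimes> ((\<one> \<ominus> s \<otimes> r) \<otimes> w) \<in> U" using UF(6) us y by simp
      moreover have "y \<otimes> ((\<one> \<ominus> s \<otimes> r) \<otimes> w) = (y \<otimes> (\<one> \<ominus> s \<otimes> r)) \<otimes> w" using y(1) us(2) c by algebra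
      ultimately have "w \<in> U" using y c by simp
      thus False using nU UF(6) c by blast
    qed
    thus ?thesis using UI by blast
  qed
qed

subsection \<open>Growth along a regular sequence\<close>

text \<open>\<open>c k n\<close> is the number of monomials of degree n in k variables; zero
  variables are listed separately because natural subtraction would give 1 for every n. Monomials
  either avoid the last variable \<open>x\<close> or are \<open>x\<close> times one of lower degree.
  This yields Pascal's recursion, and regularity of \<open>x\<close> makes the two kinds of elements
  jointly independent.\<close>

lemma indep_regular_seq:
  assumes N: "ideal N R" and vs: "regular.indep (\<mm> \<cdot> N) vs" "set vs \<subseteq> N"
  defines "c \<equiv> \<lambda>k n. if k = 0 then (if n = 0 then 1 else 0) else (n + k - 1) choose (k - 1)"
  shows "set xs \<subseteq> \<mm> \<Longrightarrow> regular_seq_on N {\<zero>} xs \<Longrightarrow>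
    \<exists>ws. regular.indep (\<mm> \<cdot> (ideal_power R (gen_ideal xs) n \<cdot> N)) ws \<and>
      set ws \<subseteq> ideal_power R (gen_ideal xs) n \<cdot> N \<and> length ws = length vs * c (length xs) n"
proof (induction xs arbitrary: n rule: rev_induct)
  case Nil
  show ?case
  proof (cases n)
    case 0 thus ?thesis using vs N by (intro exI[of _ vs]) (auto simp: c_def carrier_prod)
  qed (auto simp: c_def intro!: exI[of _ "[]"])
next
  case (snoc x xs)
  define X where "X = gen_ideal xs"
  define X' where "X' = gen_ideal (xs @ [x])"
  have xm: "x \<in> \<mm>" "set xs \<subseteq> \<mm>" using snoc.prems by auto
  have x: "x \<in> carrier R" and xs: "set xs \<subseteq> carrier R" using xm \<mm>_facts(1) by auto
  have X: "ideal X R" unfolding X_def by (rule gen_ideal_ideal[OF xs])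
  have X'_eq: "X' = X <+> multiples x (carrier R)" unfolding X'_def X_def by (rule gen_ideal_snoc)
  have X': "ideal X' R" unfolding X'_def using x xs by (intro gen_ideal_ideal) auto
  have Xm: "X \<subseteq> \<mm>" unfolding X_def by (rule gen_ideal_least[OF \<mm>_ideal xm(2)])
  define E where "E n = ideal_power R X n \<cdot> N" for n
  define E' where "E' n = ideal_power R X' n \<cdot> N" for n
  note snoc_facts = gen_ideal_power_snoc[OF N x xs, folded X_def X'_def, folded E_def E'_def]
  note EI = snoc_facts(1) and EI' = snoc_facts(2) and E'_Suc = snoc_facts(3) and EE' = snoc_facts(4)
    and xE' = snoc_facts(5) and E'N = snoc_facts(6)
  have mEI: "ideal (\<mm> \<cdot> E n) R" and mEI': "ideal (\<mm> \<cdot> E' n) R" for n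
    using EI EI' by (auto intro: ideal_prod_is_ideal)
  have seq: "regular_seq_on N {\<zero>} xs" "regular_on x N (X \<cdot> N)"
    using snoc.prems(2) gen_ideal_prod[OF xs N] unfolding regular_seq_on_snoc X_def by auto
  have H: "regular_on x N (E n)" for n
    unfolding E_def X_def
    by (rule regular_on_gen_ideal_power[OF N xs seq(1) x]) (use seq(2) X_def in simp)
  have "\<exists>ws. regular.indep (\<mm> \<cdot> E' n) ws \<and> set ws \<subseteq> E' n \<and> length ws = length vs * c (length (xs @ [x])) n"
  proof (induction n)
    case 0
    show ?case using vs N X' by (intro exI[of _ vs]) (auto simp: c_def E'_def carrier_prod)
  next
    case (Suc n)
    obtain A where A: "regular.indep (\<mm> \<cdot> E (Suc n)) A" "set A \<subseteq> E (Suc n)" "length A = length vs * c (length xs) (Suc n)"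
      using snoc.IH[OF xm(2) seq(1), of "Suc n"] unfolding E_def X_def by blast
    obtain B where B: "regular.indep (\<mm> \<cdot> E' n) B" "set B \<subseteq> E' n" "length B = length vs * c (length (xs @ [x])) n"
      using Suc by blast
    define Q where "Q = \<mm> \<cdot> E' (Suc n)"
    have QI: "ideal Q R" unfolding Q_def by (rule mEI')
    have Q_eq: "Q = (\<mm> \<cdot> E (Suc n)) <+> multiples x (\<mm> \<cdot> E' n)"
      unfolding Q_def E'_Suc
      using ideal_prod_distr(1)[OF \<mm>_ideal EI multiples_ideal[OF x EI']] prod_multiples[OF x EI' \<mm>_ideal] by simp
    have mE'E': "\<mm> \<cdot> E' n \<subseteq> E' n" by (rule ideal_prod_absorb(1)[OF EI' \<mm>_facts(1)])
    have mEE: "\<mm> \<cdot> E (Suc n) \<subseteq> E (Suc n)" by (rule ideal_prod_absorb(1)[OF EI \<mm>_facts(1)])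
    \<comment> \<open>One factor of X^(n+1) is used up as a factor from
      \<open>\<mm>\<close>.\<close>
    have EmE': "E (Suc n) \<subseteq> \<mm> \<cdot> E' n"
    proof -
      have "E (Suc n) = X \<cdot> E n" unfolding E_def using X N by (simp add: ideal_prod_ac ideal_prod_is_ideal)
      also have "\<dots> \<subseteq> \<mm> \<cdot> E' n" by (intro ideal_prod_mono Xm EE')
      finally show ?thesis .
    qed
    \<comment> \<open>Multiplication by \<open>x\<close> is injective from E'(n)/\<mm> E'(n) even
      after dividing by everything free of \<open>x\<close>.\<close>
    have key: "v \<in> \<mm> \<cdot> E' n" if v: "v \<in> E' n" "x \<otimes> v \<in> Q <+> E (Suc n)" for v
    proof -
      obtain q e where qe: "q \<in> Q" "e \<in> E (Suc n)" "x \<otimes> v = q \<oplus> e" using v(2) by (auto simp: set_add_iff)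
      then obtain z1 z2 where z: "z1 \<in> \<mm> \<cdot> E (Suc n)" "z2 \<in> \<mm> \<cdot> E' n" "q = z1 \<oplus> x \<otimes> z2"
        unfolding Q_eq by (auto simp: set_add_iff multiples_def)
      have cc: "v \<in> carrier R" "e \<in> carrier R" "z1 \<in> carrier R" "z2 \<in> carrier R"
        using v qe z ideal_facts(1)[OF EI] ideal_facts(1)[OF EI'] ideal_facts(1)[OF mEI] ideal_facts(1)[OF mEI'] by blast+
      have "x \<otimes> (v \<ominus> z2) = x \<otimes> v \<ominus> x \<otimes> z2" using cc x by algebra
      also have "\<dots> = z1 \<oplus> e" unfolding qe(3) z(3) using cc x by algebra
      finally have "x \<otimes> (v \<ominus> z2) \<in> E (Suc n)" using ideal_facts(3)[OF EI] z(1) qe(2) mEE by auto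
      moreover have "v \<ominus> z2 \<in> N" using ideal_facts(4)[OF EI'] v(1) z(2) mE'E' E'N by blast
      ultimately have "v \<ominus> z2 \<in> E (Suc n)" using H[of "Suc n"] unfolding regular_on_def by blast
      hence "(v \<ominus> z2) \<oplus> z2 \<in> \<mm> \<cdot> E' n" using ideal_facts(3)[OF mEI'] z(2) EmE' by blast
      moreover have "(v \<ominus> z2) \<oplus> z2 = v" using cc by algebra
      ultimately show ?thesis by simp
    qed
    have "regular.indep Q A"
    proof (rule regular.indep_restrict[of "E (Suc n)"])
      show "submodule (E (Suc n)) R (ideal_as_module R (carrier R))"
        "submodule (\<mm> \<cdot> E (Suc n)) R (ideal_as_module R (carrier R))"
        "submodule Q R (ideal_as_module R (carrier R))" using EI mEI QI by auto
      show "regular.indep (\<mm> \<cdot> E (Suc n)) A" "set A \<subseteq> E (Suc n)" by (fact A)+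
      \<comment> \<open>If x z2 is free of \<open>x\<close>, then regularity puts z2 into
        \<open>E (Suc n)\<close>, and the factor \<open>x\<close> lies in
        \<open>\<mm>\<close>.\<close>
      show "E (Suc n) \<inter> Q \<subseteq> \<mm> \<cdot> E (Suc n)"
      proof
        fix z assume z: "z \<in> E (Suc n) \<inter> Q"
        then obtain z1 z2 where z12: "z1 \<in> \<mm> \<cdot> E (Suc n)" "z2 \<in> \<mm> \<cdot> E' n" "z = z1 \<oplus> x \<otimes> z2"
          unfolding Q_eq by (auto simp: set_add_iff multiples_def)
        have cc: "z1 \<in> carrier R" "z2 \<in> carrier R"
          using z12 ideal_facts(1)[OF mEI] ideal_facts(1)[OF mEI'] by blast+
        have "x \<otimes> z2 = z \<ominus> z1" unfolding z12(3) using cc x by algebra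
        moreover have "z \<ominus> z1 \<in> E (Suc n)" using ideal_facts(4)[OF EI] z z12(1) mEE by blast
        moreover have "z2 \<in> N" using z12(2) mE'E' E'N by blast
        ultimately have "z2 \<in> E (Suc n)" using H[of "Suc n"] unfolding regular_on_def by auto
        hence "x \<otimes> z2 \<in> \<mm> \<cdot> E (Suc n)" using xm(1) by (intro ideal_prod.prod)
        thus "z \<in> \<mm> \<cdot> E (Suc n)" using z12 ideal_facts(3)[OF mEI] by blast
      qed
    qed
    moreover have "regular.indep (regular.span Q A) (map (\<lambda>v. x \<otimes> v) B)"
    proof (rule regular.indep_map[of "E' n"])
      show "submodule (E' n) R (ideal_as_module R (carrier R))"
        "submodule (\<mm> \<cdot> E' n) R (ideal_as_module R (carrier R))" using EI' mEI' by auto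
      show "submodule (regular.span Q A) R (ideal_as_module R (carrier R))"
        by (rule regular.span_submodule) (use QI A(2) ideal_facts(1)[OF EI, of "Suc n"] in auto)
      show "regular.indep (\<mm> \<cdot> E' n) B" "set B \<subseteq> E' n" by (fact B)+
      have "regular.span Q A \<subseteq> Q <+> E (Suc n)"
        by (rule regular.span_least)
          (use add_ideals[OF QI EI] set_add_upper[OF QI EI, of "Suc n"] A(2) in auto)
      thus "v \<in> \<mm> \<cdot> E' n" if "v \<in> E' n" "x \<otimes> v \<in> regular.span Q A" for v using key that by blast
    qed (use x in \<open>auto simp: r_distr m_lcomm\<close>)
    ultimately have "regular.indep Q (A @ map (\<lambda>v. x \<otimes> v) B)" by (simp add: regular.indep_append)
    moreover have "set (A @ map (\<lambda>v. x \<otimes> v) B) \<subseteq> E' (Suc n)"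
    proof -
      have "set A \<subseteq> E' (Suc n)" using A(2) EE' by blast
      thus ?thesis using B(2) xE'[of n] by (auto simp: multiples_def)
    qed
    moreover have "length (A @ map (\<lambda>v. x \<otimes> v) B) = length vs * c (length (xs @ [x])) (Suc n)"
    proof -
      have "c (length (xs @ [x])) (Suc n) = c (length xs) (Suc n) + c (length (xs @ [x])) n"
        by (cases "length xs") (auto simp: c_def)
      thus ?thesis using A(3) B(3) by (simp add: algebra_simps)
    qed
    ultimately show ?case unfolding Q_def by blast
  qed
  thus ?case unfolding E'_def X'_def .
qed

end

section \<open>Products of primes inside an ideal\<close>

context cring
begin

lemma mem_ideal_power: "y \<in> A \<Longrightarrow> A \<subseteq> carrier R \<Longrightarrow> y [^] (n::nat) \<in> ideal_power R A n"
proof (induction n)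
  case (Suc n) thus ?case by (auto intro: ideal_prod.prod)
qed simp

lemma add_multiples_add:
  assumes "ideal N R" "ideal V R" "ideal W R" "set xs \<subseteq> carrier R"
  shows "add_multiples N (V <+> W) xs = add_multiples N V xs <+> W"
  using assms(2,4)
proof (induction xs arbitrary: V)
  case (Cons x xs)
  have x: "ideal (multiples x N) R" using Cons.prems assms by auto
  have "(V <+> W) <+> multiples x N = (V <+> multiples x N) <+> W"
    using Cons.prems(1) assms(3) x by (simp add: add_ideals_assoc add_ideals_comm[of W])
  thus ?case using Cons add_ideals[OF Cons.prems(1) x] by simp
qed simp

lemma foldr_prod_ideal: "(\<And>A. A \<in> set As \<Longrightarrow> ideal A R) \<Longrightarrow> ideal (foldr (\<cdot>) As (carrier R)) R"
  by (induction As) (auto intro: oneideal ideal_prod_is_ideal)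

lemma foldr_prod_append:
  "(\<And>A. A \<in> set As \<union> set Bs \<Longrightarrow> ideal A R) \<Longrightarrow>
    foldr (\<cdot>) (As @ Bs) (carrier R) = foldr (\<cdot>) As (carrier R) \<cdot> foldr (\<cdot>) Bs (carrier R)"
  by (induction As) (auto simp: carrier_prod ideal_prod_assoc foldr_prod_ideal)

lemma primeideal_foldr_prod_le:
  assumes "primeideal Q R"
  shows "(\<And>A. A \<in> set As \<Longrightarrow> ideal A R) \<Longrightarrow> foldr (\<cdot>) As (carrier R) \<subseteq> Q \<Longrightarrow> \<exists>A\<in>set As. A \<subseteq> Q"
proof (induction As)
  case Nil thus ?case using primeideal_facts[OF assms] one_closed by auto
next
  case (Cons A As)
  thus ?case using primeideal_prod_le[OF assms, of A "foldr (\<cdot>) As (carrier R)"] foldr_prod_ideal[of As] by auto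
qed

end

context noetherian_cring
begin

text \<open>If \<open>U\<close> is proper and not prime, a product ab in \<open>U\<close> of
  elements outside \<open>U\<close> yields two strictly larger ideals whose product lies in
  \<open>U\<close>. The list stands in for the minimal primes: every prime over \<open>U\<close>
  contains one of its members.\<close>

lemma contains_prime_product:
  assumes "ideal U R"
  shows "\<exists>Ps. (\<forall>P\<in>set Ps. primeideal P R \<and> U \<subseteq> P) \<and> foldr (\<cdot>) Ps (carrier R) \<subseteq> U"
  using assms
proof (induction U rule: ideal_noetherian_induct)
  case (step U)
  note UF = ideal_facts[OF step.hyps]
  show ?case
  proof (cases "primeideal U R \<or> U = carrier R")
    case True
    thus ?thesis
    proof
      assume "primeideal U R"
      thus ?thesis using step.hyps by (intro exI[of _ "[U]"]) (auto simp: ideal_prod_one)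
    next
      assume "U = carrier R" thus ?thesis by (intro exI[of _ "[]"]) auto
    qed
  next
    case False
    then obtain a b where ab: "a \<in> carrier R" "b \<in> carrier R" "a \<otimes> b \<in> U" "a \<notin> U" "b \<notin> U"
      using primeidealI[OF step.hyps cring_axioms] by blast
    have P: "ideal (PIdl x) R" "x \<in> PIdl x" if "x \<in> carrier R" for x
      using that by (auto intro: cgenideal_ideal cgenideal_self)
    have big: "ideal (U <+> PIdl x) R \<and> U \<subset> U <+> PIdl x" if "x \<in> carrier R" "x \<notin> U" for x
      using add_ideals[OF step.hyps P(1)[OF that(1)]] set_add_upper[OF step.hyps P(1)[OF that(1)]] P(2)[OF that(1)] that
      by blast
    obtain Ps where Ps: "\<forall>P\<in>set Ps. primeideal P R \<and> U <+> PIdl a \<subseteq> P" "foldr (\<cdot>) Ps (carrier R) \<subseteq> U <+> PIdl a"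
      using step.IH[of "U <+> PIdl a"] big[OF ab(1,4)] by blast
    obtain Qs where Qs: "\<forall>P\<in>set Qs. primeideal P R \<and> U <+> PIdl b \<subseteq> P" "foldr (\<cdot>) Qs (carrier R) \<subseteq> U <+> PIdl b"
      using step.IH[of "U <+> PIdl b"] big[OF ab(2,5)] by blast
    have "foldr (\<cdot>) (Ps @ Qs) (carrier R) = foldr (\<cdot>) Ps (carrier R) \<cdot> foldr (\<cdot>) Qs (carrier R)"
      by (rule foldr_prod_append) (use Ps Qs primeideal_facts(1) in blast)
    also have "\<dots> \<subseteq> (U <+> PIdl a) \<cdot> (U <+> PIdl b)" by (rule ideal_prod_mono[OF Ps(2) Qs(2)])
    also have "\<dots> \<subseteq> U"
    proof (rule ideal_prod_least[OF step.hyps])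
      fix x y assume "x \<in> U <+> PIdl a" "y \<in> U <+> PIdl b"
      then obtain u r v s where *: "u \<in> U" "r \<in> carrier R" "x = u \<oplus> r \<otimes> a" "v \<in> U" "s \<in> carrier R" "y = v \<oplus> s \<otimes> b"
        by (auto simp: set_add_iff cgenideal_def)
      have c: "u \<in> carrier R" "v \<in> carrier R" using * UF(1) by auto
      have "x \<otimes> y = (y \<otimes> u \<oplus> (r \<otimes> a) \<otimes> v) \<oplus> (r \<otimes> s) \<otimes> (a \<otimes> b)"
        unfolding *(3,6) using c * ab(1,2) by algebra
      moreover have "y \<in> carrier R" "r \<otimes> a \<in> carrier R" "r \<otimes> s \<in> carrier R" using * c ab by auto
      ultimately show "x \<otimes> y \<in> U" using UF(3,6) * ab(3) by simp
    qed
    finally have "foldr (\<cdot>) (Ps @ Qs) (carrier R) \<subseteq> U" .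
    moreover have "primeideal P R \<and> U \<subseteq> P" if "P \<in> set (Ps @ Qs)" for P
      using that Ps(1) Qs(1) big[OF ab(1,4)] big[OF ab(2,5)] by (metis Un_iff psubset_imp_subset set_append subset_trans)
    ultimately show ?thesis by blast
  qed
qed

end

context noetherian_local_ring
begin

subsection \<open>Systems of parameters\<close>

text \<open>Adding to \<open>U\<close> an element outside all non-maximal primes of the list
  shortens every chain of primes above \<open>U\<close>. After \<open>e\<close> such steps only
  \<open>\<mm>\<close> contains the ideal, so a power of \<open>\<mm>\<close> does lie in it. For
  \<open>U\<close> zero this is a system of parameters.\<close>

lemma exists_parameters:
  assumes "ideal U R" "\<And>P. prime_chain R (Suc e) P \<Longrightarrow> \<not> U \<subseteq> P 0"
  shows "\<exists>ys a. length ys = e \<and> set ys \<subseteq> \<mm> \<and> ideal_power R \<mm> a \<subseteq> add_multiples (carrier R) U ys"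
  using assms
proof (induction e arbitrary: U)
  case 0
  obtain Ps where Ps: "\<forall>P\<in>set Ps. primeideal P R \<and> U \<subseteq> P" "foldr (\<cdot>) Ps (carrier R) \<subseteq> U"
    using contains_prime_product[OF 0(1)] by blast
  have "P = \<mm>" if "P \<in> set Ps" for P
  proof (rule ccontr)
    assume "P \<noteq> \<mm>"
    hence "P \<subset> \<mm>" using Ps that prime_le_\<mm> by blast
    hence "prime_chain R (Suc 0) (\<lambda>i. if i = 0 then P else \<mm>)"
      using Ps that prime_\<mm> by (auto simp: prime_chain_def le_Suc_eq)
    thus False using 0(2) Ps(1) that by fastforce
  qed
  hence Ps_eq: "Ps = replicate (length Ps) \<mm>" by (metis replicate_eqI)
  have "foldr (\<cdot>) (replicate n \<mm>) (carrier R) = ideal_power R \<mm> n" for n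
    by (induction n) (auto simp: ideal_prod_commute)
  hence "ideal_power R \<mm> (length Ps) \<subseteq> U" using Ps(2) Ps_eq by metis
  thus ?case by auto
next
  case (Suc e)
  obtain Ps where Ps: "\<forall>P\<in>set Ps. primeideal P R \<and> U \<subseteq> P" "foldr (\<cdot>) Ps (carrier R) \<subseteq> U"
    using contains_prime_product[OF Suc.prems(1)] by blast
  have "\<exists>y\<in>\<mm>. \<forall>P\<in>{P\<in>set Ps. P \<noteq> \<mm>}. y \<notin> P"
  proof (rule prime_avoidance)
    show "primeideal P R" "\<not> \<mm> \<subseteq> P" if "P \<in> {P \<in> set Ps. P \<noteq> \<mm>}" for P
      using that Ps(1) prime_le_\<mm> by blast+
  qed auto
  then obtain y where y: "y \<in> \<mm>" "\<And>P. P \<in> set Ps \<Longrightarrow> P \<noteq> \<mm> \<Longrightarrow> y \<notin> P" by auto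
  have yc: "y \<in> carrier R" using y \<mm>_facts(1) by auto
  define V where "V = U <+> multiples y (carrier R)"
  have yI: "ideal (multiples y (carrier R)) R" using yc oneideal by simp
  have V: "ideal V R" unfolding V_def by (rule add_ideals[OF Suc.prems(1) yI])
  have UV: "U \<subseteq> V" "y \<in> V"
    using set_add_upper[OF Suc.prems(1) yI] multiplesI[OF one_closed, of y] yc unfolding V_def by auto
  have "\<exists>ys a. length ys = e \<and> set ys \<subseteq> \<mm> \<and> ideal_power R \<mm> a \<subseteq> add_multiples (carrier R) V ys"
  proof (rule Suc.IH[OF V], rule notI)
    fix Q assume Q: "prime_chain R (Suc e) Q" and VQ: "V \<subseteq> Q 0"
    have Q0: "primeideal (Q 0) R" and Q1: "primeideal (Q 1) R" "Q 0 \<subset> Q 1" using Q by (auto simp: prime_chain_def)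
    have "foldr (\<cdot>) Ps (carrier R) \<subseteq> Q 0" using Ps(2) UV VQ by blast
    then obtain P where P: "P \<in> set Ps" "P \<subseteq> Q 0"
      using primeideal_foldr_prod_le[OF Q0] Ps(1) primeideal_facts(1) by metis
    have "P \<noteq> \<mm>" using P(2) Q1 prime_le_\<mm>[OF Q1(1)] by blast
    hence "P \<subset> Q 0" using P y(2)[OF P(1)] UV VQ by blast
    \<comment> \<open>A chain over \<open>V\<close> that is too long could be prolonged downwards by
      a prime of the list, which lies strictly below because \<open>y\<close> is not in it.\<close>
    have "prime_chain R (Suc (Suc e)) (\<lambda>i. if i = 0 then P else Q (i - 1))"
      unfolding prime_chain_def
    proof (intro conjI allI impI)
      fix i
      show "i \<le> Suc (Suc e) \<Longrightarrow> primeideal (if i = 0 then P else Q (i - 1)) R"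
        using Q Ps(1) P(1) by (simp add: prime_chain_def)
      show "i < Suc (Suc e) \<Longrightarrow> (if i = 0 then P else Q (i - 1)) \<subset> (if Suc i = 0 then P else Q (Suc i - 1))"
        using Q \<open>P \<subset> Q 0\<close> by (cases i) (simp_all add: prime_chain_def)
    qed
    thus False using Suc.prems(2) Ps(1) P(1) by fastforce
  qed
  then obtain ys a where "length ys = e" "set ys \<subseteq> \<mm>" "ideal_power R \<mm> a \<subseteq> add_multiples (carrier R) V ys" by blast
  thus ?case using y(1) unfolding V_def by (intro exI[of _ "y # ys"] exI[of _ a]) auto
qed

subsection \<open>Filtrations with simple quotients\<close>

text \<open>Each quotient is the residue field or zero, since \<open>w\<close> may already belong to
  \<open>V\<close>; the number therefore bounds the length of V/U from above without having to equal
  it.\<close>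

inductive simple_filtration :: "'a set \<Rightarrow> 'a set \<Rightarrow> nat \<Rightarrow> bool" for U where
  base: "simple_filtration U U 0"
| step: "simple_filtration U V n \<Longrightarrow> w \<in> carrier R \<Longrightarrow> (\<And>r. r \<in> \<mm> \<Longrightarrow> r \<otimes> w \<in> V) \<Longrightarrow>
    simple_filtration U (V <+> PIdl w) (Suc n)"

lemma simple_filtration_ideal: "simple_filtration U V n \<Longrightarrow> ideal U R \<Longrightarrow> ideal V R"
  by (induction rule: simple_filtration.induct) (auto intro: add_ideals cgenideal_ideal)

lemma simple_filtration_trans:
  assumes "simple_filtration V W n" "simple_filtration U V m"
  shows "simple_filtration U W (m + n)"
  using assms by (induction rule: simple_filtration.induct) (auto intro: simple_filtration.intros)

text \<open>The function \<open>h\<close> takes the place of the length of A/U: it is bounded by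
  \<open>L\<close> and strictly increasing on the ideals between. At each step it is refined by
  recording whether \<open>A\<close> reaches the new simple quotient.\<close>

lemma simple_filtration_length:
  assumes "simple_filtration U W L" "ideal U R"
  shows "\<exists>h. (\<forall>A. h A \<le> L) \<and> (\<forall>A B. ideal A R \<longrightarrow> ideal B R \<longrightarrow> U \<subseteq> A \<longrightarrow> A \<subset> B \<longrightarrow> B \<subseteq> W \<longrightarrow> h A < (h B :: nat))"
  using assms
proof (induction rule: simple_filtration.induct)
  case base show ?case by (intro exI[of _ "\<lambda>_. 0"]) auto
next
  case (step V n w)
  obtain h where h: "\<And>A. h A \<le> n"
    "\<And>A B. ideal A R \<Longrightarrow> ideal B R \<Longrightarrow> U \<subseteq> A \<Longrightarrow> A \<subset> B \<Longrightarrow> B \<subseteq> V \<Longrightarrow> h A < h B"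
    using step by blast
  have V: "ideal V R" using simple_filtration_ideal step by blast
  have UV: "U \<subseteq> V" using step.hyps(1)
  proof (induction rule: simple_filtration.induct)
    case (step V n w)
    thus ?case using set_add_upper(1)[of V "PIdl w"] simple_filtration_ideal[OF step.hyps(1)] \<open>ideal U R\<close> cgenideal_ideal
      by blast
  qed simp
  define h' where "h' A = h (A \<inter> V) + (if A \<subseteq> V then 0 else 1)" for A
  show ?case
  proof (intro exI[of _ h'] conjI allI impI)
    show "h' A \<le> Suc n" for A using h(1)[of "A \<inter> V"] by (simp add: h'_def)
    fix A B assume A: "ideal A R" and B: "ideal B R" and UA: "U \<subseteq> A" and AB: "A \<subset> B" and BW: "B \<subseteq> V <+> PIdl w"
    have AV: "ideal (A \<inter> V) R" "ideal (B \<inter> V) R" using A B V by (auto intro: Int_ideal)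
    show "h' A < h' B"
    proof (cases "A \<inter> V = B \<inter> V")
      case False
      hence "h (A \<inter> V) < h (B \<inter> V)" using AB UA UV by (intro h(2)[OF AV]) auto
      moreover have "B \<subseteq> V \<Longrightarrow> A \<subseteq> V" using AB by blast
      ultimately show ?thesis by (auto simp: h'_def)
    next
      case True
      \<comment> \<open>If \<open>A\<close> left \<open>V\<close>, it would generate the simple
        quotient above \<open>V\<close>. Each element of \<open>B\<close> could then be corrected by
        a multiple of z' into the common intersection with \<open>V\<close>, making \<open>A\<close>
        and \<open>B\<close> equal.\<close>
      have "A \<subseteq> V"
      proof (rule ccontr)
        assume "\<not> A \<subseteq> V"
        then obtain z' where z': "z' \<in> A" "z' \<notin> V" by blast
        then obtain v' r' where z'_eq: "v' \<in> V" "r' \<in> carrier R" "z' = v' \<oplus> r' \<otimes> w"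
          using AB BW by (fastforce simp: set_add_iff cgenideal_def)
        have w: "w \<in> carrier R" by (rule step.hyps(2))
        have v'c: "v' \<in> carrier R" using z'_eq ideal_facts(1)[OF V] by auto
        have "r' \<notin> \<mm>" using z' z'_eq step.hyps(3) ideal_facts(3)[OF V] by blast
        then obtain y where y: "y \<in> carrier R" "y \<otimes> r' = \<one>" using inverse_ex z'_eq by blast
        have "B \<subseteq> A"
        proof
          fix z assume z: "z \<in> B"
          then obtain v r where z_eq: "v \<in> V" "r \<in> carrier R" "z = v \<oplus> r \<otimes> w"
            using BW by (fastforce simp: set_add_iff cgenideal_def)
          have vc: "v \<in> carrier R" using z_eq ideal_facts(1)[OF V] by auto
          have ry: "r \<otimes> y \<in> carrier R" using z_eq y by auto
          have "(r \<otimes> y) \<otimes> z' \<in> A" using ideal_facts(6)[OF A ry z'(1)] .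
          have "z \<ominus> (r \<otimes> y) \<otimes> z' = v \<ominus> (r \<otimes> y) \<otimes> v' \<oplus> (r \<otimes> w \<ominus> r \<otimes> (y \<otimes> r') \<otimes> w)"
            unfolding z_eq(3) z'_eq(3) using vc v'c w y(1) z_eq(2) z'_eq(2) by algebra
          also have "\<dots> = v \<ominus> (r \<otimes> y) \<otimes> v'" unfolding y(2) using vc v'c w y(1) z_eq(2) by algebra
          finally have "z \<ominus> (r \<otimes> y) \<otimes> z' \<in> V" using ideal_facts(4,6)[OF V] z_eq(1) z'_eq(1) ry by auto
          moreover have "z \<ominus> (r \<otimes> y) \<otimes> z' \<in> B"
            using ideal_facts(4)[OF B z] \<open>(r \<otimes> y) \<otimes> z' \<in> A\<close> AB by blast
          ultimately have "z \<ominus> (r \<otimes> y) \<otimes> z' \<in> A" using True by blast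
          hence "(z \<ominus> (r \<otimes> y) \<otimes> z') \<oplus> (r \<otimes> y) \<otimes> z' \<in> A"
            using ideal_facts(3)[OF A] \<open>(r \<otimes> y) \<otimes> z' \<in> A\<close> by blast
          moreover have "(z \<ominus> (r \<otimes> y) \<otimes> z') \<oplus> (r \<otimes> y) \<otimes> z' = z"
          proof -
            have "z \<in> carrier R" "(r \<otimes> y) \<otimes> z' \<in> carrier R"
              using z ideal_facts(1)[OF B] \<open>(r \<otimes> y) \<otimes> z' \<in> A\<close> ideal_facts(1)[OF A] by auto
            thus ?thesis by algebra
          qed
          ultimately show "z \<in> A" by simp
        qed
        thus False using AB by blast
      qed
      moreover have "\<not> B \<subseteq> V" using True AB by blast
      ultimately show ?thesis using True by (simp add: h'_def)
    qed
  qed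
qed

lemma simple_filtration_translate:
  assumes V: "ideal V R" and t: "t \<in> carrier R" and U: "ideal U R"
  shows "simple_filtration U W L \<Longrightarrow> simple_filtration (V <+> multiples t U) (V <+> multiples t W) L"
proof (induction rule: simple_filtration.induct)
  case base show ?case by (rule simple_filtration.base)
next
  case (step W n w)
  have W: "ideal W R" using simple_filtration_ideal[OF step.hyps(1) U] .
  have P: "ideal (PIdl w) R" using step by (intro cgenideal_ideal)
  have tw: "multiples t (PIdl w) = PIdl (t \<otimes> w)"
    using t step.hyps(2) by (auto simp: multiples_def cgenideal_def m_lcomm image_iff) (metis m_lcomm)
  have "simple_filtration (V <+> multiples t U) ((V <+> multiples t W) <+> PIdl (t \<otimes> w)) (Suc n)"
  proof (rule simple_filtration.step[OF step.IH])
    show "t \<otimes> w \<in> carrier R" using t step by simp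
    fix r assume r: "r \<in> \<mm>"
    hence rc: "r \<in> carrier R" using \<mm>_facts(1) by auto
    have "r \<otimes> (t \<otimes> w) = t \<otimes> (r \<otimes> w)" using rc t step.hyps(2) by (simp add: m_lcomm)
    hence "r \<otimes> (t \<otimes> w) \<in> multiples t W" using step.hyps(3)[OF r] multiplesI by simp
    thus "r \<otimes> (t \<otimes> w) \<in> V <+> multiples t W" using set_add_upper(2)[OF V multiples_ideal[OF t W]] by blast
  qed
  moreover have "(V <+> multiples t W) <+> PIdl (t \<otimes> w) = V <+> multiples t (W <+> PIdl w)"
    unfolding multiples_add[OF t W P] tw[symmetric]
    by (rule add_ideals_assoc) (use V W P t in auto)
  ultimately show ?case by simp
qed

text \<open>The step from V + (y^(n+1)) to V + (y^n) is the given filtration multiplied by y^n;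
  there are \<open>n\<close> such steps.\<close>

lemma simple_filtration_power:
  assumes V: "ideal V R" and y: "y \<in> carrier R"
    and L: "simple_filtration (V <+> multiples y (carrier R)) (carrier R) L"
  shows "simple_filtration (V <+> multiples (y [^] n) (carrier R)) (carrier R) (n * L)"
proof (induction n)
  case 0
  have "V <+> multiples \<one> (carrier R) = carrier R"
  proof -
    have "multiples \<one> (carrier R) = carrier R" by (auto simp: multiples_def image_iff)
    thus ?thesis using set_add_upper(2)[OF V oneideal] ideal_facts(1)[OF add_ideals[OF V oneideal]] by auto
  qed
  thus ?case by (simp add: simple_filtration.base)
next
  case (Suc n)
  let ?t = "y [^] n"
  have t: "?t \<in> carrier R" using y by simp
  have yI: "ideal (multiples y (carrier R)) R" "ideal (multiples ?t (carrier R)) R" using y t oneideal by auto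
  have "V <+> multiples ?t (V <+> multiples y (carrier R)) = (V <+> multiples ?t V) <+> multiples ?t (multiples y (carrier R))"
    unfolding multiples_add[OF t V yI(1)] using V yI t by (intro add_ideals_assoc[symmetric]) auto
  also have "V <+> multiples ?t V = V"
    using set_add_upper(1)[OF V multiples_ideal[OF t V]] set_add_least[OF V order_refl multiples_le[OF V t]] by blast
  also have "multiples ?t (multiples y (carrier R)) = multiples (y [^] Suc n) (carrier R)"
    using y by (auto simp: multiples_def image_image m_assoc)
  finally have "simple_filtration (V <+> multiples (y [^] Suc n) (carrier R)) (V <+> multiples ?t (carrier R)) L"
    using simple_filtration_translate[OF V t add_ideals[OF V yI(1)] L] by simp
  from simple_filtration_trans[OF Suc this] show ?case by simp
qed

text \<open>Replacing the parameters by their n-th powers one at a time multiplies the length by at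
  most \<open>n\<close> each. This is the source of the exponent d in the bound on
  generators.\<close>

lemma simple_filtration_powers:
  assumes "set ys \<subseteq> carrier R"
  shows "ideal V R \<Longrightarrow> simple_filtration (add_multiples (carrier R) V ys) (carrier R) L \<Longrightarrow>
    simple_filtration (add_multiples (carrier R) V (map (\<lambda>y. y [^] n) ys)) (carrier R) (n ^ length ys * L)"
  using assms
proof (induction ys arbitrary: V L)
  case (Cons y ys)
  let ?ys = "map (\<lambda>y. y [^] n) ys"
  have y: "y \<in> carrier R" and ys: "set ys \<subseteq> carrier R" "set ?ys \<subseteq> carrier R" using Cons.prems by auto
  have yI: "ideal (multiples y (carrier R)) R" "ideal (multiples (y [^] n) (carrier R)) R" using y oneideal by auto
  have "simple_filtration (add_multiples (carrier R) (V <+> multiples y (carrier R)) ?ys) (carrier R) (n ^ length ys * L)"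
    by (rule Cons.IH[OF add_ideals[OF Cons.prems(1) yI(1)] _ ys(1)]) (use Cons.prems(2) in simp)
  hence "simple_filtration (add_multiples (carrier R) V ?ys <+> multiples y (carrier R)) (carrier R) (n ^ length ys * L)"
    using add_multiples_add[OF oneideal Cons.prems(1) yI(1) ys(2)] by simp
  hence "simple_filtration (add_multiples (carrier R) V ?ys <+> multiples (y [^] n) (carrier R)) (carrier R) (n * (n ^ length ys * L))"
    by (rule simple_filtration_power[OF add_multiples_ideal[OF oneideal Cons.prems(1) ys(2)] y])
  thus ?case using add_multiples_add[OF oneideal Cons.prems(1) yI(2) ys(2)] by (simp add: mult.assoc)
qed simp

text \<open>For the least i with \<mm>^i inside \<open>U\<close>, an element of \<mm>^(i-1) outside
  \<open>U\<close> spans a simple quotient; Noetherian induction does the rest.\<close>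

lemma exists_simple_filtration:
  assumes "ideal U R" "ideal_power R \<mm> a \<subseteq> U"
  shows "\<exists>L. simple_filtration U (carrier R) L"
  using assms
proof (induction U rule: ideal_noetherian_induct)
  case (step U)
  show ?case
  proof (cases "U = carrier R")
    case True thus ?thesis using simple_filtration.base by auto
  next
    case False
    have "\<exists>i. ideal_power R \<mm> i \<subseteq> U" using step.prems by blast
    then obtain i where i: "ideal_power R \<mm> i \<subseteq> U" "\<And>j. j < i \<Longrightarrow> \<not> ideal_power R \<mm> j \<subseteq> U"
      using exists_least_iff[of "\<lambda>i. ideal_power R \<mm> i \<subseteq> U"] by blast
    have "i \<noteq> 0" using i(1) False ideal_facts(1)[OF step.hyps] by (metis ideal_power_0 subset_antisym)
    then obtain j where j: "i = Suc j" by (cases i) auto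
    then obtain w where w: "w \<in> ideal_power R \<mm> j" "w \<notin> U" using i(2)[of j] by blast
    have wc: "w \<in> carrier R" using w ideal_facts(1)[OF ideal_power_ideal[OF \<mm>_ideal]] by blast
    have mw: "r \<otimes> w \<in> U" if "r \<in> \<mm>" for r
    proof -
      have "w \<otimes> r \<in> ideal_power R \<mm> i" unfolding j using w that by (auto intro: ideal_prod.prod)
      thus ?thesis using i(1) m_comm[OF wc, of r] that \<mm>_facts(1) by auto
    qed
    have P: "ideal (PIdl w) R" "w \<in> PIdl w" using wc by (auto intro: cgenideal_ideal cgenideal_self)
    have big: "U \<subset> U <+> PIdl w" using set_add_upper[OF step.hyps P(1)] P(2) w(2) by blast
    then obtain L where "simple_filtration (U <+> PIdl w) (carrier R) L"
      using step.IH[OF add_ideals[OF step.hyps P(1)] big] step.prems by blast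
    moreover have "simple_filtration U (U <+> PIdl w) (Suc 0)"
      by (rule simple_filtration.step[OF simple_filtration.base wc mw])
    ultimately show ?thesis using simple_filtration_trans by blast
  qed
qed

end

context noetherian_local_ring
begin

subsection \<open>Independent elements in the powers of an ideal\<close>

text \<open>
  The ideals \<open>K n\<close> are the powers of \<open>J + \<mm>\<^sup>a\<close>, for \<open>a\<close> so large that minimal generators of
  \<open>J\<^sup>n\<close> stay independent in \<open>K n\<close>. This reduces counting generators to the \<open>\<mm>\<close>-primary case.
\<close>

lemma exists_primary_filtration:
  assumes J: "ideal J R" "J \<subseteq> \<mm>"
  shows "\<exists>K a. K 0 = carrier R \<and> (\<forall>n. ideal (K n) R \<and> K (Suc n) \<subseteq> \<mm> \<cdot> K n \<and>
    ideal_power R \<mm> (a * n) \<subseteq> K n \<and> ideal_power R J n \<subseteq> K n \<and>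
    ideal_power R J n \<inter> (\<mm> \<cdot> K n) \<subseteq> \<mm> \<cdot> ideal_power R J n)"
proof -
  let ?m = "ideal_power R \<mm>" and ?J = "ideal_power R J"
  obtain c where c: "\<And>s n. (?m (s + c) \<cdot> ?J n) \<inter> ?J (Suc n) \<subseteq> ?m s \<cdot> ?J (Suc n)"
    using artin_rees[OF \<mm>_ideal J(1)] by blast
  \<comment> \<open>One more than the Artin-Rees constant, so that \<mm>^a is contained in
    \<open>\<mm>\<close>.\<close>
  define a where "a = Suc c"
  have AR: "(?m (s + a) \<cdot> ?J n) \<inter> ?J (Suc n) \<subseteq> ?m s \<cdot> ?J (Suc n)" for s n
  proof -
    have "?m (s + a) \<cdot> ?J n \<subseteq> ?m (s + c) \<cdot> ?J n"
      by (intro ideal_prod_mono ideal_power_antimono) (auto simp: a_def J(1) simp del: ideal_power_Suc nat_pow_Suc)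
    thus ?thesis using c by blast
  qed
  \<comment> \<open>This recursion is the expansion of the powers of J + \<mm>^a that separates the
    term J^(n+1).\<close>
  define K where "K = rec_nat (carrier R) (\<lambda>n Kn. ?J (Suc n) <+> (?m a \<cdot> Kn))"
  have K0: "K 0 = carrier R" by (simp add: K_def)
  have KS: "K (Suc n) = ?J (Suc n) <+> (?m a \<cdot> K n)" for n by (simp add: K_def)
  have JI: "ideal (?J n) R" and mI: "ideal (?m n) R" for n using J(1) by auto
  have KI: "ideal (K n) R" for n
    by (induction n) (simp_all only: K0 KS oneideal add_ideals ideal_prod_is_ideal JI mI)
  have mKI: "ideal (?m s \<cdot> K n) R" and mJI: "ideal (?m s \<cdot> ?J n) R" for s n
    by (intro ideal_prod_is_ideal mI KI JI)+
  have JK: "?J n \<subseteq> K n" for n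
  proof (cases n)
    case (Suc m)
    show ?thesis unfolding Suc KS by (rule set_add_upper(1)[OF JI mKI])
  qed (simp add: K0)
  have ma: "?m a \<subseteq> \<mm>" using ideal_power_antimono[OF \<mm>_ideal, of 1 a] ideal_power_1[OF \<mm>_ideal]
    by (simp add: a_def del: ideal_power_Suc nat_pow_Suc)
  \<comment> \<open>Artin-Rees is transferred from J^n to \<open>K n\<close>. The statement must
    hold for all s, since the summand \<mm>^a K(n) raises the exponent by \<open>a\<close> before
    the induction hypothesis lowers it again.\<close>
  have E: "(?m (s + a) \<cdot> K n) \<inter> ?J (Suc n) \<subseteq> ?m s \<cdot> ?J (Suc n)" for s n
  proof (induction n arbitrary: s)
    case 0 show ?case using AR[of s 0] by (simp add: K0)
  next
    case (Suc n)
    show ?case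
    proof
      fix z assume z: "z \<in> (?m (s + a) \<cdot> K (Suc n)) \<inter> ?J (Suc (Suc n))"
      have "?m (s + a) \<cdot> K (Suc n) = (?m (s + a) \<cdot> ?J (Suc n)) <+> (?m (s + a) \<cdot> (?m a \<cdot> K n))"
        unfolding KS by (rule ideal_prod_distr(1)[OF mI JI mKI])
      also have "?m (s + a) \<cdot> (?m a \<cdot> K n) = ?m ((s + a) + a) \<cdot> K n"
        unfolding ideal_power_add[OF \<mm>_ideal, of "s + a" a] by (rule ideal_prod_assoc[symmetric, OF mI mI KI])
      finally obtain z1 z2 where z12: "z1 \<in> ?m (s + a) \<cdot> ?J (Suc n)" "z2 \<in> ?m ((s + a) + a) \<cdot> K n" "z = z1 \<oplus> z2"
        using z by (auto simp: set_add_iff)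
      have cc: "z1 \<in> carrier R" "z2 \<in> carrier R"
        using z12 ideal_facts(1)[OF mJI] ideal_facts(1)[OF mKI] by blast+
      have z1J: "z1 \<in> ?J (Suc n)" using z12(1) ideal_prod_absorb(1)[OF JI ideal_facts(1)[OF mI]] by blast
      have zJ: "z \<in> ?J (Suc n)" using z ideal_power_antimono[OF J(1), of "Suc n" "Suc (Suc n)"] by auto
      have "z2 = z \<ominus> z1" unfolding z12(3) using cc by algebra
      hence "z2 \<in> ?J (Suc n)" using ideal_facts(4)[OF JI zJ z1J] by simp
      hence "z2 \<in> ?m (s + a) \<cdot> ?J (Suc n)" using Suc[of "s + a"] z12(2) by blast
      hence "z \<in> ?m (s + a) \<cdot> ?J (Suc n)" using z12(1,3) ideal_facts(3)[OF mJI] by blast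
      thus "z \<in> ?m s \<cdot> ?J (Suc (Suc n))" using AR[of s "Suc n"] z by blast
    qed
  qed
  have le: "K (Suc n) \<subseteq> \<mm> \<cdot> K n" for n
  proof -
    have "?J (Suc n) = J \<cdot> ?J n" using J by (simp add: ideal_prod_commute)
    also have "\<dots> \<subseteq> \<mm> \<cdot> K n" by (intro ideal_prod_mono J JK)
    finally show ?thesis unfolding KS
      by (intro set_add_least ideal_prod_is_ideal \<mm>_ideal KI ideal_prod_mono ma order_refl)
  qed
  have mK: "?m (a * n) \<subseteq> K n" for n
  proof (induction n)
    case (Suc n)
    have "?m (a * Suc n) = ?m a \<cdot> ?m (a * n)" using ideal_power_add[OF \<mm>_ideal, of a "a * n"] by simp
    also have "\<dots> \<subseteq> ?m a \<cdot> K n" by (intro ideal_prod_mono Suc order_refl)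
    also have "\<dots> \<subseteq> K (Suc n)" unfolding KS by (rule set_add_upper(2)[OF JI mKI])
    finally show ?case .
  qed (simp add: K0)
  have int: "?J n \<inter> (\<mm> \<cdot> K n) \<subseteq> \<mm> \<cdot> ?J n" for n
  proof (cases n)
    case 0 thus ?thesis by (auto simp: K0)
  next
    case (Suc m)
    show ?thesis
    proof
      fix z assume z: "z \<in> ?J n \<inter> (\<mm> \<cdot> K n)"
      have "\<mm> \<cdot> K n = (\<mm> \<cdot> ?J (Suc m)) <+> (\<mm> \<cdot> (?m a \<cdot> K m))"
        unfolding Suc KS by (rule ideal_prod_distr(1)[OF \<mm>_ideal JI mKI])
      also have "\<mm> \<cdot> (?m a \<cdot> K m) = ?m (1 + a) \<cdot> K m"
        unfolding ideal_power_add[OF \<mm>_ideal, of 1 a] ideal_power_1[OF \<mm>_ideal]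
        by (rule ideal_prod_assoc[symmetric, OF \<mm>_ideal mI KI])
      finally obtain z1 z2 where z12: "z1 \<in> \<mm> \<cdot> ?J (Suc m)" "z2 \<in> ?m (1 + a) \<cdot> K m" "z = z1 \<oplus> z2"
        using z by (auto simp: set_add_iff)
      have I1: "ideal (\<mm> \<cdot> ?J (Suc m)) R" by (intro ideal_prod_is_ideal \<mm>_ideal JI)
      have cc: "z1 \<in> carrier R" "z2 \<in> carrier R"
        using z12 ideal_facts(1)[OF I1] ideal_facts(1)[OF mKI] by blast+
      have z1J: "z1 \<in> ?J (Suc m)" using z12(1) ideal_prod_absorb(1)[OF JI \<mm>_facts(1)] by blast
      have "z2 = z \<ominus> z1" unfolding z12(3) using cc by algebra
      hence "z2 \<in> ?J (Suc m)" using ideal_facts(4)[OF JI _ z1J] z Suc by simp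
      hence "z2 \<in> ?m 1 \<cdot> ?J (Suc m)" using E[of 1 m] z12(2) by blast
      hence "z2 \<in> \<mm> \<cdot> ?J (Suc m)" unfolding ideal_power_1[OF \<mm>_ideal] .
      thus "z \<in> \<mm> \<cdot> ?J n" unfolding Suc z12(3) using ideal_facts(3)[OF I1 z12(1)] by blast
    qed
  qed
  show ?thesis
    by (rule exI[of _ K], rule exI[of _ a]) (intro conjI allI K0 KI le mK JK int)
qed

text \<open>Each element of an independent list enlarges the ideal strictly, so it costs at least
  one unit of \<open>h\<close>.\<close>

lemma indep_chain_length:
  assumes h: "\<And>A B. ideal A R \<Longrightarrow> ideal B R \<Longrightarrow> U \<subseteq> A \<Longrightarrow> A \<subset> B \<Longrightarrow> h A < (h B :: nat)"
    and B: "ideal B R"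
  shows "ideal P R \<Longrightarrow> U \<subseteq> P \<Longrightarrow> P \<subseteq> B \<Longrightarrow> regular.indep P ws \<Longrightarrow> set ws \<subseteq> B \<Longrightarrow> h P + length ws \<le> h B"
proof (induction ws arbitrary: P)
  case Nil thus ?case using h[OF Nil(1) B] by (cases "P = B") (auto simp: order_le_less)
next
  case (Cons w ws)
  have w: "w \<in> carrier R" using Cons.prems ideal_facts(1)[OF B] by auto
  let ?P = "P <+> PIdl w"
  have PI: "ideal (PIdl w) R" "w \<in> PIdl w" using w by (auto intro: cgenideal_ideal cgenideal_self)
  have P': "ideal ?P R" by (rule add_ideals[OF Cons.prems(1) PI(1)])
  note up = set_add_upper[OF Cons.prems(1) PI(1)]
  have "?P \<subseteq> B" using Cons.prems by (intro set_add_least[OF B] cgenideal_minimal[OF B]) auto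
  hence "h ?P + length ws \<le> h B"
    using Cons.prems up by (intro Cons.IH[OF P']) (auto simp: regular_adjoin)
  moreover have "h P < h ?P"
    using Cons.prems up PI(2) by (intro h[OF Cons.prems(1) P']) auto
  ultimately show ?case by simp
qed

text \<open>The lists fit one above the other into the chain of the \<open>K n\<close>, hence all of
  them into the ring modulo \<open>K N\<close>. That quotient is controlled by powers of a system of
  parameters.\<close>

lemma sum_length_indep_le:
  assumes J: "ideal J R" "J \<subseteq> \<mm>" and dim: "\<And>P. \<not> prime_chain R (Suc d) P"
  shows "\<exists>C. \<forall>N ws. (\<forall>n<N. regular.indep (\<mm> \<cdot> ideal_power R J n) (ws n) \<and> set (ws n) \<subseteq> ideal_power R J n)
    \<longrightarrow> (\<Sum>n<N. length (ws n)) \<le> C * N ^ d"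
proof -
  let ?m = "ideal_power R \<mm>" and ?J = "ideal_power R J"
  obtain K a where K: "K 0 = carrier R" "\<And>n. ideal (K n) R" "\<And>n. K (Suc n) \<subseteq> \<mm> \<cdot> K n"
    "\<And>n. ?m (a * n) \<subseteq> K n" "\<And>n. ?J n \<subseteq> K n" "\<And>n. ?J n \<inter> (\<mm> \<cdot> K n) \<subseteq> \<mm> \<cdot> ?J n"
    using exists_primary_filtration[OF J] by blast
  obtain ys b where ys: "length ys = d" "set ys \<subseteq> \<mm>" "?m b \<subseteq> add_multiples (carrier R) {\<zero>} ys"
    using exists_parameters[OF zeroideal, of d] dim by blast
  have ysc: "set ys \<subseteq> carrier R" using ys \<mm>_facts(1) by auto
  obtain L where L: "simple_filtration (add_multiples (carrier R) {\<zero>} ys) (carrier R) L"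
    using exists_simple_filtration[OF add_multiples_ideal[OF oneideal zeroideal ysc] ys(3)] by blast
  show ?thesis
  proof (intro exI[of _ "a ^ d * L"] allI impI)
    fix N and ws :: "nat \<Rightarrow> 'a list"
    assume ws: "\<forall>n<N. regular.indep (\<mm> \<cdot> ?J n) (ws n) \<and> set (ws n) \<subseteq> ?J n"
    \<comment> \<open>With the exponent a N the powers of the parameters lie in \<mm>^(aN), which is
      contained in \<open>K N\<close>.\<close>
    let ?ys = "map (\<lambda>y. y [^] (a * N)) ys"
    define Q where "Q = add_multiples (carrier R) {\<zero>} ?ys"
    have ysc': "set ?ys \<subseteq> carrier R" using ysc by auto
    have Q: "ideal Q R" unfolding Q_def by (rule add_multiples_ideal[OF oneideal zeroideal ysc'])
    have QK: "Q \<subseteq> K N"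
    proof -
      have "set ?ys \<subseteq> ?m (a * N)" using mem_ideal_power ys(2) \<mm>_facts(1) by auto
      hence "Q \<subseteq> ?m (a * N)"
        unfolding Q_def gen_ideal_def[symmetric] by (intro gen_ideal_least ideal_power_ideal \<mm>_ideal)
      thus ?thesis using K(4) by blast
    qed
    have "simple_filtration Q (carrier R) ((a * N) ^ d * L)"
      unfolding Q_def using simple_filtration_powers[OF ysc zeroideal L] ys(1) by simp
    then obtain h :: "'a set \<Rightarrow> nat" where h: "\<And>A. h A \<le> (a * N) ^ d * L"
      "\<And>A B. ideal A R \<Longrightarrow> ideal B R \<Longrightarrow> Q \<subseteq> A \<Longrightarrow> A \<subset> B \<Longrightarrow> h A < h B"
      using simple_filtration_length[OF _ Q] ideal_facts(1) by metis
    have mK: "ideal (\<mm> \<cdot> K n) R" for n by (intro ideal_prod_is_ideal \<mm>_ideal K)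
    have mKK: "\<mm> \<cdot> K n \<subseteq> K n" for n by (rule ideal_prod_absorb(1)[OF K(2) \<mm>_facts(1)])
    have Kanti: "K N \<subseteq> K n" if "n \<le> N" for n
      using that by (induction rule: inc_induct) (use K(3) mKK in blast)+
    \<comment> \<open>The independent elements of degree n live between \<mm> K(n) and K(n), and
      K(n+1) is already below; these differences telescope.\<close>
    have step: "h (K (Suc n)) + length (ws n) \<le> h (K n)" if n: "n < N" for n
    proof -
      have QS: "Q \<subseteq> K (Suc n)" using QK Kanti[of "Suc n"] n by auto
      have "h (K (Suc n)) \<le> h (\<mm> \<cdot> K n)"
        using h(2)[OF K(2) mK QS] K(3)[of n] by (cases "K (Suc n) = \<mm> \<cdot> K n") (auto simp: order_le_less)
      moreover have "h (\<mm> \<cdot> K n) + length (ws n) \<le> h (K n)"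
      proof (rule indep_chain_length[OF h(2) K(2) mK _ mKK])
        show "Q \<subseteq> \<mm> \<cdot> K n" using QS K(3) by blast
        show "set (ws n) \<subseteq> K n" using ws n K(5) by blast
        show "regular.indep (\<mm> \<cdot> K n) (ws n)"
        proof (rule regular.indep_restrict[of "?J n" "\<mm> \<cdot> ?J n"])
          show "regular.indep (\<mm> \<cdot> ?J n) (ws n)" "set (ws n) \<subseteq> ?J n" using ws n by auto
          show "?J n \<inter> (\<mm> \<cdot> K n) \<subseteq> \<mm> \<cdot> ?J n" by (rule K(6))
        qed (use J mK in \<open>auto intro: ideal_prod_is_ideal\<close>)
      qed
      ultimately show ?thesis by simp
    qed
    have "h (K n) + (\<Sum>i<n. length (ws i)) \<le> h (K 0)" if "n \<le> N" for n
      using that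
    proof (induction n)
      case (Suc n)
      thus ?case using step[of n] by simp
    qed simp
    from this[of N] have "(\<Sum>n<N. length (ws n)) \<le> (a * N) ^ d * L" using h(1)[of "K 0"] by simp
    also have "\<dots> = a ^ d * L * N ^ d" by (simp add: power_mult_distrib)
    finally show "(\<Sum>n<N. length (ws n)) \<le> a ^ d * L * N ^ d" .
  qed
qed

text \<open>As J^j = X^j I^j, the count along a regular sequence is applied to the ideal I^j in
  degree j itself. Below the bound for regularity the empty list is used.\<close>

lemma sum_length_indep_regular_seq_le:
  assumes I: "ideal I R" and dim: "\<And>P. \<not> prime_chain R (Suc d) P"
    and xs: "set xs \<subseteq> \<mm>" "xs \<noteq> []" "\<And>j. j \<ge> j\<^sub>0 \<Longrightarrow> regular_seq_on (ideal_power R I j) {\<zero>} xs"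
    and vs: "\<And>j. regular.indep (\<mm> \<cdot> ideal_power R I j) (vs j)" "\<And>j. set (vs j) \<subseteq> ideal_power R I j"
  shows "\<exists>C. \<forall>N. (\<Sum>j=j\<^sub>0..<N. length (vs j) * ((j + length xs - 1) choose (length xs - 1))) \<le> C * N ^ d"
proof -
  let ?k = "length xs" and ?I = "ideal_power R I"
  have xsc: "set xs \<subseteq> carrier R" using xs(1) \<mm>_facts(1) by auto
  define X where "X = gen_ideal xs"
  have X: "ideal X R" unfolding X_def by (rule gen_ideal_ideal[OF xsc])
  define J where "J = X \<cdot> I"
  have J: "ideal J R" unfolding J_def by (rule ideal_prod_is_ideal[OF X I])
  have "X \<subseteq> \<mm>" unfolding X_def by (rule gen_ideal_least[OF \<mm>_ideal xs(1)])
  hence Jm: "J \<subseteq> \<mm>" unfolding J_def using ideal_prod_inter[OF X I] by blast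
  have Jpow: "ideal_power R J n = ideal_power R X n \<cdot> ?I n" for n
    unfolding J_def by (rule ideal_power_mult_distrib[OF X I])
  have "\<exists>w. regular.indep (\<mm> \<cdot> ideal_power R J j) w \<and> set w \<subseteq> ideal_power R J j \<and>
    length w = (if j < j\<^sub>0 then 0 else length (vs j) * ((j + ?k - 1) choose (?k - 1)))" for j
  proof (cases "j < j\<^sub>0")
    case True thus ?thesis by (intro exI[of _ "[]"]) auto
  next
    case False
    show ?thesis
      using indep_regular_seq[OF ideal_power_ideal[OF I] vs xs(1), of j j] xs(2,3) False
      unfolding Jpow X_def by auto
  qed
  then obtain w where w: "\<And>j. regular.indep (\<mm> \<cdot> ideal_power R J j) (w j)" "\<And>j. set (w j) \<subseteq> ideal_power R J j"
    "\<And>j. length (w j) = (if j < j\<^sub>0 then 0 else length (vs j) * ((j + ?k - 1) choose (?k - 1)))" by metis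
  obtain C where C: "\<And>N. (\<Sum>n<N. length (w n)) \<le> C * N ^ d"
    using sum_length_indep_le[OF J Jm dim] w(1,2) by metis
  have "(\<Sum>j=j\<^sub>0..<N. length (vs j) * ((j + ?k - 1) choose (?k - 1))) = (\<Sum>j=j\<^sub>0..<N. length (w j))" for N
    by (rule sum.cong) (auto simp: w(3))
  also have "\<dots> N \<le> (\<Sum>n<N. length (w n))" for N by (rule sum_mono2) auto
  finally show ?thesis using C order_trans by blast
qed

end

section \<open>The growth of the fiber cone\<close>

lemma (in abelian_monoid) finsum_mem:
  assumes "finite A" "H \<subseteq> carrier G" "\<zero> \<in> H" "\<And>x y. x \<in> H \<Longrightarrow> y \<in> H \<Longrightarrow> x \<oplus> y \<in> H"
    "\<And>a. a \<in> A \<Longrightarrow> f a \<in> H"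
  shows "finsum G f A \<in> H"
  using assms(1,5)
proof (induction A)
  case (insert a A)
  have "finsum G f (insert a A) = f a \<oplus> finsum G f A"
    using insert assms(2) by (intro finsum_insert) auto
  thus ?case using insert assms(4) by auto
qed (use assms(3) in simp)

lemma (in cring) primeideal_quotient_preimage:
  assumes E: "ideal E R" and P: "primeideal P (R Quot E)"
  shows "primeideal {r \<in> carrier R. E +> r \<in> P} R" "E \<subseteq> {r \<in> carrier R. E +> r \<in> P}"
proof -
  interpret E: ideal E R by fact
  have zero: "\<zero>\<^bsub>R Quot E\<^esub> = E" by (simp add: FactRing_def)
  have EQ: "E +> r = \<zero>\<^bsub>R Quot E\<^esub>" if "r \<in> E" for r
    unfolding zero by (rule a_rcos_zero[OF E that])
  interpret h: ring_hom_cring R "R Quot E" "(+>) E" by (rule E.rcos_ring_hom_cring[OF cring_axioms])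
  interpret P: primeideal P "R Quot E" by fact
  show "E \<subseteq> {r \<in> carrier R. E +> r \<in> P}"
    using E.a_subset EQ P.zero_closed by auto
  show "primeideal {r \<in> carrier R. E +> r \<in> P} R"
  proof (rule primeidealI)
    show "ideal {r \<in> carrier R. E +> r \<in> P} R" by (rule h.ring.ideal_vimage[OF P.is_ideal])
    show "cring R" by (rule cring_axioms)
    show "carrier R \<noteq> {r \<in> carrier R. E +> r \<in> P}"
    proof
      assume "carrier R = {r \<in> carrier R. E +> r \<in> P}"
      hence "E +> \<one> \<in> P" by blast
      hence "\<one>\<^bsub>R Quot E\<^esub> \<in> P" by simp
      thus False using P.one_imp_carrier P.I_notcarr by simp
    qed
    fix a b assume ab: "a \<in> carrier R" "b \<in> carrier R" "a \<otimes> b \<in> {r \<in> carrier R. E +> r \<in> P}"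
    hence "(E +> a) \<otimes>\<^bsub>R Quot E\<^esub> (E +> b) \<in> P" by simp
    thus "a \<in> {r \<in> carrier R. E +> r \<in> P} \<or> b \<in> {r \<in> carrier R. E +> r \<in> P}"
      using P.I_prime[of "E +> a" "E +> b"] ab by auto
  qed
qed

lemma (in cring) prime_chain_quotient_preimage:
  assumes E: "ideal E R" and P: "prime_chain (R Quot E) n P"
  shows "\<exists>Q. prime_chain R n Q \<and> E \<subseteq> Q 0"
proof (intro exI conjI)
  define Q where "Q i = {r \<in> carrier R. E +> r \<in> P i}" for i
  show "E \<subseteq> Q 0" using primeideal_quotient_preimage(2)[OF E] P by (auto simp: Q_def prime_chain_def)
  have "Q i \<subset> Q (Suc i)" if i: "i < n" for i
  proof -
    have lt: "P i \<subset> P (Suc i)" using P i by (auto simp: prime_chain_def)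
    then obtain x where x: "x \<in> P (Suc i)" "x \<notin> P i" by blast
    have "primeideal (P (Suc i)) (R Quot E)" using P i by (auto simp: prime_chain_def)
    hence "x \<in> carrier (R Quot E)" using x(1) ideal.Icarr primeideal.axioms(1) by metis
    then obtain r where "r \<in> carrier R" "x = E +> r" by (auto simp: FactRing_def A_RCOSETS_def')
    hence "r \<in> Q (Suc i)" "r \<notin> Q i" using x by (auto simp: Q_def)
    thus ?thesis using lt by (auto simp: Q_def)
  qed
  thus "prime_chain R n Q"
    using primeideal_quotient_preimage(1)[OF E] P by (auto simp: Q_def prime_chain_def)
qed

section \<open>Ideals of the Rees algebra and independence over the residue field\<close>

context noetherian_local_ring
begin

context
  fixes I assumes I: "ideal I R"
begin

interpretation UP: UP_cring R "UP R"
  by unfold_locales simp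

abbreviation (input) "Rees \<equiv> rees_algebra R I"

lemma carrier_rees: "carrier Rees = {p \<in> carrier (UP R). \<forall>j. coeff (UP R) p j \<in> ideal_power R I j}"
  by (simp add: rees_algebra_def)

lemma rees_simps [simp]:
  "x \<oplus>\<^bsub>Rees\<^esub> y = x \<oplus>\<^bsub>UP R\<^esub> y" "x \<otimes>\<^bsub>Rees\<^esub> y = x \<otimes>\<^bsub>UP R\<^esub> y"
  "\<zero>\<^bsub>Rees\<^esub> = \<zero>\<^bsub>UP R\<^esub>" "\<one>\<^bsub>Rees\<^esub> = \<one>\<^bsub>UP R\<^esub>"
  by (simp_all add: rees_algebra_def)

lemma ideal_power_mult_mem:
  assumes "a \<in> ideal_power R I i" "b \<in> ideal_power R I j"
  shows "a \<otimes> b \<in> ideal_power R I (i + j)"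
  unfolding ideal_power_add[OF I] using assms by (rule ideal_prod.prod)

lemma subring_rees: "subring (carrier Rees) (UP R)"
proof (rule UP.P.subringI)
  note IP = ideal_facts[OF ideal_power_ideal[OF I]]
  show "carrier Rees \<subseteq> carrier (UP R)" by (auto simp: carrier_rees)
  show "\<one>\<^bsub>UP R\<^esub> \<in> carrier Rees"
    using IP(2) by (auto simp: carrier_rees simp del: nat_pow_Suc)
  show "\<ominus>\<^bsub>UP R\<^esub> p \<in> carrier Rees" if "p \<in> carrier Rees" for p
    using that IP(5) by (auto simp: carrier_rees)
  show "p \<oplus>\<^bsub>UP R\<^esub> q \<in> carrier Rees" if "p \<in> carrier Rees" "q \<in> carrier Rees" for p q
    using that IP(3) by (auto simp: carrier_rees)
  show "p \<otimes>\<^bsub>UP R\<^esub> q \<in> carrier Rees" if pq: "p \<in> carrier Rees" "q \<in> carrier Rees" for p q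
  proof -
    have "coeff (UP R) (p \<otimes>\<^bsub>UP R\<^esub> q) n \<in> ideal_power R I n" for n
    proof -
      have "(\<Oplus>i\<in>{..n}. coeff (UP R) p i \<otimes> coeff (UP R) q (n - i)) \<in> ideal_power R I n"
      proof (rule finsum_mem)
        fix i assume "i \<in> {..n}"
        hence "i + (n - i) = n" by simp
        thus "coeff (UP R) p i \<otimes> coeff (UP R) q (n - i) \<in> ideal_power R I n"
          using ideal_power_mult_mem[of "coeff (UP R) p i" i "coeff (UP R) q (n - i)" "n - i"] pq
          by (simp add: carrier_rees)
      qed (use ideal_facts[OF ideal_power_ideal[OF I, of n]] in auto)
      thus ?thesis using pq by (simp add: carrier_rees)
    qed
    thus ?thesis using pq by (auto simp: carrier_rees)
  qed
qed

lemma cring_rees: "cring Rees"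
proof -
  have "cring (UP R \<lparr>carrier := carrier Rees\<rparr>)"
    using UP.P.subcring_iff[OF subringE(1)[OF subring_rees]] UP.P.subcringI'[OF subring_rees] by blast
  thus ?thesis by (simp add: rees_algebra_def)
qed

interpretation Rees: cring Rees by (rule cring_rees)

lemma rees_carrier_UP: "carrier Rees \<subseteq> carrier (UP R)"
  by (auto simp: carrier_rees)

lemma monom_mem_rees: "v \<in> ideal_power R I j \<Longrightarrow> monom (UP R) v j \<in> carrier Rees"
  using ideal_facts(1)[OF ideal_power_ideal[OF I, of j]] ideal_facts(2)[OF ideal_power_ideal[OF I]]
  by (simp add: carrier_rees subset_iff)

lemma rees_ideal_smult:
  assumes "ideal Q Rees" "r \<in> carrier R" "p \<in> Q"
  shows "r \<odot>\<^bsub>UP R\<^esub> p \<in> Q"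
proof -
  have "p \<in> carrier (UP R)" using assms Rees.ideal_facts(1)[OF assms(1)] rees_carrier_UP by blast
  hence "r \<odot>\<^bsub>UP R\<^esub> p = monom (UP R) r 0 \<otimes>\<^bsub>Rees\<^esub> p"
    using assms(2) by (simp add: UP.monom_mult_is_smult)
  moreover have "monom (UP R) r 0 \<in> carrier Rees" using monom_mem_rees[of r 0] assms(2) by simp
  ultimately show ?thesis using Rees.ideal_facts(6)[OF assms(1)] assms(3) by simp
qed

text \<open>The degree zero part of the Rees algebra is the ring, so its ideals are submodules of
  the polynomial module; this gives access to independence modulo a prime of the Rees
  algebra.\<close>

lemma rees_ideal_submodule:
  assumes Q: "ideal Q Rees"
  shows "submodule Q R (UP R)"
proof (rule UP.submoduleI)
  note QI = Rees.ideal_facts[OF Q]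
  show "Q \<subseteq> carrier (UP R)" using QI(1) rees_carrier_UP by blast
  show "\<zero>\<^bsub>UP R\<^esub> \<in> Q" using QI(2) by simp
  show "a \<oplus>\<^bsub>UP R\<^esub> b \<in> Q" if "a \<in> Q" "b \<in> Q" for a b using QI(3)[OF that] by simp
  show "r \<odot>\<^bsub>UP R\<^esub> a \<in> Q" if "r \<in> carrier R" "a \<in> Q" for r a using rees_ideal_smult[OF Q that] .
  show "\<ominus>\<^bsub>UP R\<^esub> a \<in> Q" if "a \<in> Q" for a
  proof -
    have "a \<in> carrier (UP R)" using that QI(1) rees_carrier_UP by blast
    hence "\<ominus>\<^bsub>UP R\<^esub> a = (\<ominus> \<one>) \<odot>\<^bsub>UP R\<^esub> a" by (simp add: UP.smult_l_minus)
    thus ?thesis using rees_ideal_smult[OF Q _ that, of "\<ominus> \<one>"] by simp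
  qed
qed

text \<open>
  Modulo \<open>Q\<close> the multiples of \<open>a\<close> drop out of a linear relation; the rest can be divided by \<open>a\<close>
  modulo \<open>P\<close>.
\<close>

lemma indep_append_prime:
  assumes P: "primeideal P Rees" and Q: "ideal Q Rees" and PQ: "P \<subseteq> Q"
    and m: "\<And>r f. r \<in> \<mm> \<Longrightarrow> f \<in> carrier Rees \<Longrightarrow> r \<odot>\<^bsub>UP R\<^esub> f \<in> P"
    and a: "a \<in> Q" "a \<notin> P"
    and fs: "UP.indep Q fs" "set fs \<subseteq> carrier Rees" and gs: "UP.indep P gs" "set gs \<subseteq> carrier Rees"
  shows "UP.indep P (fs @ map (\<lambda>v. a \<otimes>\<^bsub>UP R\<^esub> v) gs)"
proof -
  have PI: "ideal P Rees" using Rees.primeideal_facts(1)[OF P] .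
  note QF = Rees.ideal_facts[OF Q]
  have ac: "a \<in> carrier Rees" "a \<in> carrier (UP R)" using a QF(1) rees_carrier_UP by auto
  have fsc: "set fs \<subseteq> carrier (UP R)" using fs rees_carrier_UP by blast
  have "UP.indep (UP.span P fs) (map (\<lambda>v. a \<otimes>\<^bsub>UP R\<^esub> v) gs)"
  proof (rule UP.indep_map[where N="carrier Rees" and P=P])
    show "submodule (carrier Rees) R (UP R)" by (rule rees_ideal_submodule[OF Rees.oneideal])
    show "submodule P R (UP R)" by (rule rees_ideal_submodule[OF PI])
    thus "submodule (UP.span P fs) R (UP R)" by (rule UP.span_submodule[OF _ fsc])
    show "UP.indep P gs" "set gs \<subseteq> carrier Rees" by (fact gs)+
    show "a \<otimes>\<^bsub>UP R\<^esub> v \<in> carrier (UP R)" if "v \<in> carrier (UP R)" for v using that ac by simp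
    show "a \<otimes>\<^bsub>UP R\<^esub> (v \<oplus>\<^bsub>UP R\<^esub> r \<odot>\<^bsub>UP R\<^esub> w) = a \<otimes>\<^bsub>UP R\<^esub> v \<oplus>\<^bsub>UP R\<^esub> r \<odot>\<^bsub>UP R\<^esub> (a \<otimes>\<^bsub>UP R\<^esub> w)"
      if c: "v \<in> carrier (UP R)" "w \<in> carrier (UP R)" "r \<in> carrier R" for v w r
    proof -
      have "a \<otimes>\<^bsub>UP R\<^esub> (r \<odot>\<^bsub>UP R\<^esub> w) = (r \<odot>\<^bsub>UP R\<^esub> w) \<otimes>\<^bsub>UP R\<^esub> a"
        by (rule UP.P.m_comm) (use ac c in auto)
      also have "\<dots> = r \<odot>\<^bsub>UP R\<^esub> (w \<otimes>\<^bsub>UP R\<^esub> a)" by (rule UP.smult_assoc2) (use ac c in auto)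
      also have "w \<otimes>\<^bsub>UP R\<^esub> a = a \<otimes>\<^bsub>UP R\<^esub> w" by (rule UP.P.m_comm) (use ac c in auto)
      finally show ?thesis using ac c by (simp add: UP.P.r_distr)
    qed
    fix v assume v: "v \<in> carrier Rees" "a \<otimes>\<^bsub>UP R\<^esub> v \<in> UP.span P fs"
    have "a \<otimes>\<^bsub>UP R\<^esub> v \<in> Q" using QF(7)[OF v(1) a(1)] by simp
    moreover have "UP.span P fs \<inter> Q \<subseteq> P"
      by (rule UP.span_Int[where \<mm>=\<mm>])
        (use inverse_ex rees_ideal_submodule[OF PI] rees_ideal_submodule[OF Q] fs fsc PQ m in auto)
    ultimately have "a \<otimes>\<^bsub>Rees\<^esub> v \<in> P" using v(2) by auto
    thus "v \<in> P" using Rees.primeideal_facts(4)[OF P ac(1) v(1)] a(2) by blast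
  qed
  thus ?thesis using UP.indep_antimono[OF fs(1) PQ] by (simp add: UP.indep_append)
qed

text \<open>An element from each gap of the chain is chosen, and the list consists of the monomials
  in these n elements with all exponents below N. The induction descends from the top prime, where 1
  is independent, and each gap multiplies the number by N.\<close>

lemma exists_indep_of_prime_chain:
  assumes P: "prime_chain Rees n P"
    and m: "\<And>r f. r \<in> \<mm> \<Longrightarrow> f \<in> carrier Rees \<Longrightarrow> r \<odot>\<^bsub>UP R\<^esub> f \<in> P 0"
  shows "\<exists>D. \<forall>N. \<exists>fs. length fs = N ^ n \<and> UP.indep (P 0) fs \<and> set fs \<subseteq> carrier Rees \<and>
    (\<forall>f\<in>set fs. deg R f \<le> D * N)"
proof -
  have prime: "primeideal (P i) Rees" if "i \<le> n" for i using P that by (auto simp: prime_chain_def)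
  have lt: "P i \<subset> P (Suc i)" if "i < n" for i using P that by (auto simp: prime_chain_def)
  have P0: "P 0 \<subseteq> P i" if "i \<le> n" for i using that
    by (induction i) (use lt in \<open>auto, meson Suc_le_lessD in_mono less_imp_le_nat psubset_imp_subset\<close>)
  have "\<exists>D. \<forall>N. \<exists>fs. length fs = N ^ k \<and> UP.indep (P (n - k)) fs \<and> set fs \<subseteq> carrier Rees \<and>
    (\<forall>f\<in>set fs. deg R f \<le> D * N)" if "k \<le> n" for k
    using that
  proof (induction k)
    case 0
    have "\<one>\<^bsub>UP R\<^esub> \<notin> P n" using Rees.primeideal_facts(3)[OF prime[of n]] by simp
    moreover have "\<one>\<^bsub>UP R\<^esub> \<in> carrier Rees" using Rees.one_closed by simp
    ultimately show ?case
      by (intro exI[of _ 0] allI exI[of _ "[\<one>\<^bsub>UP R\<^esub>]"]) auto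
  next
    case (Suc k)
    then obtain D where D: "\<And>N. \<exists>fs. length fs = N ^ k \<and> UP.indep (P (n - k)) fs \<and> set fs \<subseteq> carrier Rees \<and>
      (\<forall>f\<in>set fs. deg R f \<le> D * N)" by auto
    define i where "i = n - Suc k"
    have i: "n - k = Suc i" "i < n" using Suc.prems by (auto simp: i_def)
    obtain a where a: "a \<in> P (Suc i)" "a \<notin> P i" using lt[OF i(2)] by blast
    have PI: "primeideal (P i) Rees" and QI: "ideal (P (Suc i)) Rees"
      using prime[of i] prime[of "Suc i"] i Rees.primeideal_facts(1) by auto
    have ac: "a \<in> carrier Rees" "a \<in> carrier (UP R)"
      using a Rees.ideal_facts(1)[OF QI] rees_carrier_UP by auto
    show ?case
    proof (intro exI[of _ "D + deg R a"] allI)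
      fix N
      obtain fs where fs: "length fs = N ^ k" "UP.indep (P (Suc i)) fs" "set fs \<subseteq> carrier Rees"
        "\<And>f. f \<in> set fs \<Longrightarrow> deg R f \<le> D * N" using D[of N] unfolding i(1) by blast
      \<comment> \<open>After t rounds the list is fs, a fs, ..., a^(t-1) fs.\<close>
      have "\<exists>gs. length gs = t * N ^ k \<and> UP.indep (P i) gs \<and> set gs \<subseteq> carrier Rees \<and>
        (\<forall>g\<in>set gs. deg R g \<le> D * N + t * deg R a)" for t
      proof (induction t)
        case 0 show ?case by (intro exI[of _ "[]"]) auto
      next
        case (Suc t)
        then obtain gs where gs: "length gs = t * N ^ k" "UP.indep (P i) gs" "set gs \<subseteq> carrier Rees"
          "\<And>g. g \<in> set gs \<Longrightarrow> deg R g \<le> D * N + t * deg R a" by blast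
        let ?hs = "fs @ map (\<lambda>v. a \<otimes>\<^bsub>UP R\<^esub> v) gs"
        have "length ?hs = Suc t * N ^ k" using fs gs by simp
        moreover have "UP.indep (P i) ?hs"
        proof (rule indep_append_prime[OF PI QI _ _ a fs(2,3) gs(2,3)])
          show "P i \<subseteq> P (Suc i)" using lt[OF i(2)] by blast
          show "r \<odot>\<^bsub>UP R\<^esub> f \<in> P i" if "r \<in> \<mm>" "f \<in> carrier Rees" for r f
            using m[OF that] P0[of i] i by auto
        qed
        moreover have "set ?hs \<subseteq> carrier Rees"
          using fs(3) gs(3) Rees.m_closed[OF ac(1)] by auto
        moreover have "deg R h \<le> D * N + Suc t * deg R a" if "h \<in> set ?hs" for h
        proof (cases "h \<in> set fs")
          case True thus ?thesis using fs(4) by (simp add: trans_le_add1)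
        next
          case False
          then obtain g where g: "g \<in> set gs" "h = a \<otimes>\<^bsub>UP R\<^esub> g" using \<open>h \<in> set ?hs\<close> by auto
          have "deg R h \<le> deg R a + deg R g"
            unfolding g(2) using UP.deg_mult_ring[of a g] ac g gs(3) rees_carrier_UP by blast
          thus ?thesis using gs(4)[OF g(1)] by simp
        qed
        ultimately show ?case by blast
      qed
      from this[of N] show "\<exists>gs. length gs = N ^ Suc k \<and> UP.indep (P (n - Suc k)) gs \<and> set gs \<subseteq> carrier Rees \<and>
        (\<forall>g\<in>set gs. deg R g \<le> (D + deg R a) * N)"
        by (simp add: i_def algebra_simps)
    qed
  qed
  from this[of n] show ?thesis by simp
qed

lemma rees_extension_ideal: "ideal (rees_extension R I \<mm>) Rees"
proof -
  have "(\<lambda>a. monom (UP R) a 0) ` \<mm> \<subseteq> carrier Rees"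
    using monom_mem_rees[of _ 0] \<mm>_facts(1) by auto
  thus ?thesis unfolding rees_extension_def by (rule Rees.genideal_ideal)
qed

lemma rees_extension_smult:
  assumes "r \<in> \<mm>" "f \<in> carrier Rees"
  shows "r \<odot>\<^bsub>UP R\<^esub> f \<in> rees_extension R I \<mm>"
proof -
  have sub: "(\<lambda>a. monom (UP R) a 0) ` \<mm> \<subseteq> carrier Rees"
    using monom_mem_rees[of _ 0] \<mm>_facts(1) by auto
  have "monom (UP R) r 0 \<in> rees_extension R I \<mm>"
    using Rees.genideal_self[OF sub] assms(1) unfolding rees_extension_def by blast
  hence "monom (UP R) r 0 \<otimes>\<^bsub>Rees\<^esub> f \<in> rees_extension R I \<mm>"
    using Rees.ideal_facts(7)[OF rees_extension_ideal] assms(2) by blast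
  thus ?thesis using UP.monom_mult_is_smult[of r f] assms \<mm>_facts(1) rees_carrier_UP by auto
qed

text \<open>The N^n independent elements have degree at most D N, so they lie in the span of the
  generators of I^j placed in degree j for j up to D N. Steinitz exchange compares the two
  numbers.\<close>

lemma prime_chain_fiber_growth:
  assumes P: "prime_chain (Rees Quot rees_extension R I \<mm>) n P"
    and vs: "\<And>j. set (vs j) \<subseteq> ideal_power R I j"
      "\<And>j. ideal_power R I j \<subseteq> regular.span (\<mm> \<cdot> ideal_power R I j) (vs j)"
  shows "\<exists>D. \<forall>N. N ^ n \<le> (\<Sum>j\<le>D * N. length (vs j))"
proof -
  obtain Q where Q: "prime_chain Rees n Q" "rees_extension R I \<mm> \<subseteq> Q 0"
    using Rees.prime_chain_quotient_preimage[OF rees_extension_ideal P] by blast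
  have QI: "ideal (Q 0) Rees" using Q(1) Rees.primeideal_facts(1) by (auto simp: prime_chain_def)
  have mQ: "r \<odot>\<^bsub>UP R\<^esub> f \<in> Q 0" if "r \<in> \<mm>" "f \<in> carrier Rees" for r f
    using rees_extension_smult[OF that] Q(2) by blast
  obtain D where D: "\<And>N. \<exists>fs. length fs = N ^ n \<and> UP.indep (Q 0) fs \<and> set fs \<subseteq> carrier Rees \<and>
    (\<forall>f\<in>set fs. deg R f \<le> D * N)"
    using exists_indep_of_prime_chain[OF Q(1) mQ] by blast
  show ?thesis
  proof (intro exI[of _ D] allI)
    fix N
    obtain fs where fs: "length fs = N ^ n" "UP.indep (Q 0) fs" "set fs \<subseteq> carrier Rees"
      "\<And>f. f \<in> set fs \<Longrightarrow> deg R f \<le> D * N" using D by blast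
    define ws where "ws = concat (map (\<lambda>j. map (\<lambda>v. monom (UP R) v j) (vs j)) [0..<Suc (D * N)])"
    have ws: "set ws \<subseteq> carrier Rees"
      unfolding ws_def using monom_mem_rees vs(1) by fastforce
    hence wsc: "set ws \<subseteq> carrier (UP R)" using rees_carrier_UP by blast
    have Qs: "submodule (Q 0) R (UP R)" by (rule rees_ideal_submodule[OF QI])
    let ?K = "UP.span (Q 0) ws"
    have Ks: "submodule ?K R (UP R)" by (rule UP.span_submodule[OF Qs wsc])
    note KF = UP.submodule_facts[OF Ks] and up = UP.span_upper[OF Qs wsc]
    have mono: "monom (UP R) v j \<in> ?K" if j: "j \<le> D * N" and v: "v \<in> ideal_power R I j" for v j
    proof -
      let ?I = "ideal_power R I j"
      note IF = ideal_facts[OF ideal_power_ideal[OF I, of j]]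
      \<comment> \<open>The coefficients whose monomial lies in the span form an ideal; it contains
        \<mm> I^j because of \<open>Q 0\<close> and the generators by construction.\<close>
      have TI: "ideal {v \<in> ?I. monom (UP R) v j \<in> ?K} R"
      proof (rule ideal_intro)
        show "{v \<in> ?I. monom (UP R) v j \<in> ?K} \<subseteq> carrier R" using IF(1) by blast
        show "\<zero> \<in> {v \<in> ?I. monom (UP R) v j \<in> ?K}" using IF(2) KF(2) by simp
        fix x y assume xy: "x \<in> {v \<in> ?I. monom (UP R) v j \<in> ?K}" "y \<in> {v \<in> ?I. monom (UP R) v j \<in> ?K}"
        hence "monom (UP R) (x \<oplus> y) j = monom (UP R) x j \<oplus>\<^bsub>UP R\<^esub> monom (UP R) y j"
          using IF(1) by (intro UP.monom_add) auto
        thus "x \<oplus> y \<in> {v \<in> ?I. monom (UP R) v j \<in> ?K}" using xy IF(3) KF(3) by simp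
      next
        fix r x assume rx: "r \<in> carrier R" "x \<in> {v \<in> ?I. monom (UP R) v j \<in> ?K}"
        hence "monom (UP R) (r \<otimes> x) j = r \<odot>\<^bsub>UP R\<^esub> monom (UP R) x j"
          using IF(1) by (intro UP.monom_mult_smult) auto
        thus "r \<otimes> x \<in> {v \<in> ?I. monom (UP R) v j \<in> ?K}" using rx IF(6) KF(4) by simp
      qed
      have "\<mm> \<cdot> ?I \<subseteq> {v \<in> ?I. monom (UP R) v j \<in> ?K}"
      proof (rule ideal_prod_least[OF TI])
        fix r w assume rw: "r \<in> \<mm>" "w \<in> ?I"
        have c: "r \<in> carrier R" "w \<in> carrier R" using rw IF(1) \<mm>_facts(1) by auto
        have "monom (UP R) (r \<otimes> w) j \<in> Q 0"
          using mQ[OF rw(1) monom_mem_rees[OF rw(2)]] UP.monom_mult_smult[OF c] by simp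
        thus "r \<otimes> w \<in> {v \<in> ?I. monom (UP R) v j \<in> ?K}" using IF(6) c rw up by blast
      qed
      moreover have "set (vs j) \<subseteq> {v \<in> ?I. monom (UP R) v j \<in> ?K}"
      proof
        fix v assume v: "v \<in> set (vs j)"
        hence "monom (UP R) v j \<in> set ws" unfolding ws_def using j by (auto simp del: upt_Suc intro!: bexI[of _ j])
        thus "v \<in> {v \<in> ?I. monom (UP R) v j \<in> ?K}" using up vs(1) v by blast
      qed
      ultimately have "regular.span (\<mm> \<cdot> ?I) (vs j) \<subseteq> {v \<in> ?I. monom (UP R) v j \<in> ?K}"
        using TI by (intro regular.span_least) auto
      thus ?thesis using vs(2) v by blast
    qed
    have "set fs \<subseteq> ?K"
    proof
      fix f assume f: "f \<in> set fs"
      have fc: "f \<in> carrier Rees" "f \<in> carrier (UP R)" using f fs(3) rees_carrier_UP by auto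
      have "(\<Oplus>\<^bsub>UP R\<^esub> i\<in>{..D * N}. monom (UP R) (coeff (UP R) f i) i) \<in> ?K"
      proof (rule UP.P.finsum_mem)
        show "monom (UP R) (coeff (UP R) f i) i \<in> ?K" if "i \<in> {..D * N}" for i
          using mono[of i] that fc(1) by (simp add: carrier_rees)
      qed (use KF in auto)
      thus "f \<in> ?K" using UP.up_repr_le[OF fs(4)[OF f] fc(2)] by simp
    qed
    hence "length fs \<le> length ws"
      using inverse_ex mQ ws
      by (intro UP.steinitz[where \<mm>=\<mm>, OF _ Qs fs(2) wsc]) auto
    also have "length ws = (\<Sum>j\<le>D * N. length (vs j))"
      by (simp add: ws_def length_concat comp_def interv_sum_list_conv_sum_set_nat atLeast0LessThan lessThan_Suc_atMost del: upt_Suc)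
    finally show "N ^ n \<le> (\<Sum>j\<le>D * N. length (vs j))" using fs(1) by simp
  qed
qed

end

end

section \<open>Comparison of growth rates\<close>

lemma power_le_binomial: "j ^ m \<le> m ^ m * ((j + m) choose m)"
proof (cases "m = 0")
  case False
  have "(real (j + m) / real m) ^ m \<le> real ((j + m) choose m)"
    by (rule binomial_ge_n_over_k_pow_k) simp
  hence "real (j + m) ^ m \<le> real m ^ m * real ((j + m) choose m)"
    using False by (simp add: power_divide divide_le_eq mult.commute)
  moreover have "real j ^ m \<le> real (j + m) ^ m" by (intro power_mono) auto
  ultimately have "real (j ^ m) \<le> real (m ^ m * ((j + m) choose m))" by simp
  thus ?thesis by (simp only: of_nat_le_iff)
qed simp

lemma exists_exp_gt_linear: "\<exists>s. (P :: nat) + Q * s < 2 ^ s"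
proof -
  \<comment> \<open>The choice gives u^2 = 2 Q u + (P + 1) u, which exceeds P + 2 Q u; the exponent
    is then 2 u.\<close>
  define u where "u = P + 2 * Q + 1"
  have "P + Q * (2 * u) < u * u" unfolding u_def by (simp add: algebra_simps)
  also have "u * u \<le> 2 ^ u * 2 ^ u" by (rule mult_le_mono) (rule less_imp_le[OF less_exp])+
  also have "\<dots> = 2 ^ (2 * u)" by (simp add: mult_2 power_add)
  finally show ?thesis by blast
qed

text \<open>No monotonicity of \<open>\<mu>\<close> is available, so the sums are cut into dyadic
  blocks. For j between 2^i and 2^(i+1) the binomial is at least (2^i)^m / m^m, so the block sum of
  \<open>\<mu>\<close> is at most a constant times 2^(i(d-m)). If d < n + m, summing the blocks
  stays below the required growth 2^(in).\<close>

lemma growth_comparison: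
  fixes \<mu> :: "nat \<Rightarrow> nat"
  assumes "n \<ge> 1" and lower: "\<And>N. N ^ n \<le> (\<Sum>j\<le>D * N. \<mu> j)"
    and upper: "\<And>N. (\<Sum>j=j\<^sub>0..<N. \<mu> j * ((j + m) choose m)) \<le> C * N ^ d"
  shows "n + m \<le> d"
proof (rule ccontr)
  assume "\<not> n + m \<le> d"
  hence dm: "d \<le> (n - 1) + m" using assms(1) by simp
  define S where "S i = (\<Sum>j<2 ^ i. \<mu> j)" for i :: nat
  \<comment> \<open>m^m comes from the bound on the binomial, 2^d from the upper end 2^(i+1) of the
    block.\<close>
  define C' where "C' = m ^ m * C * 2 ^ d"
  obtain i0 where i0: "j\<^sub>0 < 2 ^ i0" using less_exp by blast
  have step: "S (Suc i) \<le> S i + C' * 2 ^ (i * (n - 1))" if i: "i \<ge> i0" for i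
  proof -
    define T where "T = (\<Sum>j=2 ^ i..<2 ^ Suc i. \<mu> j)"
    have j0: "j\<^sub>0 \<le> 2 ^ i" using less_le_trans[OF i0 power_increasing[OF i, of "2::nat"]] by simp
    have "S (Suc i) = S i + T"
      unfolding S_def T_def lessThan_atLeast0 by (rule sum.atLeastLessThan_concat[symmetric]) simp_all
    moreover have "T \<le> C' * 2 ^ (i * (n - 1))"
    proof -
      have "T * (2 ^ i) ^ m = (\<Sum>j=2 ^ i..<2 ^ Suc i. \<mu> j * (2 ^ i) ^ m)" by (simp add: T_def sum_distrib_right)
      also have "\<dots> \<le> (\<Sum>j=2 ^ i..<2 ^ Suc i. m ^ m * (\<mu> j * ((j + m) choose m)))"
      proof (rule sum_mono)
        fix j assume "j \<in> {2 ^ i..<2 ^ Suc i :: nat}"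
        hence "(2 ^ i) ^ m \<le> j ^ m" by (intro power_mono) auto
        hence "(2 ^ i) ^ m \<le> m ^ m * ((j + m) choose m)" using power_le_binomial order_trans by blast
        hence "\<mu> j * (2 ^ i) ^ m \<le> \<mu> j * (m ^ m * ((j + m) choose m))" by (rule mult_le_mono2)
        thus "\<mu> j * (2 ^ i) ^ m \<le> m ^ m * (\<mu> j * ((j + m) choose m))" by (simp add: mult_ac)
      qed
      also have "\<dots> = m ^ m * (\<Sum>j=2 ^ i..<2 ^ Suc i. \<mu> j * ((j + m) choose m))"
        by (simp only: sum_distrib_left)
      also have "\<dots> \<le> m ^ m * (\<Sum>j=j\<^sub>0..<2 ^ Suc i. \<mu> j * ((j + m) choose m))"
        using j0 by (intro mult_le_mono2 sum_mono2) auto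
      also have "\<dots> \<le> m ^ m * (C * (2 ^ Suc i) ^ d)" by (intro mult_le_mono2 upper)
      also have "\<dots> = C' * 2 ^ (i * d)"
        by (simp add: C'_def power_mult[symmetric] power_mult_distrib mult_ac)
      also have "\<dots> \<le> C' * 2 ^ (i * ((n - 1) + m))"
        using dm by (intro mult_le_mono2 power_increasing mult_le_mono2) auto
      also have "\<dots> = C' * 2 ^ (i * (n - 1)) * (2 ^ i) ^ m"
        by (simp add: algebra_simps power_add power_mult[symmetric])
      finally show ?thesis by simp
    qed
    ultimately show ?thesis by simp
  qed
  \<comment> \<open>The factor linear in t cannot be avoided: for n = 1 the block bounds are
    constant instead of geometric.\<close>
  have S_le: "S (i0 + t) \<le> (S i0 + C' * t) * 2 ^ ((i0 + t) * (n - 1))" for t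
  proof (induction t)
    case (Suc t)
    have e: "(2::nat) ^ ((i0 + t) * (n - 1)) \<le> 2 ^ ((i0 + Suc t) * (n - 1))"
      by (intro power_increasing mult_le_mono1) auto
    have "S (i0 + Suc t) \<le> S (i0 + t) + C' * 2 ^ ((i0 + t) * (n - 1))" using step[of "i0 + t"] by simp
    also have "\<dots> \<le> (S i0 + C' * t) * 2 ^ ((i0 + t) * (n - 1)) + C' * 2 ^ ((i0 + t) * (n - 1))" using Suc by simp
    also have "\<dots> = (S i0 + C' * Suc t) * 2 ^ ((i0 + t) * (n - 1))" by (simp add: algebra_simps)
    also have "\<dots> \<le> (S i0 + C' * Suc t) * 2 ^ ((i0 + Suc t) * (n - 1))" by (rule mult_le_mono2[OF e])
    finally show ?case .
  qed simp
  \<comment> \<open>The factor \<open>D\<close> in the lower bound is absorbed by b further dyadic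
    blocks.\<close>
  obtain b where b: "D < 2 ^ b" using less_exp by blast
  define B where "B = (2::nat) ^ (b * (n - 1))"
  \<comment> \<open>The linear factor, together with the constants caused by the shift by b, is
    beaten by 2^s, which is at most the surplus factor 2^(i0+s) on the other side.\<close>
  obtain s where s: "(S i0 + C' * b) * B + (C' * B) * s < 2 ^ s" using exists_exp_gt_linear by blast
  let ?i = "i0 + s"
  have "(2 ^ ?i) ^ n \<le> (\<Sum>j\<le>D * 2 ^ ?i. \<mu> j)" by (rule lower)
  also have "\<dots> \<le> S (i0 + (s + b))"
    unfolding S_def
  proof (rule sum_mono2)
    have "D * 2 ^ ?i < 2 ^ b * 2 ^ ?i" using b by simp
    also have "\<dots> = 2 ^ (i0 + (s + b))" by (simp add: power_add mult_ac)
    finally show "{..D * 2 ^ ?i} \<subseteq> {..<2 ^ (i0 + (s + b))}" by auto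
  qed auto
  also have "\<dots> \<le> (S i0 + C' * (s + b)) * 2 ^ ((i0 + (s + b)) * (n - 1))" by (rule S_le)
  also have "\<dots> = ((S i0 + C' * b) * B + (C' * B) * s) * 2 ^ (?i * (n - 1))"
    by (simp add: B_def algebra_simps power_add)
  also have "\<dots> < 2 ^ s * 2 ^ (?i * (n - 1))" using s by simp
  also have "\<dots> \<le> 2 ^ ?i * 2 ^ (?i * (n - 1))" by (intro mult_le_mono1 power_increasing) auto
  also have "\<dots> = 2 ^ (?i + ?i * (n - 1))" by (simp add: power_add)
  also have "?i + ?i * (n - 1) = ?i * n" using assms(1) by (cases n) auto
  finally show False by (simp add: power_mult)
qed

section \<open>Burch's inequality\<close>

context cring
begin

lemma smult_span_ideal_as_module:
  assumes N: "ideal N R" and xs: "set xs \<subseteq> carrier R"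
  shows "smult_span R (set xs) (ideal_as_module R N) = add_multiples N {\<zero>} xs"
proof
  have upper: "U \<subseteq> add_multiples N U xs \<and> (\<forall>x\<in>set xs. \<forall>v\<in>N. x \<otimes> v \<in> add_multiples N U xs)"
    if "ideal U R" "set xs \<subseteq> carrier R" for U xs
    using that
  proof (induction xs arbitrary: U)
    case (Cons x xs)
    have xN: "ideal (multiples x N) R" using Cons.prems N by auto
    note up = set_add_upper[OF Cons.prems(1) xN]
    have "U <+> multiples x N \<subseteq> add_multiples N U (x # xs) \<and>
      (\<forall>y\<in>set xs. \<forall>v\<in>N. y \<otimes> v \<in> add_multiples N U (x # xs))"
      using Cons.IH[OF add_ideals[OF Cons.prems(1) xN]] Cons.prems(2) by simp
    thus ?case using up multiplesI[of _ N x] by auto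
  qed simp
  have zN: "{\<zero>} \<subseteq> N" using ideal_facts(2)[OF N] by simp
  have sub: "submodule (add_multiples N {\<zero>} xs) R (ideal_as_module R N)"
    unfolding submodule_ideal_as_module[OF N]
    using add_multiples_ideal[OF N zeroideal xs] add_multiples_least[OF N zN] ideal_facts(6)[OF N] xs by blast
  show "smult_span R (set xs) (ideal_as_module R N) \<subseteq> add_multiples N {\<zero>} xs"
    unfolding smult_span_def using sub upper[OF zeroideal xs] by (intro Inter_lower) simp
  show "add_multiples N {\<zero>} xs \<subseteq> smult_span R (set xs) (ideal_as_module R N)"
    unfolding smult_span_def
  proof (rule Inter_greatest)
    fix K assume K: "K \<in> {K. submodule K R (ideal_as_module R N) \<and>
      (\<forall>a\<in>set xs. \<forall>v\<in>carrier (ideal_as_module R N). a \<odot>\<^bsub>ideal_as_module R N\<^esub> v \<in> K)}"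
    hence "ideal K R" by (simp add: submodule_ideal_as_module[OF N])
    thus "add_multiples N {\<zero>} xs \<subseteq> K"
      using K ideal_facts(2) by (intro add_multiples_least) auto
  qed
qed

text \<open>The condition at index i concerns the prefix of length i, so the recursive predicate is
  verified prefix by prefix.\<close>

lemma regular_sequence_imp_regular_seq_on:
  assumes N: "ideal N R" and reg: "regular_sequence R (ideal_as_module R N) xs"
  shows "regular_seq_on N {\<zero>} (take m xs)"
proof (induction m)
  case (Suc m)
  show ?case
  proof (cases "m < length xs")
    case True
    have xs: "set xs \<subseteq> carrier R" using reg by (simp add: regular_sequence_def)
    have "set (take m xs) \<subseteq> carrier R" using xs set_take_subset by fastforce
    note span = smult_span_ideal_as_module[OF N this]
    have "\<forall>v\<in>N. xs ! m \<otimes> v \<in> smult_span R (set (take m xs)) (ideal_as_module R N) \<longrightarrow>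
        v \<in> smult_span R (set (take m xs)) (ideal_as_module R N)"
      using reg True by (simp add: regular_sequence_def)
    hence "regular_on (xs ! m) N (add_multiples N {\<zero>} (take m xs))"
      unfolding span regular_on_def .
    thus ?thesis using Suc True by (simp add: take_Suc_conv_app_nth regular_seq_on_snoc)
  qed (use Suc in simp)
qed simp

lemma depth_le:
  assumes N: "ideal N R" "N \<noteq> {\<zero>}" and k: "\<not> depth_ge M N {\<zero>} (Suc k)"
  shows "depth R M (ideal_as_module R N) \<le> ereal (real k)"
proof -
  have "length xs \<le> k" if xs: "set xs \<subseteq> M" "regular_sequence R (ideal_as_module R N) xs" for xs
  proof (rule ccontr)
    assume "\<not> length xs \<le> k"
    hence "length (take (Suc k) xs) = Suc k" by simp
    moreover have "set (take (Suc k) xs) \<subseteq> M" using xs(1) set_take_subset by fastforce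
    ultimately show False
      using k regular_sequence_imp_regular_seq_on[OF N(1) xs(2)] unfolding depth_ge_def by blast
  qed
  thus ?thesis using N(2) unfolding depth_def by (auto intro!: Sup_least)
qed

lemma codim_le_of_prime:
  assumes "primeideal P R" "I \<subseteq> P" shows "codim R I \<le> prime_height R P"
  unfolding codim_def using assms by (intro Inf_lower) blast

text \<open>The bottom of a prime chain of maximal length is a minimal prime.\<close>

lemma ideal_power_nonzero:
  assumes I: "ideal I R" "codim R I > 0"
    and chain: "prime_chain R d P" and dim: "\<And>P. \<not> prime_chain R (Suc d) P"
  shows "ideal_power R I j \<noteq> {\<zero>}"
proof
  assume z: "ideal_power R I j = {\<zero>}"
  have P0: "primeideal (P 0) R" using chain by (simp add: prime_chain_def)
  \<comment> \<open>A proper chain ending in \<open>P 0\<close> could be joined below the maximal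
    chain; so \<open>P 0\<close> has height 0. It contains \<open>I\<close> as soon as some power of
    \<open>I\<close> is zero, which contradicts positive codimension.\<close>
  have "n = 0" if Q: "prime_chain R n Q" "Q n = P 0" for n Q
  proof (rule ccontr)
    assume "n \<noteq> 0"
    then obtain n' where n: "n = Suc n'" by (cases n) auto
    have "prime_chain R (Suc d) (\<lambda>i. if i = 0 then Q n' else P (i - 1))"
      unfolding prime_chain_def
    proof (intro conjI allI impI)
      fix i
      show "i \<le> Suc d \<Longrightarrow> primeideal (if i = 0 then Q n' else P (i - 1)) R"
        using Q chain n by (simp add: prime_chain_def)
      show "i < Suc d \<Longrightarrow> (if i = 0 then Q n' else P (i - 1)) \<subset> (if Suc i = 0 then Q n' else P (Suc i - 1))"
        using Q chain n by (cases i) (auto simp: prime_chain_def)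
    qed
    thus False using dim by blast
  qed
  hence "prime_height R (P 0) \<le> 0" unfolding prime_height_def by (intro Sup_least) auto
  moreover have "I \<subseteq> P 0"
    by (rule primeideal_power_le[OF P0 I(1), of j])
      (use z ideal_facts(2)[OF primeideal_facts(1)[OF P0]] in simp)
  ultimately show False using codim_le_of_prime[OF P0] I(2) by (meson leD order_trans)
qed

end

context noetherian_local_ring
begin

text \<open>The list is a basis of N/\<mm> N over the residue field, extracted from a finite set of
  generators.\<close>

lemma exists_minimal_generators:
  assumes N: "ideal N R"
  shows "\<exists>vs. set vs \<subseteq> N \<and> regular.indep (\<mm> \<cdot> N) vs \<and> N \<subseteq> regular.span (\<mm> \<cdot> N) vs"
proof -
  obtain S where S: "S \<subseteq> carrier R" "finite S" "N = Idl S" using finetely_gen[OF N] by blast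
  obtain ws where ws: "set ws = S" using finite_list[OF S(2)] by blast
  have mN: "ideal (\<mm> \<cdot> N) R" by (rule ideal_prod_is_ideal[OF \<mm>_ideal N])
  have "\<exists>vs. set vs \<subseteq> set ws \<and> regular.span (\<mm> \<cdot> N) vs = regular.span (\<mm> \<cdot> N) ws \<and> regular.indep (\<mm> \<cdot> N) vs"
    using mN S ws by (intro regular.exists_indep_sublist) auto
  moreover have "N \<subseteq> regular.span (\<mm> \<cdot> N) ws"
    unfolding S(3)
  proof (rule genideal_minimal)
    show "ideal (regular.span (\<mm> \<cdot> (Idl S)) ws) R"
      using regular.span_submodule[of "\<mm> \<cdot> N" ws] mN S ws by simp
    show "S \<subseteq> regular.span (\<mm> \<cdot> (Idl S)) ws"
      using regular.span_upper[of "\<mm> \<cdot> N" ws] mN S ws by simp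
  qed
  moreover have "set ws \<subseteq> N" using genideal_self[OF S(1)] ws S(3) by simp
  ultimately show ?thesis by (metis subset_trans)
qed

text \<open>A regular sequence of length k + 1 produces binomials with lower index k, since
  monomials in k + 1 variables of degree j number (j + k choose k); hence \<open>Suc k\<close> in
  the hypothesis and k in the bound. The first bound guarantees that d + 1 - n is not truncated when
  it is later substituted for k.\<close>

lemma fiber_chain_bound:
  assumes I: "ideal I R" and dim: "\<And>P. \<not> prime_chain R (Suc d) P"
    and nz: "\<And>j. ideal_power R I j \<noteq> {\<zero>}"
    and P: "prime_chain (rees_algebra R I Quot rees_extension R I \<mm>) n P"
  shows "n \<le> d + 1" and "\<exists>\<^sub>\<infinity>j. depth_ge \<mm> (ideal_power R I j) {\<zero>} (Suc k) \<Longrightarrow> n + k \<le> d"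
proof -
  let ?I = "ideal_power R I"
  have "\<exists>vs. set vs \<subseteq> ?I j \<and> regular.indep (\<mm> \<cdot> ?I j) vs \<and> ?I j \<subseteq> regular.span (\<mm> \<cdot> ?I j) vs" for j
    by (rule exists_minimal_generators) (use I in auto)
  then obtain vs where vs: "\<And>j. set (vs j) \<subseteq> ?I j" "\<And>j. regular.indep (\<mm> \<cdot> ?I j) (vs j)"
    "\<And>j. ?I j \<subseteq> regular.span (\<mm> \<cdot> ?I j) (vs j)" by metis
  define \<mu> where "\<mu> j = length (vs j)" for j
  obtain D where D: "\<And>N. N ^ n \<le> (\<Sum>j\<le>D * N. \<mu> j)"
    using prime_chain_fiber_growth[OF I P vs(1,3)] unfolding \<mu>_def by blast
  have pos: "\<mu> j \<ge> 1" for j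
  proof -
    have "vs j \<noteq> []" using vs(3)[of j] nakayama[OF ideal_power_ideal[OF I] nz, of j] by auto
    thus ?thesis by (cases "vs j") (auto simp: \<mu>_def)
  qed
  show "n \<le> d + 1"
  proof (cases "n = 0")
    case False
    show ?thesis
    proof (cases "I \<subseteq> \<mm>")
      case True
      obtain C where C: "\<And>N. (\<Sum>n<N. \<mu> n) \<le> C * N ^ d"
        using sum_length_indep_le[OF I True dim] vs(1,2) unfolding \<mu>_def by metis
      \<comment> \<open>Without a regular sequence the binomial factor is 1, the case m = 0 of the
        comparison, and even \<open>n \<le> d\<close> results.\<close>
      have "(\<Sum>j=0..<N. \<mu> j * ((j + 0) choose 0)) \<le> C * N ^ d" for N
        using C[of N] by (simp add: atLeast0LessThan)
      from growth_comparison[OF _ D this] False show ?thesis by simp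
    next
      case notm: False
      \<comment> \<open>For the unit ideal the fiber cone is the polynomial ring in one variable
        over the residue field; one generator suffices for each power, and the comparison with
        exponent 1 yields \<open>n \<le> 1\<close>.\<close>
      have "I = carrier R" using proper_le_\<mm>[OF I] notm ideal.one_imp_carrier[OF I] by blast
      hence pw: "?I j = carrier R" for j by (induction j) (auto simp: carrier_prod oneideal)
      have "\<mu> j \<le> 1" for j
      proof -
        have "length (vs j) \<le> length [\<one>]"
        proof (rule regular.steinitz[where \<mm>=\<mm> and P=\<mm>])
          show "regular.indep \<mm> (vs j)" using vs(2)[of j] by (simp add: pw ideal_prod_one)
          have "carrier R \<subseteq> regular.span \<mm> [\<one>]"
          proof
            fix x assume x: "x \<in> carrier R"
            have "regular.adjoin \<mm> \<one> = \<mm> <+> PIdl \<one>" by (rule regular_adjoin)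
            moreover have "x \<in> PIdl \<one>" using x by (auto simp: cgenideal_def intro!: exI[of _ x])
            ultimately show "x \<in> regular.span \<mm> [\<one>]"
              using set_add_upper(2)[OF \<mm>_ideal cgenideal_ideal[OF one_closed]] by auto
          qed
          thus "set (vs j) \<subseteq> regular.span \<mm> [\<one>]" using vs(1)[of j] by (auto simp: pw)
        qed (use inverse_ex \<mm>_facts in auto)
        thus ?thesis by (simp add: \<mu>_def)
      qed
      hence "(\<Sum>j=0..<N. \<mu> j * ((j + 0) choose 0)) \<le> 1 * N ^ 1" for N
        using sum_bounded_above[of "{0..<N}" \<mu> 1] by simp
      from growth_comparison[OF _ D this] False show ?thesis by simp
    qed
  qed simp
  assume inf: "\<exists>\<^sub>\<infinity>j. depth_ge \<mm> (?I j) {\<zero>} (Suc k)"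
  obtain xs j\<^sub>0 where xs: "length xs = Suc k" "set xs \<subseteq> \<mm>" "\<And>j. j \<ge> j\<^sub>0 \<Longrightarrow> regular_seq_on (?I j) {\<zero>} xs"
    using exists_stable_regular_seq[OF \<mm>_ideal I inf] by blast
  have "xs \<noteq> []" using xs(1) by auto
  from sum_length_indep_regular_seq_le[OF I dim xs(2) this xs(3) vs(2,1)]
  obtain C where C: "\<And>N. (\<Sum>j=j\<^sub>0..<N. \<mu> j * ((j + k) choose k)) \<le> C * N ^ d"
    unfolding \<mu>_def xs(1) by auto
  show "n + k \<le> d"
  proof (cases "n = 0")
    case False thus ?thesis by (intro growth_comparison[OF _ D C]) simp
  next
    case True
    \<comment> \<open>The comparison requires a positive exponent. As every \<open>\<mu> j\<close>
      is at least 1 by Nakayama's lemma, linear growth is available in any case, and 1 + k is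
      bounded by d.\<close>
    have "N ^ 1 \<le> (\<Sum>j\<le>1 * N. \<mu> j)" for N
      using sum_mono[of "{..N}" "\<lambda>_. 1" \<mu>] pos by simp
    from growth_comparison[OF _ this C] show ?thesis using True by simp
  qed
qed

lemma exists_krull_dim:
  assumes "krull_dim R \<noteq> \<infinity>"
  shows "\<exists>d P. krull_dim R = ereal (real d) \<and> prime_chain R d P \<and> (\<forall>P. \<not> prime_chain R (Suc d) P)"
proof -
  define A where "A = {n. \<exists>P. prime_chain R n P}"
  have kd: "krull_dim R = Sup ((\<lambda>n. ereal (real n)) ` A)"
    unfolding krull_dim_def A_def by (rule arg_cong[of _ _ Sup]) auto
  have "prime_chain R 0 (\<lambda>_. \<mm>)" using prime_\<mm> by (simp add: prime_chain_def)
  hence ne: "A \<noteq> {}" by (auto simp: A_def)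
  have up: "ereal (real n) \<le> krull_dim R" if "n \<in> A" for n unfolding kd using that by (intro Sup_upper) auto
  have "krull_dim R \<noteq> -\<infinity>" using up ne by fastforce
  then obtain r where r: "krull_dim R = ereal r" using assms by (cases "krull_dim R") auto
  have "n \<le> nat \<lceil>r\<rceil>" if "n \<in> A" for n using up[OF that] unfolding r by simp linarith
  hence fin: "finite A" using finite_nat_set_iff_bounded_le by blast
  define d where "d = Max A"
  have d: "d \<in> A" "\<And>n. n \<in> A \<Longrightarrow> n \<le> d" unfolding d_def using fin ne by auto
  have "krull_dim R \<le> ereal (real d)" unfolding kd using d(2) by (intro Sup_least) auto
  hence "krull_dim R = ereal (real d)" using up[OF d(1)] by simp
  moreover have "\<not> prime_chain R (Suc d) P" for P using d(2)[of "Suc d"] by (auto simp: A_def)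
  ultimately show ?thesis using d(1) by (auto simp: A_def)
qed

end

theorem corollary3p2:
  fixes R :: "('a, 'b) ring_scheme" and \<mm> I :: "'a set"
  assumes "noetherian_ring R" and "local_ring R \<mm>"
    and "ideal I R" and "codim R I > 0"
  shows "analytic_spread R \<mm> I \<le>
    krull_dim R - limsup (\<lambda>j::nat. depth R \<mm> (ideal_as_module R (ideal_power R I j))) + 1"
proof -
  interpret noetherian_local_ring R \<mm>
    using assms(1,2) by (simp add: noetherian_local_ring_def noetherian_cring_def local_ring_def)
  let ?depth = "\<lambda>j. depth R \<mm> (ideal_as_module R (ideal_power R I j))"
  show ?thesis
  proof (cases "krull_dim R = \<infinity>")
    \<comment> \<open>In the extended reals infinity minus anything is infinity, so the right-hand
      side is infinite.\<close>
    case True thus ?thesis by simp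
  next
    case False
    then obtain d P where d: "krull_dim R = ereal (real d)" "prime_chain R d P" "\<And>P. \<not> prime_chain R (Suc d) P"
      using exists_krull_dim by blast
    note nz = ideal_power_nonzero[OF assms(3,4) d(2,3)]
    show ?thesis
      unfolding analytic_spread_def krull_dim_def[of "_ Quot _"]
    proof (rule Sup_least, safe)
      fix n Q assume Q: "prime_chain (rees_algebra R I Quot rees_extension R I \<mm>) n Q"
      have n: "n \<le> d + 1" by (rule fiber_chain_bound(1)[OF assms(3) d(3) nz Q])
      \<comment> \<open>Depth at least d + 2 - n for infinitely many powers would give d + 1 \<le>
        d; hence the depth is eventually at most d + 1 - n.\<close>
      have "\<not> (\<exists>\<^sub>\<infinity>j. depth_ge \<mm> (ideal_power R I j) {\<zero>\<^bsub>R\<^esub>} (Suc (d + 1 - n)))"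
      proof
        assume "\<exists>\<^sub>\<infinity>j. depth_ge \<mm> (ideal_power R I j) {\<zero>\<^bsub>R\<^esub>} (Suc (d + 1 - n))"
        hence "n + (d + 1 - n) \<le> d" by (rule fiber_chain_bound(2)[OF assms(3) d(3) nz Q])
        thus False using n by simp
      qed
      hence "eventually (\<lambda>j. \<not> depth_ge \<mm> (ideal_power R I j) {\<zero>\<^bsub>R\<^esub>} (Suc (d + 1 - n))) sequentially"
        by (simp add: not_frequently cofinite_eq_sequentially)
      hence "eventually (\<lambda>j. ?depth j \<le> ereal (real (d + 1 - n))) sequentially"
        by eventually_elim (use depth_le[OF ideal_power_ideal[OF assms(3)] nz] in auto)
      hence "limsup ?depth \<le> ereal (real (d + 1 - n))" by (rule Limsup_bounded)
      thus "ereal (real n) \<le> krull_dim R - limsup ?depth + 1"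
        unfolding d(1) using n by (cases "limsup ?depth") (auto simp: of_nat_diff)
    qed
  qed
qed

end
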